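(* Let $\omega$ be a continuous, translation-invariant 2-cocycle on $\mathscr{S}\mathfrak{g}_{\mathbb{C}}$ which is $G$-invariant. Then $\omega$ is proportional to the cocycle $$(\xi,\eta)\longmapsto \frac{1}{2\pi i}\int_{\mathbb{R}} \langle \xi(t),\eta'(t)\rangle\,dt ,$$ i.e. there is a constant $c\in\mathbb{C}$ with $\omega(\xi,\eta)=\frac{c}{2\pi i}\int_{\mathbb{R}}\langle \xi(t),\eta'(t)\rangle\,dt$ for all $\xi,\eta\in\mathscr{S}\mathfrak{g}_{\mathbb{C}}$.
   Context: $G$ is a compact, simple, simply connected Lie group, $\mathfrak{g}$ its Lie algebra, $\mathfrak{g}_{\mathbb{C}}$ the complexification, and $\langle\cdot,\cdot\rangle$ the invariant symmetric bilinear form on $\mathfrak{g}_{\mathbb{C}}$ (unique up to scalar; a multiple of the Killing form). $\mathscr{S}\mathfrak{g}_{\mathbb{C}}=\mathfrak{g}_{\mathbb{C}}\otimes\mathscr{S}(\mathbb{R})$ is the Lie algebra of smooth rapidly decreasing (Schwartz) maps $\xi:\mathbb{R}\to\mathfrak{g}_{\mathbb{C}}$ with pointwise bracket $[\xi,\eta](t)=[\xi(t),\eta(t)]$ and the Schwartz topology in each component. A 2-cocycle on a complex Lie algebra $\mathfrak{k}$ is a bilinear form $\omega:\mathfrak{k}\times\mathfrak{k}\to\mathbb{C}$ with $\omega(\xi,\eta)=-\omega(\eta,\xi)$ and $\omega([\xi,\eta],\zeta)+\omega([\eta,\zeta],\xi)+\omega([\zeta,\xi],\eta)=0$. $\omega$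 is translation-invariant if $\omega(\xi_a,\eta_a)=\omega(\xi,\eta)$ for all $a\in\mathbb{R}$, where $\xi_a(t)=\xi(t-a)$. $G$ acts on $\mathscr{S}\mathfrak{g}_{\mathbb{C}}$ by the pointwise adjoint action, and $\omega$ is $G$-invariant if $\omega(g^{-1}\xi,g^{-1}\eta)=\omega(\xi,\eta)$ for all $g\in G$. *)

theory Defs
  imports "HOL-Analysis.Analysis" "HOL-Algebra.Group"
begin

section \<open>Smooth manifolds and Lie groups\<close>

fun Ck_on :: "nat \<Rightarrow> ('a::euclidean_space \<Rightarrow> 'b::euclidean_space) \<Rightarrow> 'a set \<Rightarrow> bool" where
  "Ck_on 0 f S \<longleftrightarrow> continuous_on S f"
| "Ck_on (Suc k) f S \<longleftrightarrow> (\<forall>x\<in>S. f differentiable (at x)) \<and>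
     (\<forall>v. Ck_on k (\<lambda>x. frechet_derivative f (at x) v) S)"

text \<open>Meaningful for open \<open>S\<close> only.\<close>

definition smooth_on :: "('a::euclidean_space \<Rightarrow> 'b::euclidean_space) \<Rightarrow> 'a set \<Rightarrow> bool" where
  "smooth_on f S \<longleftrightarrow> (\<forall>k. Ck_on k f S)"

text \<open>A chart is a pair of its domain and its coordinate map; values of the coordinate map outside
  the domain are irrelevant.\<close>

type_synonym ('m, 'e) chart = "'m set \<times> ('m \<Rightarrow> 'e)"

definition param :: "('m, 'e) chart \<Rightarrow> 'e \<Rightarrow> 'm" where
  "param c = inv_into (fst c) (snd c)"

definition smooth_atlas ::
    "('m::{t2_space,second_countable_topology}, 'e::euclidean_space) chart set \<Rightarrow> bool" where
  "smooth_atlas A \<longleftrightarrow>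
     (\<Union>c\<in>A. fst c) = UNIV \<and>
     (\<forall>c\<in>A. open (fst c) \<and> open (snd c ` fst c) \<and>
        homeomorphism (fst c) (snd c ` fst c) (snd c) (param c)) \<and>
     (\<forall>c\<in>A. \<forall>d\<in>A. smooth_on (snd d \<circ> param c) (snd c ` (fst c \<inter> fst d)))"

definition smooth_map ::
    "('m::topological_space, 'e::euclidean_space) chart set \<Rightarrow>
     ('n::topological_space, 'f::euclidean_space) chart set \<Rightarrow> ('m \<Rightarrow> 'n) \<Rightarrow> bool" where
  "smooth_map A B f \<longleftrightarrow> continuous_on UNIV f \<and>
     (\<forall>c\<in>A. \<forall>d\<in>B. smooth_on (snd d \<circ> f \<circ> param c) (snd c ` (fst c \<inter> f -` fst d)))"

definition prod_atlas :: "('m, 'e) chart set \<Rightarrow> ('n, 'f) chart set \<Rightarrow> ('m \<times> 'n, 'e \<times> 'f) chart set" where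
  "prod_atlas A B = {(fst c \<times> fst d, map_prod (snd c) (snd d)) | c d. c \<in> A \<and> d \<in> B}"

definition lie_group ::
    "'g::{t2_space,second_countable_topology} monoid \<Rightarrow> ('g, 'e::euclidean_space) chart set \<Rightarrow> bool" where
  "lie_group G A \<longleftrightarrow>
     group G \<and> carrier G = UNIV \<and> smooth_atlas A \<and>
     smooth_map (prod_atlas A A) A (\<lambda>(g, h). g \<otimes>\<^bsub>G\<^esub> h) \<and>
     smooth_map A A (\<lambda>g. inv\<^bsub>G\<^esub> g)"


section \<open>The Lie algebra\<close>

text \<open>A chart \<open>c\<close> around the identity identifies the tangent space at the identity with the
  model space \<open>'e\<close>. The Lie algebra is this vector space; \<open>Ad g\<close> is the
  derivative at the identity of the conjugation by \<open>g\<close>, and the bracket is the derivative of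
  \<open>Ad\<close> at the identity, \<open>[v, w] = (d Ad)(v) w\<close>, both written in the chart \<open>c\<close>.\<close>

definition Ad :: "'g monoid \<Rightarrow> ('g, 'e::euclidean_space) chart \<Rightarrow> 'g \<Rightarrow> 'e \<Rightarrow> 'e" where
  "Ad G c g = frechet_derivative
     (\<lambda>x. snd c (g \<otimes>\<^bsub>G\<^esub> param c x \<otimes>\<^bsub>G\<^esub> inv\<^bsub>G\<^esub> g)) (at (snd c \<one>\<^bsub>G\<^esub>))"

definition lie_bracket :: "'g monoid \<Rightarrow> ('g, 'e::euclidean_space) chart \<Rightarrow> 'e \<Rightarrow> 'e \<Rightarrow> 'e" where
  "lie_bracket G c v w =
     frechet_derivative (\<lambda>x. Ad G c (param c x) w) (at (snd c \<one>\<^bsub>G\<^esub>)) v"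

definition simple_lie_algebra :: "('e::euclidean_space \<Rightarrow> 'e \<Rightarrow> 'e) \<Rightarrow> bool" where
  "simple_lie_algebra br \<longleftrightarrow>
     (\<exists>x y. br x y \<noteq> 0) \<and>
     (\<forall>I. subspace I \<and> (\<forall>x. \<forall>y\<in>I. br x y \<in> I) \<longrightarrow> I = {0} \<or> I = UNIV)"


section \<open>Complexification of \<open>real ^ 'n\<close> as \<open>complex ^ 'n\<close>\<close>

definition Re_vec :: "complex ^ 'n \<Rightarrow> real ^ 'n" where
  "Re_vec z = (\<chi> i. Re (z $ i))"

definition Im_vec :: "complex ^ 'n \<Rightarrow> real ^ 'n" where
  "Im_vec z = (\<chi> i. Im (z $ i))"

definition Complex_vec :: "real ^ 'n \<Rightarrow> real ^ 'n \<Rightarrow> complex ^ 'n" where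
  "Complex_vec x y = (\<chi> i. Complex (x $ i) (y $ i))"

definition complexify :: "(real ^ 'n \<Rightarrow> real ^ 'm) \<Rightarrow> complex ^ 'n \<Rightarrow> complex ^ 'm" where
  "complexify f z = Complex_vec (f (Re_vec z)) (f (Im_vec z))"

definition complexify2 ::
    "(real ^ 'n \<Rightarrow> real ^ 'n \<Rightarrow> real ^ 'n) \<Rightarrow> complex ^ 'n \<Rightarrow> complex ^ 'n \<Rightarrow> complex ^ 'n" where
  "complexify2 br z w = Complex_vec
     (br (Re_vec z) (Re_vec w) - br (Im_vec z) (Im_vec w))
     (br (Re_vec z) (Im_vec w) + br (Im_vec z) (Re_vec w))"

definition invariant_symmetric_form ::
    "(complex ^ 'n \<Rightarrow> complex ^ 'n \<Rightarrow> complex ^ 'n) \<Rightarrow>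
     (complex ^ 'n \<Rightarrow> complex ^ 'n \<Rightarrow> complex) \<Rightarrow> bool" where
  "invariant_symmetric_form br B \<longleftrightarrow>
     (\<forall>x. Vector_Spaces.linear (*s) (*) (B x)) \<and>
     (\<forall>x y. B x y = B y x) \<and>
     (\<forall>x y z. B (br x y) z + B y (br x z) = 0)"


section \<open>Schwartz functions\<close>

definition vderiv :: "(real \<Rightarrow> 'e::real_normed_vector) \<Rightarrow> real \<Rightarrow> 'e" where
  "vderiv f t = vector_derivative f (at t)"

definition schwartz :: "(real \<Rightarrow> 'e::real_normed_vector) set" where
  "schwartz = {f. (\<forall>m t. (vderiv ^^ m) f differentiable (at t)) \<and>
                  (\<forall>k m. bounded (range (\<lambda>t. t ^ k *\<^sub>R (vderiv ^^ m) f t)))}"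

definition schwartz_seminorm :: "nat \<Rightarrow> nat \<Rightarrow> (real \<Rightarrow> 'e::real_normed_vector) \<Rightarrow> real" where
  "schwartz_seminorm k m f = (SUP t. norm (t ^ k *\<^sub>R (vderiv ^^ m) f t))"

text \<open>The locally convex topology on \<open>schwartz\<close> defined by the seminorms.\<close>

definition schwartz_topology :: "(real \<Rightarrow> 'e::real_normed_vector) topology" where
  "schwartz_topology = topology_generated_by
     {{g \<in> schwartz. schwartz_seminorm k m (\<lambda>t. g t - f t) < \<epsilon>} | f k m \<epsilon>. f \<in> schwartz \<and> 0 < \<epsilon>}"


section \<open>Cocycles on the Lie algebra of Schwartz functions\<close>

type_synonym 'n form = "(real \<Rightarrow> complex ^ 'n) \<Rightarrow> (real \<Rightarrow> complex ^ 'n) \<Rightarrow> complex"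

definition schwartz_bilinear :: "'n::finite form \<Rightarrow> bool" where
  "schwartz_bilinear \<omega> \<longleftrightarrow>
     (\<forall>\<xi>\<in>schwartz. \<forall>\<eta>\<in>schwartz. \<forall>\<zeta>\<in>schwartz. \<forall>a b.
        \<omega> (\<lambda>t. a *s \<xi> t + b *s \<eta> t) \<zeta> = a * \<omega> \<xi> \<zeta> + b * \<omega> \<eta> \<zeta> \<and>
        \<omega> \<zeta> (\<lambda>t. a *s \<xi> t + b *s \<eta> t) = a * \<omega> \<zeta> \<xi> + b * \<omega> \<zeta> \<eta>)"

definition two_cocycle :: "(complex ^ 'n \<Rightarrow> complex ^ 'n \<Rightarrow> complex ^ 'n) \<Rightarrow> 'n::finite form \<Rightarrow> bool" where
  "two_cocycle br \<omega> \<longleftrightarrow>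
     schwartz_bilinear \<omega> \<and>
     (\<forall>\<xi>\<in>schwartz. \<forall>\<eta>\<in>schwartz. \<omega> \<xi> \<eta> = - \<omega> \<eta> \<xi>) \<and>
     (\<forall>\<xi>\<in>schwartz. \<forall>\<eta>\<in>schwartz. \<forall>\<zeta>\<in>schwartz.
        \<omega> (\<lambda>t. br (\<xi> t) (\<eta> t)) \<zeta> + \<omega> (\<lambda>t. br (\<eta> t) (\<zeta> t)) \<xi> + \<omega> (\<lambda>t. br (\<zeta> t) (\<xi> t)) \<eta> = 0)"

definition continuous_form :: "'n::finite form \<Rightarrow> bool" where
  "continuous_form \<omega> \<longleftrightarrow>
     continuous_map (prod_topology schwartz_topology schwartz_topology) euclidean (\<lambda>(\<xi>, \<eta>). \<omega> \<xi> \<eta>)"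

definition translation_invariant :: "'n::finite form \<Rightarrow> bool" where
  "translation_invariant \<omega> \<longleftrightarrow>
     (\<forall>\<xi>\<in>schwartz. \<forall>\<eta>\<in>schwartz. \<forall>a. \<omega> (\<lambda>t. \<xi> (t - a)) (\<lambda>t. \<eta> (t - a)) = \<omega> \<xi> \<eta>)"

definition group_invariant :: "'g monoid \<Rightarrow> ('g, real ^ 'n::finite) chart \<Rightarrow> 'n form \<Rightarrow> bool" where
  "group_invariant G c \<omega> \<longleftrightarrow>
     (\<forall>\<xi>\<in>schwartz. \<forall>\<eta>\<in>schwartz. \<forall>g\<in>carrier G.
        \<omega> (\<lambda>t. complexify (Ad G c (inv\<^bsub>G\<^esub> g)) (\<xi> t)) (\<lambda>t. complexify (Ad G c (inv\<^bsub>G\<^esub> g)) (\<eta> t)) = \<omega> \<xi> \<eta>)"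

end

theory Submission
  imports Defs "HOL-Computational_Algebra.Polynomial" "HOL-Probability.Sinc_Integral"
begin

text \<open>On real tensors \<open>f \<otimes> X\<close>, invariance and simplicity force \<open>\<omega> (f \<otimes> X) (h \<otimes> Y) = D f h \<cdot> \<langle>X, Y\<rangle>\<close>,
  where \<open>\<langle>_, _\<rangle>\<close> is an \<open>Ad\<close>-invariant inner product, which exists by compactness. Since
  \<open>\<langle>[X, Y], Z\<rangle>\<close> is cyclic, \<open>D\<close> is a skew form with \<open>D (f g) h + D (g h) f + D (h f) g = 0\<close>.
  By this identity \<open>L f g = D f (t g) - D (t f) g\<close> depends only on the product \<open>f g\<close>, and by
  translation invariance of \<open>D\<close> it annihilates derivatives, so \<open>L f g = c \<integral> f g\<close>. Iterating,
  \<open>D f (p g) - D (p f) g = c \<integral> p' f g\<close> for polynomials \<open>p\<close>, hence, by the Weierstrass theorem and continuity,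
  for test functions \<open>p\<close>. The cyclic identity turns this into \<open>D f u = c \<integral> f u'\<close>, and test functions are dense.\<close>

section \<open>Smooth functions on the line\<close>

text \<open>The constant function 1 is not a Schwartz function, so neither \<open>D\<close> nor
  \<open>L\<close> can be evaluated at it. Functions equal to 1 on a large interval take its place,
  and the algebra is done on test functions, where such a plateau can be chosen to be 1 on the
  relevant supports. The reason for \<open>L\<close>, the commutator of \<open>D\<close> with
  multiplication by t: for the expected answer, \<open>D f g\<close> = integral of f g', it is the
  integral of f g, so it removes the derivative and isolates the constant, and no distribution
  kernel on the plane is needed. Continuity enters solely as an estimate of \<open>\<omega>\<close>,
  and hence of \<open>D\<close>, by a product of Schwartz seminorms of finite order; limits
  involving \<open>D\<close> become bounds that are linear in a small parameter a. On the Lie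
  algebra side, \<open>Ad\<close> and the bracket are bare derivatives in a chart, so that
  bilinearity, the Jacobi identity and skew symmetry have to be derived. The invariant inner product
  comes from a minimisation over the convex hull of an orbit, in place of an average over Haar
  measure.\<close>

definition smooth :: "(real \<Rightarrow> 'e::real_normed_vector) \<Rightarrow> bool" where
  "smooth f \<longleftrightarrow> (\<forall>m t. (vderiv ^^ m) f differentiable (at t))"

lemma vderiv_eqI:
  assumes "\<And>t. (f has_vector_derivative g t) (at t)"
  shows "vderiv f = g"
  using assms by (auto simp: vderiv_def vector_derivative_at)

lemma funpow_vderiv_Suc: "(vderiv ^^ Suc m) f = (vderiv ^^ m) (vderiv f)"
  by (simp add: funpow_Suc_right del: funpow.simps)

text \<open>Induction on m keeps every iterated derivative inside \<open>P\<close>, so exhibiting a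
  class closed under differentiation replaces formulas for higher derivatives.\<close>

lemma smooth_coinduct:
  assumes "P f" and step: "\<And>g. P g \<Longrightarrow> \<exists>g'. P g' \<and> (\<forall>t. (g has_vector_derivative g' t) (at t))"
  shows "smooth f"
proof -
  have *: "P ((vderiv ^^ m) f)" for m
  proof (induction m)
    case (Suc m)
    then show ?case using step[OF Suc] vderiv_eqI by fastforce
  qed (use assms in simp)
  then show ?thesis
    unfolding smooth_def by (meson step differentiableI_vector)
qed

lemma smooth_vderiv: "smooth f \<Longrightarrow> smooth (vderiv f)"
  unfolding smooth_def by (metis funpow_vderiv_Suc)

lemma smooth_funpow_vderiv: "smooth f \<Longrightarrow> smooth ((vderiv ^^ m) f)"
  by (induction m) (auto intro: smooth_vderiv)

lemma smooth_has_vector_derivative: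
  assumes "smooth f" shows "(f has_vector_derivative vderiv f t) (at t)"
proof -
  have "f differentiable (at t)"
    using assms unfolding smooth_def by (metis funpow_0)
  then show ?thesis by (simp add: vderiv_def vector_derivative_works)
qed

lemma smooth_continuous_on: "smooth f \<Longrightarrow> continuous_on S f"
  by (meson continuous_at_imp_continuous_on has_vector_derivative_continuous
      smooth_has_vector_derivative)

lemma smoothI:
  assumes "\<And>t. (f has_vector_derivative g t) (at t)" "smooth g"
  shows "smooth f"
  by (rule smooth_coinduct[where P="\<lambda>h. h = f \<or> smooth h"])
     (use assms smooth_has_vector_derivative smooth_vderiv in blast)+

lemma smooth_const: "smooth (\<lambda>t. a)"
  by (rule smooth_coinduct[where P="\<lambda>h. \<exists>a. h = (\<lambda>t. a)"]) (auto intro!: derivative_eq_intros exI)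

lemma vderiv_const: "vderiv (\<lambda>t. a) = (\<lambda>t. 0)"
  by (rule vderiv_eqI) (auto intro!: derivative_eq_intros)

lemma funpow_vderiv_zero: "(vderiv ^^ m) (\<lambda>t. 0) = (\<lambda>t. 0)"
  by (induction m) (auto simp: vderiv_const)

lemma vderiv_add:
  assumes "smooth f" "smooth g"
  shows "vderiv (\<lambda>t. f t + g t) = (\<lambda>t. vderiv f t + vderiv g t)"
  by (rule vderiv_eqI) (intro has_vector_derivative_add smooth_has_vector_derivative assms)

lemma smooth_add:
  assumes "smooth f" "smooth g" shows "smooth (\<lambda>t. f t + g t)"
proof (rule smooth_coinduct[where P="\<lambda>h. \<exists>f g. smooth f \<and> smooth g \<and> h = (\<lambda>t. f t + g t)"])
  fix h assume "\<exists>f g. smooth f \<and> smooth g \<and> h = (\<lambda>t. f t + g t)"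
  then obtain f g where fg: "smooth f" "smooth g" "h = (\<lambda>t. f t + g t)" by blast
  have "\<forall>t. (h has_vector_derivative vderiv f t + vderiv g t) (at t)"
    unfolding fg(3) by (intro allI has_vector_derivative_add smooth_has_vector_derivative fg)
  then show "\<exists>h'. (\<exists>f g. smooth f \<and> smooth g \<and> h' = (\<lambda>t. f t + g t)) \<and>
      (\<forall>t. (h has_vector_derivative h' t) (at t))"
    using fg smooth_vderiv by blast
qed (use assms in blast)

lemma funpow_vderiv_add:
  assumes "smooth f" "smooth g"
  shows "(vderiv ^^ m) (\<lambda>t. f t + g t) = (\<lambda>t. (vderiv ^^ m) f t + (vderiv ^^ m) g t)"
  by (induction m) (simp_all add: vderiv_add smooth_funpow_vderiv assms)

lemma vderiv_linear:
  assumes "bounded_linear T" "smooth f"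
  shows "vderiv (\<lambda>t. T (f t)) = (\<lambda>t. T (vderiv f t))"
  by (rule vderiv_eqI) (intro bounded_linear.has_vector_derivative[OF assms(1)] smooth_has_vector_derivative assms)

lemma smooth_linear:
  assumes T: "bounded_linear T" and "smooth f" shows "smooth (\<lambda>t. T (f t))"
proof (rule smooth_coinduct[where P="\<lambda>h. \<exists>f. smooth f \<and> h = (\<lambda>t. T (f t))"])
  fix h assume "\<exists>f. smooth f \<and> h = (\<lambda>t. T (f t))"
  then obtain f where f: "smooth f" "h = (\<lambda>t. T (f t))" by blast
  have "\<forall>t. (h has_vector_derivative T (vderiv f t)) (at t)"
    unfolding f(2) by (intro allI bounded_linear.has_vector_derivative[OF T] smooth_has_vector_derivative f)
  then show "\<exists>h'. (\<exists>f. smooth f \<and> h' = (\<lambda>t. T (f t))) \<and> (\<forall>t. (h has_vector_derivative h' t) (at t))"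
    using f smooth_vderiv by blast
qed (use assms in blast)

lemma funpow_vderiv_linear:
  assumes "bounded_linear T" "smooth f"
  shows "(vderiv ^^ m) (\<lambda>t. T (f t)) = (\<lambda>t. T ((vderiv ^^ m) f t))"
  by (induction m) (simp_all add: vderiv_linear smooth_funpow_vderiv assms)

lemma vderiv_affine:
  assumes "smooth f"
  shows "vderiv (\<lambda>t. f (s * t + b)) = (\<lambda>t. s *\<^sub>R vderiv f (s * t + b))"
proof (rule vderiv_eqI)
  fix t :: real
  have "((\<lambda>t. s * t + b) has_vector_derivative s) (at t)"
    by (auto intro!: derivative_eq_intros simp: has_real_derivative_iff_has_vector_derivative[symmetric])
  from vector_diff_chain_at[OF this smooth_has_vector_derivative[OF assms]]
  show "((\<lambda>t. f (s * t + b)) has_vector_derivative s *\<^sub>R vderiv f (s * t + b)) (at t)"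
    by (simp add: o_def)
qed

lemma smooth_affine:
  assumes "smooth f" shows "smooth (\<lambda>t. f (s * t + b))"
proof (rule smooth_coinduct[where P="\<lambda>h. \<exists>f. smooth f \<and> h = (\<lambda>t. f (s * t + b))"])
  fix h :: "real \<Rightarrow> 'a" assume "\<exists>f. smooth f \<and> h = (\<lambda>t. f (s * t + b))"
  then obtain f where f: "smooth f" "h = (\<lambda>t. f (s * t + b))" by blast
  have "((\<lambda>t. s * t + b) has_vector_derivative s) (at t)" for t
    by (auto intro!: derivative_eq_intros simp: has_real_derivative_iff_has_vector_derivative[symmetric])
  from vector_diff_chain_at[OF this smooth_has_vector_derivative[OF f(1)]]
  have "\<forall>t. (h has_vector_derivative s *\<^sub>R vderiv f (s * t + b)) (at t)"
    by (simp add: o_def f(2))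
  moreover have "smooth (\<lambda>t. s *\<^sub>R vderiv f t)"
    by (intro smooth_linear[OF bounded_linear_scaleR_right] smooth_vderiv f)
  ultimately show "\<exists>h'. (\<exists>f. smooth f \<and> h' = (\<lambda>t. f (s * t + b))) \<and>
      (\<forall>t. (h has_vector_derivative h' t) (at t))"
    by (intro exI[of _ "\<lambda>t. s *\<^sub>R vderiv f (s * t + b)"] conjI exI[of _ "\<lambda>t. s *\<^sub>R vderiv f t"]) auto
qed (use assms in blast)

lemma funpow_vderiv_affine:
  assumes "smooth f"
  shows "(vderiv ^^ m) (\<lambda>t. f (s * t + b)) = (\<lambda>t. s ^ m *\<^sub>R (vderiv ^^ m) f (s * t + b))"
proof (induction m)
  case (Suc m)
  have "smooth (\<lambda>t. (vderiv ^^ m) f (s * t + b))" by (intro smooth_affine smooth_funpow_vderiv assms)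
  then show ?case
    by (simp add: Suc vderiv_linear[OF bounded_linear_scaleR_right] vderiv_affine smooth_funpow_vderiv assms)
       (simp add: mult.commute)
qed simp

text \<open>The derivative of a product is a sum of two products, so products alone are not closed
  under differentiation; their finite sums are, and serve as the class for
  \<open>smooth_coinduct\<close>.\<close>

inductive product_sum :: "(real \<Rightarrow> 'a::real_normed_algebra) \<Rightarrow> bool" where
  prod: "smooth f \<Longrightarrow> smooth g \<Longrightarrow> product_sum (\<lambda>t. f t * g t)"
| sum: "product_sum f \<Longrightarrow> product_sum g \<Longrightarrow> product_sum (\<lambda>t. f t + g t)"

lemma vderiv_mult:
  fixes f g :: "real \<Rightarrow> 'a::real_normed_algebra"
  assumes "smooth f" "smooth g"
  shows "vderiv (\<lambda>t. f t * g t) = (\<lambda>t. f t * vderiv g t + vderiv f t * g t)"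
  by (rule vderiv_eqI) (intro has_vector_derivative_mult smooth_has_vector_derivative assms)

lemma smooth_mult:
  fixes f g :: "real \<Rightarrow> 'a::real_normed_algebra"
  assumes "smooth f" "smooth g" shows "smooth (\<lambda>t. f t * g t)"
proof (rule smooth_coinduct[where P=product_sum])
  fix h :: "real \<Rightarrow> 'a" assume "product_sum h"
  then show "\<exists>h'. product_sum h' \<and> (\<forall>t. (h has_vector_derivative h' t) (at t))"
  proof induction
    case (prod f g)
    have "product_sum (\<lambda>t. f t * vderiv g t + vderiv f t * g t)"
      by (rule product_sum.sum[OF product_sum.prod[OF prod(1) smooth_vderiv[OF prod(2)]]
            product_sum.prod[OF smooth_vderiv[OF prod(1)] prod(2)]])
    moreover have "((\<lambda>t. f t * g t) has_vector_derivative f t * vderiv g t + vderiv f t * g t) (at t)" for t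
      by (intro has_vector_derivative_mult smooth_has_vector_derivative prod)
    ultimately show ?case by blast
  next
    case (sum f g)
    then obtain f' g' where *: "product_sum f'" "product_sum g'"
      "\<And>t. (f has_vector_derivative f' t) (at t)" "\<And>t. (g has_vector_derivative g' t) (at t)" by blast
    have "((\<lambda>t. f t + g t) has_vector_derivative f' t + g' t) (at t)" for t
      by (intro has_vector_derivative_add *)
    with product_sum.sum[OF *(1,2)] show ?case by blast
  qed
qed (rule product_sum.prod[OF assms])

text \<open>Each differentiation splits a product into two, so m of them give 2^m products of
  derivatives of order at most m; binomial coefficients are not tracked. The bounds are pointwise in
  t, which lets a power of |t| sit inside \<open>b\<close>.\<close>

lemma norm_funpow_vderiv_mult_le:
  fixes f g :: "real \<Rightarrow> 'a::real_normed_algebra"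
  assumes "smooth f" "smooth g" "0 \<le> a" "0 \<le> b"
    and "\<And>i. i \<le> m \<Longrightarrow> norm ((vderiv ^^ i) f t) \<le> a" "\<And>i. i \<le> m \<Longrightarrow> norm ((vderiv ^^ i) g t) \<le> b"
  shows "norm ((vderiv ^^ m) (\<lambda>t. f t * g t) t) \<le> 2 ^ m * (a * b)"
  using assms
proof (induction m arbitrary: f g)
  case 0
  have "norm (f t) \<le> a" "norm (g t) \<le> b" using 0(5)[of 0] 0(6)[of 0] by auto
  then have "norm (f t) * norm (g t) \<le> a * b" by (intro mult_mono) (use 0 in auto)
  then show ?case using norm_mult_ineq[of "f t" "g t"] by simp
next
  case (Suc m)
  have S: "smooth (vderiv f)" "smooth (vderiv g)" using Suc smooth_vderiv by auto
  have A: "norm ((vderiv ^^ i) (vderiv f) t) \<le> a" "norm ((vderiv ^^ i) (vderiv g) t) \<le> b"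
    if "i \<le> m" for i using Suc.prems(5,6)[of "Suc i"] that by (simp_all add: funpow_vderiv_Suc del: funpow.simps)
  have 1: "norm ((vderiv ^^ m) (\<lambda>t. f t * vderiv g t) t) \<le> 2 ^ m * (a * b)"
    by (rule Suc.IH) (use Suc.prems S A in auto)
  have 2: "norm ((vderiv ^^ m) (\<lambda>t. vderiv f t * g t) t) \<le> 2 ^ m * (a * b)"
    by (rule Suc.IH) (use Suc.prems S A in auto)
  have "norm ((vderiv ^^ Suc m) (\<lambda>t. f t * g t) t) =
    norm ((vderiv ^^ m) (\<lambda>t. f t * vderiv g t) t + (vderiv ^^ m) (\<lambda>t. vderiv f t * g t) t)"
    unfolding funpow_vderiv_Suc using Suc.prems S
    by (subst vderiv_mult) (simp_all add: funpow_vderiv_add smooth_mult)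
  also have "\<dots> \<le> 2 ^ m * (a * b) + 2 ^ m * (a * b)" using norm_triangle_mono[OF 1 2] .
  also have "\<dots> = 2 ^ Suc m * (a * b)" by simp
  finally show ?case .
qed

lemma funpow_vderiv_cong_open:
  fixes f g :: "real \<Rightarrow> 'a::real_normed_vector"
  assumes "smooth f" "smooth g" "open S" "\<And>t. t \<in> S \<Longrightarrow> f t = g t" "t \<in> S"
  shows "(vderiv ^^ m) f t = (vderiv ^^ m) g t"
  using assms(5)
proof (induction m arbitrary: t)
  case (Suc m)
  have "((vderiv ^^ m) f has_vector_derivative (vderiv ^^ Suc m) f t) (at t)"
    using smooth_has_vector_derivative[OF smooth_funpow_vderiv[OF assms(1)]] by simp
  then have 1: "((vderiv ^^ m) g has_vector_derivative (vderiv ^^ Suc m) f t) (at t)"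
    by (rule has_vector_derivative_transform_within_open[OF _ assms(3) Suc.prems Suc.IH])
  have "((vderiv ^^ m) g has_vector_derivative (vderiv ^^ Suc m) g t) (at t)"
    using smooth_has_vector_derivative[OF smooth_funpow_vderiv[OF assms(2)]] by simp
  with 1 show ?case by (rule vector_derivative_unique_at)
qed (simp add: assms(4))

lemma smooth_poly: "smooth (\<lambda>t. poly P (complex_of_real t))"
proof (rule smooth_coinduct[where P="\<lambda>h. \<exists>P. h = (\<lambda>t. poly P (complex_of_real t))"])
  fix g :: "real \<Rightarrow> complex" assume "\<exists>P. g = (\<lambda>t. poly P (complex_of_real t))"
  then obtain P where P: "g = (\<lambda>t. poly P (complex_of_real t))" by blast
  show "\<exists>g'. (\<exists>P. g' = (\<lambda>t. poly P (complex_of_real t))) \<and> (\<forall>t. (g has_vector_derivative g' t) (at t))"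
    unfolding P
    by (intro exI[of _ "\<lambda>t. poly (pderiv P) (complex_of_real t)"] conjI allI exI[of _ "pderiv P"] refl
        has_vector_derivative_real_field poly_DERIV)
qed blast

lemma vderiv_poly: "vderiv (\<lambda>t. poly P (complex_of_real t)) = (\<lambda>t. poly (pderiv P) (complex_of_real t))"
  by (rule vderiv_eqI) (intro has_vector_derivative_real_field poly_DERIV)

lemma funpow_vderiv_poly:
  "(vderiv ^^ m) (\<lambda>t. poly P (complex_of_real t)) = (\<lambda>t. poly ((pderiv ^^ m) P) (complex_of_real t))"
  by (induction m) (simp_all add: vderiv_poly)

lemma norm_diff_le_vderiv_bound:
  fixes f :: "real \<Rightarrow> 'a::real_normed_vector"
  assumes "smooth f" "\<And>t. t \<in> {a..b} \<Longrightarrow> norm (vderiv f t) \<le> B" "x \<in> {a..b}" "y \<in> {a..b}"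
  shows "norm (f x - f y) \<le> B * \<bar>x - y\<bar>"
proof -
  have "norm (f x - f y) \<le> B * norm (x - y)"
  proof (rule differentiable_bound[where S="{a..b}" and f'="\<lambda>t h. h *\<^sub>R vderiv f t"])
    show "(f has_derivative (\<lambda>h. h *\<^sub>R vderiv f t)) (at t within {a..b})" for t
      using has_vector_derivative_at_within[OF smooth_has_vector_derivative[OF assms(1)]]
      by (simp add: has_vector_derivative_def)
    show "onorm (\<lambda>h. h *\<^sub>R vderiv f t) \<le> B" if "t \<in> {a..b}" for t
    proof (rule onorm_le)
      fix h :: real
      show "norm (h *\<^sub>R vderiv f t) \<le> B * norm h"
        using mult_right_mono[OF assms(2)[OF that] norm_ge_zero[of h]] by (simp add: mult.commute)
    qed
  qed (use assms in auto)
  then show ?thesis by simp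
qed

lemma constant_of_vderiv_zero:
  fixes f :: "real \<Rightarrow> 'a::real_normed_vector"
  assumes "smooth f" "\<And>t. a \<le> t \<Longrightarrow> t \<le> b \<Longrightarrow> vderiv f t = 0" "a \<le> b"
  shows "f a = f b"
  using norm_diff_le_vderiv_bound[OF assms(1), of a b 0 a b] assms by auto

section \<open>Step functions\<close>

text \<open>The classical flat function exp(-1/x), with a polynomial in 1/x as factor so that the
  family is closed under differentiation.\<close>

definition exp_flat :: "real poly \<Rightarrow> real \<Rightarrow> real" where
  "exp_flat p x = (if x \<le> 0 then 0 else poly p (1 / x) * exp (- (1 / x)))"

lemma poly_exp_flat_limit: "((\<lambda>y. poly p y * exp (- y)) \<longlongrightarrow> 0) (at_top :: real filter)"
proof -
  have "((\<lambda>y::real. y ^ i * exp (- y)) \<longlongrightarrow> 0) at_top" for i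
    using tendsto_power_div_exp_0[of i] by (simp add: exp_minus divide_inverse)
  then have "((\<lambda>y::real. \<Sum>i\<le>degree p. coeff p i * (y ^ i * exp (- y))) \<longlongrightarrow> (\<Sum>i\<le>degree p. coeff p i * 0)) at_top"
    by (intro tendsto_sum tendsto_mult tendsto_const)
  then show ?thesis by (simp add: poly_altdef sum_distrib_right mult.assoc)
qed

text \<open>In y = 1/x one has d/dx = - y^2 d/dy, which takes p(y) exp(-y) to y^2 (p - p')(y)
  exp(-y); \<open>[:0,0,1:]\<close> is y^2. At 0 the difference quotient is y p(y) exp(-y), hence
  \<open>pCons 0 p\<close>.\<close>

lemma exp_flat_has_derivative:
  "(exp_flat p has_real_derivative exp_flat (([:0,0,1:]) * (p - pderiv p)) x) (at x)"
proof -
  consider "x < 0" | "x > 0" | "x = 0" by linarith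
  then show ?thesis
  proof cases
    case 1
    have "((\<lambda>x. 0) has_real_derivative exp_flat (([:0,0,1:]) * (p - pderiv p)) x) (at x)"
      using 1 by (simp add: exp_flat_def)
    then show ?thesis
      by (rule has_field_derivative_transform_within_open[where S="{..<0}"]) (use 1 in \<open>auto simp: exp_flat_def\<close>)
  next
    case 2
    have i: "((\<lambda>x. 1 / x) has_real_derivative - (1 / x^2)) (at x)"
      using 2 by (auto intro!: derivative_eq_intros simp: power2_eq_square)
    have "((\<lambda>x. poly p (1 / x) * exp (- (1 / x))) has_real_derivative
        poly (pderiv p) (1 / x) * - (1 / x^2) * exp (- (1 / x)) + exp (- (1 / x)) * - (- (1 / x^2)) * poly p (1 / x)) (at x)"
      by (rule DERIV_mult[OF DERIV_chain2[OF poly_DERIV i] DERIV_chain2[OF DERIV_exp DERIV_minus[OF i]]])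
    also have "poly (pderiv p) (1 / x) * - (1 / x^2) * exp (- (1 / x)) + exp (- (1 / x)) * - (- (1 / x^2)) * poly p (1 / x)
      = exp_flat ([:0,0,1:] * (p - pderiv p)) x"
      using 2 by (simp add: exp_flat_def algebra_simps power2_eq_square)
    finally have "((\<lambda>x. poly p (1 / x) * exp (- (1 / x))) has_real_derivative exp_flat ([:0,0,1:] * (p - pderiv p)) x) (at x)" .
    then show ?thesis
      by (rule has_field_derivative_transform_within_open[where S="{0<..}"]) (use 2 in \<open>auto simp: exp_flat_def\<close>)
  next
    case 3
    have R: "((\<lambda>h. exp_flat p h / h) \<longlongrightarrow> 0) (at_right 0)"
    proof -
      have "((\<lambda>h. poly (pCons 0 p) (inverse h) * exp (- inverse h)) \<longlongrightarrow> 0) (at_right (0::real))"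
        by (rule filterlim_compose[OF poly_exp_flat_limit filterlim_inverse_at_top_right])
      then show ?thesis
      proof (rule Lim_transform_eventually)
        show "\<forall>\<^sub>F h in at_right 0. poly (pCons 0 p) (inverse h) * exp (- inverse h) = exp_flat p h / h"
          by (auto simp: eventually_at_filter exp_flat_def field_simps)
      qed
    qed
    have L: "((\<lambda>h. exp_flat p h / h) \<longlongrightarrow> 0) (at_left 0)"
      by (rule Lim_transform_eventually[OF tendsto_const]) (auto simp: eventually_at_filter exp_flat_def)
    have "((\<lambda>h. exp_flat p h / h) \<longlongrightarrow> 0) (at 0)" using L R by (rule filterlim_split_at)
    then show ?thesis using 3 by (simp add: DERIV_def exp_flat_def)
  qed
qed

lemma smooth_exp_flat: "smooth (exp_flat p)"
  by (rule smooth_coinduct[where P="\<lambda>h. \<exists>p. h = exp_flat p"])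
     (use exp_flat_has_derivative has_real_derivative_iff_has_vector_derivative in blast)+

lemma smooth_antiderivative:
  fixes w :: "real \<Rightarrow> 'a::euclidean_space"
  assumes "smooth w"
  obtains F where "smooth F" "vderiv F = w"
proof -
  have "\<exists>F. \<forall>x. (-\<infinity>::ereal) < ereal x \<longrightarrow> ereal x < \<infinity> \<longrightarrow> (F has_vector_derivative w x) (at x)"
    by (rule einterval_antiderivative)
       (use smooth_continuous_on[OF assms, of UNIV] in \<open>auto simp: continuous_on_eq_continuous_at\<close>)
  then obtain F where F: "\<And>t. (F has_vector_derivative w t) (at t)" by auto
  show thesis using that[of F] smoothI[OF F assms] vderiv_eqI[OF F] by blast
qed

lemma smooth_step_exists:
  "\<exists>\<Psi> :: real \<Rightarrow> complex. smooth \<Psi> \<and> (\<forall>t\<le>-1. \<Psi> t = 0) \<and> (\<forall>t\<ge>1. \<Psi> t = 1)"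
proof -
  \<comment> \<open>Positive on (-1, 1) and flat at both ends. Its antiderivative, shifted and
    divided by the total increase, is the step; \<open>lt\<close> makes the divisor nonzero.\<close>
  define \<psi> where "\<psi> t = exp_flat 1 (1 + t) * exp_flat 1 (1 - t)" for t
  have s: "smooth (\<lambda>t. exp_flat 1 (1 * t + 1) * exp_flat 1 (-1 * t + 1))"
    by (intro smooth_mult smooth_affine smooth_exp_flat)
  have \<psi>: "smooth \<psi>"
    using s unfolding \<psi>_def[abs_def] by (simp add: add.commute)
  obtain F where F: "smooth F" "vderiv F = \<psi>" using smooth_antiderivative[OF \<psi>] .
  have pos: "\<psi> t > 0" if "-1 < t" "t < 1" for t using that by (simp add: \<psi>_def exp_flat_def)
  have zero: "\<psi> t = 0" if "t \<le> -1 \<or> 1 \<le> t" for t using that by (auto simp: \<psi>_def exp_flat_def)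
  have D: "(F has_real_derivative \<psi> t) (at t)" for t
    using smooth_has_vector_derivative[OF F(1)] F(2) by (simp add: has_real_derivative_iff_has_vector_derivative)
  define \<Psi> where "\<Psi> t = (complex_of_real (F t) + - of_real (F (-1))) * inverse (of_real (F 1 - F (-1)))" for t
  have lt: "F (-1) < F 1"
    by (rule DERIV_pos_imp_increasing_open) (use D pos smooth_continuous_on[OF F(1)] in auto)
  have lo: "F t = F (-1)" if "t \<le> -1" for t
    using constant_of_vderiv_zero[OF F(1), of t "-1"] that F(2) zero by auto
  have hi: "F t = F 1" if "1 \<le> t" for t
    using constant_of_vderiv_zero[OF F(1), of 1 t] that F(2) zero by auto
  have "smooth (\<lambda>t. complex_of_real (F t))"
    by (intro smooth_linear[OF bounded_linear_of_real] F)
  then have "smooth \<Psi>"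
    unfolding \<Psi>_def[abs_def] by (intro smooth_add smooth_mult smooth_const)
  moreover have "\<Psi> t = 0" if "t \<le> -1" for t by (simp add: \<Psi>_def lo[OF that])
  moreover have "\<Psi> t = 1" if "1 \<le> t" for t
  proof -
    have "complex_of_real (F 1) - of_real (F (-1)) \<noteq> 0" using lt by simp
    then show ?thesis by (simp add: \<Psi>_def hi[OF that])
  qed
  ultimately show ?thesis by (intro exI[of _ \<Psi>]) blast
qed

section \<open>Schwartz seminorms and test functions\<close>

text \<open>One predicate for all seminorms of order at most N. Explicit bounds are carried along in
  place of suprema, which would need boundedness each time. A larger N is a stronger statement, so
  two orders are merged by their maximum.\<close>

definition seminorm_le :: "nat \<Rightarrow> real \<Rightarrow> (real \<Rightarrow> 'e::real_normed_vector) \<Rightarrow> bool" where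
  "seminorm_le N a f \<longleftrightarrow> (\<forall>k\<le>N. \<forall>m\<le>N. \<forall>t. \<bar>t\<bar> ^ k * norm ((vderiv ^^ m) f t) \<le> a)"

definition test_functions :: "(real \<Rightarrow> complex) set" where
  "test_functions = {f. smooth f \<and> (\<exists>R. \<forall>t. R \<le> \<bar>t\<bar> \<longrightarrow> f t = 0)}"

lemma schwartz_smooth: "f \<in> schwartz \<Longrightarrow> smooth f"
  by (simp add: schwartz_def smooth_def)

lemma schwartz_bound:
  assumes "f \<in> schwartz"
  obtains C where "C > 0" "\<And>t. \<bar>t\<bar> ^ k * norm ((vderiv ^^ m) f t) \<le> C"
proof -
  have "bounded (range (\<lambda>t. t ^ k *\<^sub>R (vderiv ^^ m) f t))" using assms by (simp add: schwartz_def)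
  then obtain C where "C > 0" "\<And>t. norm (t ^ k *\<^sub>R (vderiv ^^ m) f t) \<le> C"
    unfolding bounded_pos by blast
  then show thesis by (intro that[of C]) (auto simp: power_abs)
qed

lemma schwartz_seminorm_le:
  assumes "f \<in> schwartz"
  shows "\<exists>a>0. seminorm_le N a f"
proof -
  have "\<exists>C. C > 0 \<and> (\<forall>t. \<bar>t\<bar> ^ k * norm ((vderiv ^^ m) f t) \<le> C)" for k m
    by (rule schwartz_bound[OF assms, of k m]) blast
  then obtain C where C: "\<And>k m. C k m > 0" "\<And>k m t. \<bar>t\<bar> ^ k * norm ((vderiv ^^ m) f t) \<le> C k m"
    by metis
  have *: "C k m \<le> (\<Sum>k\<le>N. \<Sum>m\<le>N. C k m)" if "k \<le> N" "m \<le> N" for k m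
  proof -
    have "C k m \<le> (\<Sum>m\<le>N. C k m)"
      using that C(1) by (intro member_le_sum) (auto simp: less_imp_le)
    also have "\<dots> \<le> (\<Sum>k\<le>N. \<Sum>m\<le>N. C k m)"
      using that C(1) by (intro member_le_sum[of k "{..N}" "\<lambda>k. \<Sum>m\<le>N. C k m"] sum_nonneg) (auto simp: less_imp_le)
    finally show ?thesis .
  qed
  show ?thesis
  proof (intro exI[of _ "\<Sum>k\<le>N. \<Sum>m\<le>N. C k m"] conjI)
    show "(\<Sum>k\<le>N. \<Sum>m\<le>N. C k m) > 0" using *[of 0 0] C(1)[of 0 0] by linarith
    show "seminorm_le N (\<Sum>k\<le>N. \<Sum>m\<le>N. C k m) f"
      unfolding seminorm_le_def by (intro allI impI order_trans[OF C(2) *])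
  qed
qed

lemma schwartzI:
  assumes "smooth f" "\<And>N. \<exists>a. seminorm_le N a f"
  shows "f \<in> schwartz"
proof -
  have "bounded (range (\<lambda>t. t ^ k *\<^sub>R (vderiv ^^ m) f t))" for k m
  proof -
    obtain a where "seminorm_le (max k m) a f" using assms(2) by blast
    then show ?thesis unfolding seminorm_le_def
      by (intro boundedI[of _ a]) (auto simp: power_abs)
  qed
  then show ?thesis using assms(1) by (simp add: schwartz_def smooth_def)
qed

lemma seminorm_le_mono: "seminorm_le N a f \<Longrightarrow> a \<le> b \<Longrightarrow> seminorm_le N b f"
  unfolding seminorm_le_def by (meson order_trans)

lemma seminorm_le_add:
  assumes "smooth f" "smooth g" "seminorm_le N a f" "seminorm_le N b g"
  shows "seminorm_le N (a + b) (\<lambda>t. f t + g t)"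
  unfolding seminorm_le_def
proof (intro allI impI)
  fix k m t assume km: "k \<le> N" "m \<le> N"
  have "\<bar>t\<bar> ^ k * norm ((vderiv ^^ m) f t + (vderiv ^^ m) g t)
      \<le> \<bar>t\<bar> ^ k * (norm ((vderiv ^^ m) f t) + norm ((vderiv ^^ m) g t))"
    by (intro mult_left_mono norm_triangle_ineq) auto
  also have "\<dots> \<le> a + b"
    using assms(3,4) km unfolding seminorm_le_def distrib_left by (meson add_mono)
  finally show "\<bar>t\<bar> ^ k * norm ((vderiv ^^ m) (\<lambda>t. f t + g t) t) \<le> a + b"
    by (simp add: funpow_vderiv_add assms)
qed

lemma seminorm_le_linear:
  assumes "bounded_linear T" "smooth f" "seminorm_le N a f" "\<And>x. norm (T x) \<le> K * norm x" "K \<ge> 0"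
  shows "seminorm_le N (K * a) (\<lambda>t. T (f t))"
  unfolding seminorm_le_def
proof (intro allI impI)
  fix k m t assume km: "k \<le> N" "m \<le> N"
  have "\<bar>t\<bar> ^ k * norm (T ((vderiv ^^ m) f t)) \<le> \<bar>t\<bar> ^ k * (K * norm ((vderiv ^^ m) f t))"
    by (intro mult_left_mono assms) auto
  also have "\<dots> = K * (\<bar>t\<bar> ^ k * norm ((vderiv ^^ m) f t))" by simp
  also have "\<dots> \<le> K * a"
    using assms(3) km unfolding seminorm_le_def by (intro mult_left_mono assms) auto
  finally show "\<bar>t\<bar> ^ k * norm ((vderiv ^^ m) (\<lambda>t. T (f t)) t) \<le> K * a"
    by (simp add: funpow_vderiv_linear assms)
qed

lemma seminorm_le_cmult:
  fixes f :: "real \<Rightarrow> complex"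
  assumes "smooth f" "seminorm_le N a f"
  shows "seminorm_le N (norm c * a) (\<lambda>t. c * f t)"
  by (rule seminorm_le_linear[OF bounded_linear_mult_right]) (auto simp: assms norm_mult)

text \<open>All derivatives vanish beyond R, so bounds are needed on [-R, R] only, where
  \<open>1 \<le> R\<close> bounds every weight by R^N.\<close>

lemma seminorm_le_compact_support:
  fixes f :: "real \<Rightarrow> complex"
  assumes "smooth f" "\<And>t. R \<le> \<bar>t\<bar> \<Longrightarrow> f t = 0" "1 \<le> R" "0 \<le> b"
    and "\<And>m t. m \<le> N \<Longrightarrow> \<bar>t\<bar> \<le> R \<Longrightarrow> norm ((vderiv ^^ m) f t) \<le> b"
  shows "seminorm_le N (R ^ N * b) f"
  unfolding seminorm_le_def
proof (intro allI impI)
  fix k m t assume km: "k \<le> N" "m \<le> N"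
  show "\<bar>t\<bar> ^ k * norm ((vderiv ^^ m) f t) \<le> R ^ N * b"
  proof (cases "\<bar>t\<bar> \<le> R")
    case True
    have "\<bar>t\<bar> ^ k \<le> R ^ k" using True by (intro power_mono) auto
    also have "\<dots> \<le> R ^ N" using km assms(3) by (intro power_increasing) auto
    finally show ?thesis using assms(5)[OF km(2) True] by (intro mult_mono) (use assms in auto)
  next
    case False
    have "open {t::real. R < \<bar>t\<bar>}" by (intro open_Collect_less continuous_intros)
    then have "(vderiv ^^ m) f t = (vderiv ^^ m) (\<lambda>t. 0) t"
      by (rule funpow_vderiv_cong_open[OF assms(1) smooth_const]) (use False assms(2) in auto)
    then show ?thesis using assms(3,4) by (simp add: funpow_vderiv_zero)
  qed
qed

section \<open>Test functions: closure properties, antiderivatives and plateaus\<close>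

lemma test_smooth: "f \<in> test_functions \<Longrightarrow> smooth f"
  by (simp add: test_functions_def)

lemma test_support:
  assumes "f \<in> test_functions"
  shows "\<exists>R\<ge>r. \<forall>t. R \<le> \<bar>t\<bar> \<longrightarrow> f t = 0"
proof -
  obtain R where "\<forall>t. R \<le> \<bar>t\<bar> \<longrightarrow> f t = 0" using assms by (auto simp: test_functions_def)
  then show ?thesis by (intro exI[of _ "max r R"]) auto
qed

lemma testI: "smooth f \<Longrightarrow> (\<And>t. R \<le> \<bar>t\<bar> \<Longrightarrow> f t = 0) \<Longrightarrow> f \<in> test_functions"
  by (auto simp: test_functions_def)

lemma smooth_bounded_on:
  fixes f :: "real \<Rightarrow> 'a::real_normed_vector"
  assumes "smooth f"
  shows "\<exists>B>0. \<forall>t m. \<bar>t\<bar> \<le> R \<longrightarrow> m \<le> N \<longrightarrow> norm ((vderiv ^^ m) f t) \<le> B"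
proof -
  have "\<exists>b. b > 0 \<and> (\<forall>t. \<bar>t\<bar> \<le> R \<longrightarrow> norm ((vderiv ^^ m) f t) \<le> b)" for m
  proof -
    have "bounded ((vderiv ^^ m) f ` {-R..R})"
      by (intro compact_imp_bounded compact_continuous_image smooth_continuous_on smooth_funpow_vderiv assms) auto
    then obtain b where "b > 0 \<and> (\<forall>x\<in>(vderiv ^^ m) f ` {-R..R}. norm x \<le> b)"
      unfolding bounded_pos ..
    then have b: "b > 0" "\<And>x. x \<in> (vderiv ^^ m) f ` {-R..R} \<Longrightarrow> norm x \<le> b" by auto
    then show ?thesis by (intro exI[of _ b] conjI b allI impI b(2) imageI) auto
  qed
  then obtain b where b: "\<And>m. b m > 0" "\<And>m t. \<bar>t\<bar> \<le> R \<Longrightarrow> norm ((vderiv ^^ m) f t) \<le> b m" by metis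
  have *: "b m \<le> (\<Sum>m\<le>N. b m)" if "m \<le> N" for m
    using that b(1) by (intro member_le_sum) (auto simp: less_imp_le)
  show ?thesis
  proof (intro exI[of _ "\<Sum>m\<le>N. b m"] conjI allI impI)
    show "0 < (\<Sum>m\<le>N. b m)" using *[of 0] b(1)[of 0] by linarith
    show "norm ((vderiv ^^ m) f t) \<le> (\<Sum>m\<le>N. b m)" if "\<bar>t\<bar> \<le> R" "m \<le> N" for t m
      using order_trans[OF b(2) *] that .
  qed
qed

lemma test_schwartz: 
  assumes "f \<in> test_functions" shows "f \<in> schwartz"
proof (rule schwartzI)
  fix N
  obtain R where R: "R \<ge> 1" "\<And>t. R \<le> \<bar>t\<bar> \<Longrightarrow> f t = 0" using test_support[where r=1, OF assms] by blast
  obtain B where "B > 0" "\<And>t m. \<bar>t\<bar> \<le> R \<Longrightarrow> m \<le> N \<Longrightarrow> norm ((vderiv ^^ m) f t) \<le> B"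
    using smooth_bounded_on[where R=R and N=N, OF test_smooth[OF assms]] by blast
  then show "\<exists>a. seminorm_le N a f"
    by (intro exI[of _ "R ^ N * B"] seminorm_le_compact_support test_smooth assms R) auto
qed (use assms test_smooth in auto)

lemma schwartz_add:
  assumes "f \<in> schwartz" "g \<in> schwartz" shows "(\<lambda>t. f t + g t) \<in> schwartz"
proof (rule schwartzI)
  show "smooth (\<lambda>t. f t + g t)" using assms by (intro smooth_add schwartz_smooth)
  fix N
  obtain a where a: "seminorm_le N a f" using schwartz_seminorm_le[OF assms(1)] by blast
  obtain b where b: "seminorm_le N b g" using schwartz_seminorm_le[OF assms(2)] by blast
  from a b show "\<exists>a. seminorm_le N a (\<lambda>t. f t + g t)"
    using seminorm_le_add[OF schwartz_smooth[OF assms(1)] schwartz_smooth[OF assms(2)]] by blast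
qed

lemma schwartz_linear:
  assumes "bounded_linear T" "f \<in> schwartz" shows "(\<lambda>t. T (f t)) \<in> schwartz"
proof (rule schwartzI)
  show "smooth (\<lambda>t. T (f t))" by (rule smooth_linear[OF assms(1) schwartz_smooth[OF assms(2)]])
  fix N
  obtain a where "seminorm_le N a f" using schwartz_seminorm_le[OF assms(2)] by blast
  from seminorm_le_linear[OF assms(1) schwartz_smooth[OF assms(2)] this onorm[OF assms(1)] onorm_pos_le[OF assms(1)]]
  show "\<exists>a. seminorm_le N a (\<lambda>t. T (f t))" by (rule exI)
qed

lemma schwartz_cmult: "f \<in> schwartz \<Longrightarrow> (\<lambda>t. c * f t :: complex) \<in> schwartz"
  by (rule schwartz_linear[OF bounded_linear_mult_right])

lemma test_smooth_mult:
  assumes "f \<in> test_functions" "smooth h" shows "(\<lambda>t. h t * f t) \<in> test_functions"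
proof -
  obtain R where R: "\<forall>t. R \<le> \<bar>t\<bar> \<longrightarrow> f t = 0" using test_support[OF assms(1)] by blast
  show ?thesis
    by (rule testI[OF smooth_mult[OF assms(2) test_smooth[OF assms(1)]], of R]) (use R in simp)
qed

lemma test_mult: "f \<in> test_functions \<Longrightarrow> g \<in> test_functions \<Longrightarrow> (\<lambda>t. f t * g t) \<in> test_functions"
  by (simp add: test_smooth test_smooth_mult)

lemma test_cmult: "f \<in> test_functions \<Longrightarrow> (\<lambda>t. c * f t) \<in> test_functions"
  by (simp add: smooth_const test_smooth_mult)

lemma test_poly_mult: "f \<in> test_functions \<Longrightarrow> (\<lambda>t. poly P (of_real t) * f t) \<in> test_functions"
  by (simp add: smooth_poly test_smooth_mult)

lemma test_of_real_mult: "f \<in> test_functions \<Longrightarrow> (\<lambda>t. of_real t * f t) \<in> test_functions"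
  using test_poly_mult[of f "[:0,1:]"] by simp

lemma test_add:
  assumes "f \<in> test_functions" "g \<in> test_functions" shows "(\<lambda>t. f t + g t) \<in> test_functions"
proof -
  obtain R where R: "\<forall>t. R \<le> \<bar>t\<bar> \<longrightarrow> f t = 0" using test_support[OF assms(1)] by blast
  obtain R' where R': "R' \<ge> R" "\<forall>t. R' \<le> \<bar>t\<bar> \<longrightarrow> g t = 0" using test_support[OF assms(2), of R] by blast
  show ?thesis
    by (rule testI[OF smooth_add[OF test_smooth[OF assms(1)] test_smooth[OF assms(2)]], of R'])
       (use R R' in \<open>simp add: order_trans[OF R'(1)]\<close>)
qed

lemma vderiv_zero_outside:
  assumes "smooth f" "\<And>t. R \<le> \<bar>t\<bar> \<Longrightarrow> f t = 0" "R < \<bar>t\<bar>"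
  shows "vderiv f t = 0"
proof -
  have "open {t::real. R < \<bar>t\<bar>}" by (intro open_Collect_less continuous_intros)
  then have "(vderiv ^^ 1) f t = (vderiv ^^ 1) (\<lambda>t. 0) t"
    by (rule funpow_vderiv_cong_open[OF assms(1) smooth_const]) (use assms(2,3) in auto)
  then show ?thesis by (simp add: vderiv_const)
qed

lemma test_vderiv:
  assumes "f \<in> test_functions" shows "vderiv f \<in> test_functions"
proof -
  obtain R where R: "\<forall>t. R \<le> \<bar>t\<bar> \<longrightarrow> f t = 0" using test_support[OF assms(1)] by blast
  have "vderiv f t = 0" if "R + 1 \<le> \<bar>t\<bar>" for t
    by (rule vderiv_zero_outside[OF test_smooth[OF assms], of R]) (use R that in auto)
  then show ?thesis by (rule testI[OF smooth_vderiv[OF test_smooth[OF assms]]])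
qed

lemma test_translate:
  assumes "f \<in> test_functions" shows "(\<lambda>t. f (t - a)) \<in> test_functions"
proof -
  obtain R where R: "\<forall>t. R \<le> \<bar>t\<bar> \<longrightarrow> f t = 0" using test_support[OF assms(1)] by blast
  have "f (t - a) = 0" if "R + \<bar>a\<bar> \<le> \<bar>t\<bar>" for t
    by (rule R[rule_format]) (use that in arith)
  moreover have "smooth (\<lambda>t. f (t - a))" using smooth_affine[OF test_smooth[OF assms], of 1 "-a"] by simp
  ultimately show ?thesis by (intro testI)
qed

lemma test_integrable:
  assumes "f \<in> test_functions" shows "integrable lborel f"
proof -
  obtain R where R: "R \<ge> 1" "\<And>t. R \<le> \<bar>t\<bar> \<Longrightarrow> f t = 0" using test_support[where r=1, OF assms(1)] by blast
  have "integrable lborel (\<lambda>x. indicator {-R..R} x *\<^sub>R f x)"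
    by (intro borel_integrable_compact smooth_continuous_on test_smooth assms) auto
  also have "(\<lambda>x. indicator {-R..R} x *\<^sub>R f x) = f"
    using R by (auto simp: fun_eq_iff indicator_def)
  finally show ?thesis .
qed

lemma integral_vderiv_compact:
  fixes F :: "real \<Rightarrow> complex"
  assumes "smooth F" "\<And>t. R \<le> \<bar>t\<bar> \<Longrightarrow> vderiv F t = 0" "0 \<le> R"
  shows "(LINT t|lborel. vderiv F t) = F R - F (-R)"
proof -
  have "(LINT t|lborel. indicator {-R..R} t *\<^sub>R vderiv F t) = F R - F (-R)"
    using assms(3) smooth_has_vector_derivative[OF assms(1)] smooth_continuous_on[OF smooth_vderiv[OF assms(1)]]
    by (intro integral_FTC_atLeastAtMost) (auto intro: has_vector_derivative_at_within)
  also have "(\<lambda>t. indicator {-R..R} t *\<^sub>R vderiv F t) = vderiv F"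
    using assms by (auto simp: fun_eq_iff indicator_def)
  finally show ?thesis .
qed

text \<open>An antiderivative is constant on each side of the support, and the zero integral makes
  the two constants equal; subtracting their common value gives support within the same radius
  \<open>R\<close>.\<close>

lemma test_antiderivative:
  assumes "w \<in> test_functions" "(LINT t|lborel. w t) = 0" "\<And>t. R \<le> \<bar>t\<bar> \<Longrightarrow> w t = 0" "0 \<le> R"
  shows "\<exists>u\<in>test_functions. vderiv u = w \<and> (\<forall>t. R \<le> \<bar>t\<bar> \<longrightarrow> u t = 0)"
proof -
  obtain F where F: "smooth F" "vderiv F = w" using smooth_antiderivative[OF test_smooth[OF assms(1)]] .
  have hi: "F t = F R" if "R \<le> t" for t
    using constant_of_vderiv_zero[OF F(1), of R t] that F(2) assms(3,4) by auto
  have lo: "F t = F (-R)" if "t \<le> -R" for t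
    using constant_of_vderiv_zero[OF F(1), of t "-R"] that F(2) assms(3,4) by auto
  have eq: "F R = F (-R)"
    using integral_vderiv_compact[OF F(1), of R] F(2) assms by auto
  have z: "F t + - F R = 0" if "R \<le> \<bar>t\<bar>" for t
    using hi[of t] lo[of t] eq that by (cases "t \<ge> 0") auto
  have s: "smooth (\<lambda>t. F t + - F R)" by (intro smooth_add smooth_const F)
  have d: "vderiv (\<lambda>t. F t + - F R) = w"
    using F by (simp add: vderiv_add[OF F(1) smooth_const, of "- F R", simplified] vderiv_const)
  show ?thesis by (intro bexI[OF _ testI[OF s z]] conjI allI impI d z)
qed

text \<open>The derivative of a step from 0 to 1 has integral 1. The step is constant beyond 1; the
  radius 2 leaves room for an open set on which the derivative can be read off.\<close>

lemma unit_mass_exists: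
  "\<exists>\<rho>\<in>test_functions. (\<forall>t. 2 \<le> \<bar>t\<bar> \<longrightarrow> \<rho> t = 0) \<and> (LINT t|lborel. \<rho> t) = 1"
proof -
  obtain \<Psi> :: "real \<Rightarrow> complex" where P: "smooth \<Psi>" "\<And>t. t \<le> -1 \<Longrightarrow> \<Psi> t = 0" "\<And>t. 1 \<le> t \<Longrightarrow> \<Psi> t = 1"
    using smooth_step_exists by auto
  have z: "vderiv \<Psi> t = 0" if "2 \<le> \<bar>t\<bar>" for t
  proof (cases "t \<ge> 0")
    case True
    have "(vderiv ^^ 1) \<Psi> t = (vderiv ^^ 1) (\<lambda>t. 1) t"
      by (rule funpow_vderiv_cong_open[OF P(1) smooth_const, of "{1<..}"]) (use that P True in auto)
    then show ?thesis by (simp add: vderiv_const)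
  next
    case False
    have "(vderiv ^^ 1) \<Psi> t = (vderiv ^^ 1) (\<lambda>t. 0) t"
      by (rule funpow_vderiv_cong_open[OF P(1) smooth_const, of "{..<-1}"]) (use that P False in auto)
    then show ?thesis by (simp add: vderiv_const)
  qed
  have "vderiv \<Psi> \<in> test_functions" using z by (rule testI[OF smooth_vderiv[OF P(1)]])
  moreover have "(LINT t|lborel. vderiv \<Psi> t) = 1"
    using integral_vderiv_compact[OF P(1), of 2] z P by simp
  ultimately show ?thesis using z by (intro bexI[of _ "vderiv \<Psi>"]) simp_all
qed

text \<open>The product of a rising step that ends at -R and a falling step that starts at R.
  Enlarging R only shifts the edges, so the derivatives are bounded independently of R;
  \<open>cutoff_approx\<close> rests on this uniformity.\<close>

lemma plateau_exists:
  "\<exists>\<theta> :: real \<Rightarrow> real \<Rightarrow> complex. (\<forall>R\<ge>0. \<theta> R \<in> test_functions) \<and> (\<forall>R. smooth (\<theta> R)) \<and>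
     (\<forall>R t. \<bar>t\<bar> \<le> R \<longrightarrow> \<theta> R t = 1) \<and> (\<forall>N. \<exists>C>0. \<forall>R t. \<forall>m\<le>N. norm ((vderiv ^^ m) (\<theta> R) t) \<le> C)"
proof -
  obtain \<Psi> :: "real \<Rightarrow> complex" where P: "smooth \<Psi>" "\<And>t. t \<le> -1 \<Longrightarrow> \<Psi> t = 0" "\<And>t. 1 \<le> t \<Longrightarrow> \<Psi> t = 1"
    using smooth_step_exists by auto
  define \<theta> where "\<theta> R t = \<Psi> (1 * t + (R + 1)) * \<Psi> (-1 * t + (R + 1))" for R t
  have s: "smooth (\<theta> R)" for R
    unfolding \<theta>_def[abs_def] by (intro smooth_mult smooth_affine P)
  have "\<exists>C>0. \<forall>R t. \<forall>m\<le>N. norm ((vderiv ^^ m) (\<theta> R) t) \<le> C" for N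
  proof -
    obtain B where B: "B > 0" "\<And>t m. \<bar>t\<bar> \<le> 1 \<Longrightarrow> m \<le> N \<Longrightarrow> norm ((vderiv ^^ m) \<Psi> t) \<le> B"
      using smooth_bounded_on[where R=1 and N=N, OF P(1)] by blast
    have const: "norm ((vderiv ^^ m) (\<lambda>t. c) t) \<le> norm c" for m and c :: complex and t :: real
      by (cases m) (simp_all add: funpow_vderiv_Suc vderiv_const funpow_vderiv_zero del: funpow.simps(2))
    have B': "norm ((vderiv ^^ m) \<Psi> t) \<le> B + 1" if "m \<le> N" for m t
    proof -
      consider "\<bar>t\<bar> \<le> 1" | "t > 1" | "t < -1" by linarith
      then show ?thesis
      proof cases
        case 1 then show ?thesis using B(2)[OF 1 that] by simp
      next
        case 2
        have "(vderiv ^^ m) \<Psi> t = (vderiv ^^ m) (\<lambda>t. 1) t"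
          by (rule funpow_vderiv_cong_open[OF P(1) smooth_const, of "{1<..}"]) (use 2 P in auto)
        then show ?thesis using const[of m 1 t] B by simp
      next
        case 3
        have "(vderiv ^^ m) \<Psi> t = (vderiv ^^ m) (\<lambda>t. 0) t"
          by (rule funpow_vderiv_cong_open[OF P(1) smooth_const, of "{..<-1}"]) (use 3 P in auto)
        then show ?thesis using const[of m 0 t] B by simp
      qed
    qed
    have "norm ((vderiv ^^ m) (\<theta> R) t) \<le> 2 ^ N * ((B + 1) * (B + 1))" if "m \<le> N" for m R t
    proof -
      \<comment> \<open>Both factors have slope of modulus 1, so the chain rule contributes no
        factor that depends on R.\<close>
      have A: "norm ((vderiv ^^ i) (\<lambda>t. \<Psi> (s * t + b)) t) \<le> B + 1" if "\<bar>s\<bar> = 1" "i \<le> m" for i s b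
        unfolding funpow_vderiv_affine[OF P(1)] using B'[of i] that \<open>m \<le> N\<close> by (simp add: power_abs)
      have "norm ((vderiv ^^ m) (\<theta> R) t) \<le> 2 ^ m * ((B + 1) * (B + 1))"
        unfolding \<theta>_def[abs_def]
        by (intro norm_funpow_vderiv_mult_le smooth_affine P(1) A) (use B(1) in auto)
      also have "\<dots> \<le> 2 ^ N * ((B + 1) * (B + 1))"
        using that B(1) by (intro mult_right_mono power_increasing) auto
      finally show ?thesis .
    qed
    then show ?thesis using B(1) by (intro exI[of _ "2 ^ N * ((B + 1) * (B + 1))"]) auto
  qed
  moreover have "\<theta> R \<in> test_functions" if "R \<ge> 0" for R
  proof (rule testI[OF s, of "R + 2"])
    fix t assume "R + 2 \<le> \<bar>t\<bar>"
    then show "\<theta> R t = 0" using P(2) by (cases "t \<ge> 0") (auto simp: \<theta>_def)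
  qed
  moreover have "\<theta> R t = 1" if "\<bar>t\<bar> \<le> R" for R t using that P(3) by (auto simp: \<theta>_def)
  ultimately show ?thesis using s by (intro exI[of _ \<theta>]) simp
qed

section \<open>Simultaneous polynomial approximation of derivatives\<close>

lemma poly_antiderivative: "\<exists>Q. pderiv Q = (P :: complex poly)"
proof -
  have "\<exists>Q. pderiv Q = (\<Sum>i\<in>I. monom (coeff P i) i)" if "finite I" for I
    using that
  proof induction
    case empty
    show ?case by (rule exI[of _ 0]) simp
  next
    case (insert i I)
    then obtain Q where "pderiv Q = (\<Sum>i\<in>I. monom (coeff P i) i)" by blast
    moreover have "pderiv (monom (coeff P i / of_nat (Suc i)) (Suc i)) = monom (coeff P i) i"
      by (simp add: pderiv_monom del: of_nat_Suc)
    ultimately have "pderiv (monom (coeff P i / of_nat (Suc i)) (Suc i) + Q) = (\<Sum>i\<in>insert i I. monom (coeff P i) i)"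
      using insert by (simp add: pderiv_add)
    then show ?case by (rule exI)
  qed
  from this[of "{..degree P}"] show ?thesis by (simp add: poly_as_sum_of_monoms)
qed

lemma polynomial_function_imp_poly:
  assumes "polynomial_function (p :: real \<Rightarrow> complex)"
  shows "\<exists>P. p = (\<lambda>t. poly P (of_real t))"
proof -
  have "real_polynomial_function (Re \<circ> p)" "real_polynomial_function (Im \<circ> p)"
    using assms bounded_linear_Re bounded_linear_Im unfolding polynomial_function_def by auto
  then obtain a n b k where ab: "Re \<circ> p = (\<lambda>x. \<Sum>i\<le>n. a i * x ^ i)" "Im \<circ> p = (\<lambda>x. \<Sum>i\<le>k. b i * x ^ i)"
    using real_polynomial_function_iff_sum by auto
  define P where "P = (\<Sum>i\<le>n. monom (complex_of_real (a i)) i) + (\<Sum>i\<le>k. monom (\<i> * of_real (b i)) i)"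
  have "p t = poly P (of_real t)" for t
  proof -
    have "Re (p t) = (\<Sum>i\<le>n. a i * t ^ i)" "Im (p t) = (\<Sum>i\<le>k. b i * t ^ i)"
      using fun_cong[OF ab(1), of t] fun_cong[OF ab(2), of t] by auto
    moreover have "poly P (of_real t) = of_real (\<Sum>i\<le>n. a i * t ^ i) + \<i> * of_real (\<Sum>i\<le>k. b i * t ^ i)"
      by (simp add: P_def poly_sum poly_monom sum_distrib_left mult.assoc)
    ultimately show ?thesis using complex_eq[of "p t"] by (simp only:)
  qed
  then show ?thesis by blast
qed

text \<open>Approximating the highest derivative by the Weierstrass theorem and integrating back m
  times controls all lower derivatives at once.\<close>

lemma poly_approx_smooth:
  fixes u :: "real \<Rightarrow> complex"
  assumes "smooth u" "e > 0" "R > 0"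
  shows "\<exists>P. \<forall>j\<le>m. \<forall>t. \<bar>t\<bar> \<le> R \<longrightarrow> norm ((vderiv ^^ j) u t + - poly ((pderiv ^^ j) P) (of_real t)) \<le> e"
  using assms
proof (induction m arbitrary: u e)
  case 0
  have "\<exists>p. polynomial_function p \<and> (\<forall>x\<in>{-R..R}. norm (u x - p x) < e)"
    by (intro Stone_Weierstrass_polynomial_function smooth_continuous_on 0) auto
  then obtain p where p: "polynomial_function p" "\<forall>x\<in>{-R..R}. norm (u x - p x) < e"
    by blast
  obtain P where P: "p = (\<lambda>t. poly P (of_real t))"
    using polynomial_function_imp_poly[OF p(1)] by blast
  have "norm (u t - poly P (of_real t)) \<le> e" if "\<bar>t\<bar> \<le> R" for t
    using p(2)[rule_format, of t] that by (simp add: P abs_le_iff)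
  then show ?case by (intro exI[of _ P]) simp
next
  case (Suc m)
  \<comment> \<open>Integration over [-R, R] costs a factor 2R, the length of the interval; the
    minimum with \<open>e\<close> keeps the bound for the derivatives themselves.\<close>
  define d where "d = min e (e / (2 * R))"
  have d: "d > 0" "d \<le> e" "d * (2 * R) \<le> e"
    using Suc.prems by (auto simp: d_def min_def field_simps)
  obtain P where P: "\<And>j t. j \<le> m \<Longrightarrow> \<bar>t\<bar> \<le> R \<Longrightarrow> norm ((vderiv ^^ j) (vderiv u) t + - poly ((pderiv ^^ j) P) (of_real t)) \<le> d"
    using Suc.IH[OF smooth_vderiv[OF Suc.prems(1)] d(1) Suc.prems(3)] by auto
  obtain Q0 where Q0: "pderiv Q0 = P" using poly_antiderivative by blast
  \<comment> \<open>The constant of integration is chosen so that \<open>Q\<close> and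
    \<open>u\<close> agree at -R, where the estimate of order zero starts.\<close>
  define Q where "Q = Q0 + [:u (-R) - poly Q0 (of_real (-R)):]"
  have Q: "pderiv Q = P" "poly Q (of_real (-R)) = u (-R)"
    by (simp_all add: Q_def pderiv_add pderiv_pCons Q0)
  define h where "h t = u t + - poly Q (of_real t)" for t
  have sp: "smooth (\<lambda>t. - poly Q (complex_of_real t))"
    by (rule smooth_linear[OF bounded_linear_minus[OF bounded_linear_ident] smooth_poly])
  have sh: "smooth h" unfolding h_def[abs_def] by (intro smooth_add Suc.prems sp)
  have dh: "vderiv h t = vderiv u t + - poly P (of_real t)" for t
    unfolding h_def[abs_def] using Q(1)
    by (simp add: vderiv_add[OF Suc.prems(1) sp, simplified]
        vderiv_linear[OF bounded_linear_minus[OF bounded_linear_ident] smooth_poly] vderiv_poly)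
  have "norm ((vderiv ^^ j) u t + - poly ((pderiv ^^ j) Q) (of_real t)) \<le> e" if "j \<le> Suc m" "\<bar>t\<bar> \<le> R" for j t
  proof (cases j)
    case 0
    have "norm (h t - h (-R)) \<le> d * \<bar>t - (-R)\<bar>"
    proof (rule norm_diff_le_vderiv_bound[OF sh, of "-R" R])
      show "norm (vderiv h s) \<le> d" if "s \<in> {-R..R}" for s
        using P[of 0 s] that by (simp add: dh abs_le_iff)
    qed (use that Suc.prems in auto)
    also have "\<dots> \<le> d * (2 * R)" using that d(1) by (intro mult_left_mono) auto
    finally show ?thesis using d(3) Q(2) 0 by (simp add: h_def)
  next
    case (Suc i)
    then show ?thesis using P[of i t] that d(2) Q(1) 
      by (simp add: funpow_vderiv_Suc funpow_Suc_right del: funpow.simps(2))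
  qed
  then show ?case by blast
qed

section \<open>Difference quotients of translations\<close>

lemma smooth_ident: "smooth (\<lambda>t. t)"
  by (rule smoothI[OF _ smooth_const[of 1]]) (auto intro!: derivative_eq_intros)

lemma vderiv_ident: "vderiv (\<lambda>t. t) = (\<lambda>t. 1)"
  by (rule vderiv_eqI) (auto intro!: derivative_eq_intros)

lemma vderiv_of_real_mult:
  assumes "smooth f" shows "vderiv (\<lambda>t. of_real t * f t) = (\<lambda>t. of_real t * vderiv f t + f t :: complex)"
  using vderiv_mult[OF smooth_linear[OF bounded_linear_of_real smooth_ident] assms]
  by (simp add: vderiv_linear[OF bounded_linear_of_real smooth_ident] vderiv_ident)

text \<open>Taylor expansion to second order, uniform in t. The sign is plus because f(t - a) has
  the derivative -f' in a at 0. \<open>B\<close> depends on f and N, not on a.\<close>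

lemma translation_remainder:
  assumes f: "f \<in> test_functions"
  shows "\<exists>B>0. \<forall>a>0. a \<le> 1 \<longrightarrow>
    seminorm_le N (B * a) (\<lambda>t. of_real (1 / a) * (f (t - a) + - f t) + vderiv f t)"
proof -
  obtain R where R: "R \<ge> 1" "\<forall>t. R \<le> \<bar>t\<bar> \<longrightarrow> f t = 0" using test_support[OF f] by blast
  \<comment> \<open>Two orders above N: the remainder for the m-th derivative is controlled by the
    derivative of order m + 2.\<close>
  obtain A where A: "A > 0" "seminorm_le (N + 2) A f"
    using schwartz_seminorm_le[OF test_schwartz[OF f]] by blast
  have A2: "norm ((vderiv ^^ m) f t) \<le> A" if "m \<le> N + 2" for m t
    using A(2)[unfolded seminorm_le_def, rule_format, of 0 m t] that by simp
  have sf: "smooth f" by (rule test_smooth[OF f])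
  have "seminorm_le N ((R + 1) ^ N * A * a) (\<lambda>t. of_real (1 / a) * (f (t - a) + - f t) + vderiv f t)"
    if a: "a > 0" "a \<le> 1" for a
  proof -
    have s1: "smooth (\<lambda>t. f (t - a))" using smooth_affine[OF sf, of 1 "-a"] by simp
    have s2: "smooth (\<lambda>t. - f t)" by (rule smooth_linear[OF bounded_linear_minus[OF bounded_linear_ident] sf])
    have s3: "smooth (\<lambda>t. of_real (1 / a) * (f (t - a) + - f t))"
      by (rule smooth_linear[OF bounded_linear_mult_right smooth_add[OF s1 s2]])
    have s4: "smooth (\<lambda>t. of_real (1 / a) * (f (t - a) + - f t) + vderiv f t)"
      by (rule smooth_add[OF s3 smooth_vderiv[OF sf]])
    have "seminorm_le N ((R + 1) ^ N * (A * a)) (\<lambda>t. of_real (1 / a) * (f (t - a) + - f t) + vderiv f t)"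
    proof (rule seminorm_le_compact_support[OF s4])
      show "of_real (1 / a) * (f (t - a) + - f t) + vderiv f t = 0" if "R + 1 \<le> \<bar>t\<bar>" for t
      proof -
        have "f (t - a) = 0" "f t = 0" by (rule R(2)[rule_format], use that a in arith)+
        moreover have "vderiv f t = 0" by (rule vderiv_zero_outside[OF sf, of R]) (use R(2) that in auto)
        ultimately show ?thesis by simp
      qed
      fix m t assume m: "m \<le> N"
      define F where "F = (vderiv ^^ m) f"
      have sF: "smooth F" unfolding F_def by (rule smooth_funpow_vderiv[OF sf])
      have F2: "norm (vderiv (vderiv F) s) \<le> A" for s
        using A2[of "Suc (Suc m)" s] m by (simp add: F_def)
      have lip: "norm (vderiv F s - vderiv F t) \<le> A * a" if "s \<in> {t - a..t}" for s
      proof -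
        have "norm (vderiv F s - vderiv F t) \<le> A * \<bar>s - t\<bar>"
          by (rule norm_diff_le_vderiv_bound[OF smooth_vderiv[OF sF] F2, where a="t - a" and b=t]) (use that a in auto)
        also have "\<dots> \<le> A * a" using that A(1) by (intro mult_left_mono) auto
        finally show ?thesis .
      qed
      \<comment> \<open>Removing the linear part at t leaves a function whose derivative is at most
        \<open>A * a\<close> on [t - a, t]. Its increment is then at most A a^2, and division by a
        leaves \<open>A * a\<close>.\<close>
      define G where "G s = F s + s *\<^sub>R (- vderiv F t)" for s
      have sl: "smooth (\<lambda>s. s *\<^sub>R (- vderiv F t))"
        by (rule smooth_linear[OF bounded_linear_scaleR_left smooth_ident])
      have sG: "smooth G" unfolding G_def[abs_def] by (rule smooth_add[OF sF sl])
      have dG: "vderiv G s = vderiv F s - vderiv F t" for s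
        unfolding G_def[abs_def]
        using vderiv_add[OF sF sl] vderiv_linear[OF bounded_linear_scaleR_left smooth_ident, of "- vderiv F t"]
        by (simp add: vderiv_ident)
      have "norm (G (t - a) - G t) \<le> (A * a) * \<bar>(t - a) - t\<bar>"
        by (rule norm_diff_le_vderiv_bound[OF sG, of "t - a" t]) (use lip a in \<open>auto simp: dG\<close>)
      then have G: "norm (G (t - a) - G t) \<le> (A * a) * a" using a by simp
      have "of_real (1 / a) * (F (t - a) + - F t) + vderiv F t = of_real (1 / a) * (G (t - a) - G t)"
        using a by (simp add: G_def scaleR_conv_of_real field_simps)
      then have "norm (of_real (1 / a) * (F (t - a) + - F t) + vderiv F t) = (1 / a) * norm (G (t - a) - G t)"
        using a by (simp only: norm_mult norm_of_real) simp
      also have "\<dots> \<le> (1 / a) * ((A * a) * a)" using G a by (intro mult_left_mono) auto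
      also have "\<dots> = A * a" using a by simp
      finally have *: "norm (of_real (1 / a) * (F (t - a) + - F t) + vderiv F t) \<le> A * a" .
      have "(vderiv ^^ m) (\<lambda>t. f (t - a)) = (\<lambda>t. F (t - a))"
        using funpow_vderiv_affine[OF sf, of m 1 "-a"] by (simp add: F_def)
      moreover have "(vderiv ^^ m) (\<lambda>t. - f t) = (\<lambda>t. - F t)"
        by (simp add: F_def funpow_vderiv_linear[OF bounded_linear_minus[OF bounded_linear_ident] sf])
      moreover have "(vderiv ^^ m) (vderiv f) = vderiv F"
        by (simp add: F_def funpow_swap1)
      ultimately have "(vderiv ^^ m) (\<lambda>t. of_real (1 / a) * (f (t - a) + - f t) + vderiv f t)
          = (\<lambda>t. of_real (1 / a) * (F (t - a) + - F t) + vderiv F t)"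
        by (simp only: funpow_vderiv_add[OF s3 smooth_vderiv[OF sf]] funpow_vderiv_add[OF s1 s2]
            funpow_vderiv_linear[OF bounded_linear_mult_right smooth_add[OF s1 s2]])
      then show "norm ((vderiv ^^ m) (\<lambda>t. of_real (1 / a) * (f (t - a) + - f t) + vderiv f t) t) \<le> A * a"
        using * by simp
    qed (use R a A in auto)
    then show ?thesis by (simp add: mult.assoc)
  qed
  then show ?thesis using A(1) R(1) by (intro exI[of _ "(R + 1) ^ N * A"]) auto
qed

section \<open>Density of test functions in the Schwartz space\<close>

lemma le_zero_of_le_small:
  assumes "\<And>a::real. 0 < a \<Longrightarrow> a \<le> 1 \<Longrightarrow> x \<le> a * M"
  shows "x \<le> (0::real)"
proof (rule ccontr)
  assume "\<not> x \<le> 0"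
  moreover from this have "M > 0" using assms[of 1] by simp
  \<comment> \<open>With this a the assumption gives x \<le> x / 2, against x > 0.\<close>
  moreover have "x \<le> min 1 (x / (2 * M)) * M" using calculation by (intro assms) auto
  ultimately show False by (auto simp: min_def field_simps split: if_splits)
qed

text \<open>The product lives on |t| \<ge> R, where one more power of |t| is available: a seminorm
  of f of order N + 1 bounds the weighted derivatives by a multiple of 1/|t| \<le> 1/R.\<close>

lemma cutoff_approx:
  assumes f: "f \<in> schwartz" and st: "\<And>R. smooth (\<theta> R)" and t1: "\<And>R t. \<bar>t\<bar> \<le> R \<Longrightarrow> \<theta> R t = (1::complex)"
    and b: "\<exists>C>0. \<forall>R t. \<forall>m\<le>N. norm ((vderiv ^^ m) (\<theta> R) t) \<le> C"
  shows "\<exists>M>0. \<forall>R\<ge>1. seminorm_le N (M / R) (\<lambda>t. (1 + - \<theta> R t) * f t)"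
proof -
  obtain C where C: "C > 0" "\<And>R t m. m \<le> N \<Longrightarrow> norm ((vderiv ^^ m) (\<theta> R) t) \<le> C" using b by blast
  obtain A where A: "A > 0" "seminorm_le (N + 1) A f" using schwartz_seminorm_le[OF f] by blast
  have sf: "smooth f" by (rule schwartz_smooth[OF f])
  have sm: "smooth (\<lambda>t. - \<theta> R t)" for R
    by (rule smooth_linear[OF bounded_linear_minus[OF bounded_linear_ident] st])
  have s1: "smooth (\<lambda>t. 1 + - \<theta> R t)" for R by (rule smooth_add[OF smooth_const sm])
  have n1: "norm ((vderiv ^^ m) (\<lambda>t. 1 + - \<theta> R t) t) \<le> 1 + C" if "m \<le> N" for m R t
  proof -
    have "norm ((vderiv ^^ m) (\<lambda>t. 1::complex) t) \<le> 1"
      by (cases m) (simp_all add: funpow_vderiv_Suc vderiv_const funpow_vderiv_zero del: funpow.simps(2))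
    then show ?thesis
      unfolding funpow_vderiv_add[OF smooth_const sm] funpow_vderiv_linear[OF bounded_linear_minus[OF bounded_linear_ident] st]
      using C(2)[OF that, of R t] by (intro order_trans[OF norm_triangle_ineq]) (simp add: add_mono)
  qed
  have "seminorm_le N (2 ^ N * ((1 + C) * A) / R) (\<lambda>t. (1 + - \<theta> R t) * f t)" if R: "R \<ge> 1" for R
    unfolding seminorm_le_def
  proof (intro allI impI)
    fix k m t assume km: "k \<le> N" "m \<le> N"
    show "\<bar>t\<bar> ^ k * norm ((vderiv ^^ m) (\<lambda>t. (1 + - \<theta> R t) * f t) t) \<le> 2 ^ N * ((1 + C) * A) / R"
    proof (cases "\<bar>t\<bar> < R")
      case True
      have "open {t::real. \<bar>t\<bar> < R}" by (intro open_Collect_less continuous_intros)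
      then have "(vderiv ^^ m) (\<lambda>t. (1 + - \<theta> R t) * f t) t = (vderiv ^^ m) (\<lambda>t. 0) t"
        by (rule funpow_vderiv_cong_open[OF smooth_mult[OF s1 sf] smooth_const]) (use True t1 in auto)
      then show ?thesis using A C R by (simp add: funpow_vderiv_zero)
    next
      case False
      then have t: "\<bar>t\<bar> > 0" using R by simp
      have "norm ((vderiv ^^ m) (\<lambda>t. (1 + - \<theta> R t) * f t) t) \<le> 2 ^ m * ((1 + C) * (A / (\<bar>t\<bar> ^ k * \<bar>t\<bar>)))"
      proof (rule norm_funpow_vderiv_mult_le[OF s1 sf])
        fix i assume i: "i \<le> m"
        show "norm ((vderiv ^^ i) (\<lambda>t. 1 + - \<theta> R t) t) \<le> 1 + C" using n1[of i R t] i km by simp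
        have "\<bar>t\<bar> ^ Suc k * norm ((vderiv ^^ i) f t) \<le> A"
          by (rule A(2)[unfolded seminorm_le_def, rule_format]) (use i km in auto)
        then show "norm ((vderiv ^^ i) f t) \<le> A / (\<bar>t\<bar> ^ k * \<bar>t\<bar>)"
          using t by (simp add: field_simps)
      qed (use C A in auto)
      then have "\<bar>t\<bar> ^ k * norm ((vderiv ^^ m) (\<lambda>t. (1 + - \<theta> R t) * f t) t) \<le> \<bar>t\<bar> ^ k * (2 ^ m * ((1 + C) * (A / (\<bar>t\<bar> ^ k * \<bar>t\<bar>))))"
        by (intro mult_left_mono) auto
      also have "\<dots> = 2 ^ m * ((1 + C) * A) / \<bar>t\<bar>" using t by simp
      also have "\<dots> \<le> 2 ^ N * ((1 + C) * A) / R"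
        using False km C A R by (intro frac_le mult_right_mono power_increasing) auto
      finally show ?thesis .
    qed
  qed
  then show ?thesis using A C by (intro exI[of _ "2 ^ N * ((1 + C) * A)"]) auto
qed

text \<open>Cut both arguments off at R = 1/a. The tails have seminorms O(a), the truncated f stays
  bounded uniformly in R, and the term with both arguments truncated is zero.\<close>

lemma vanish_on_schwartz:
  fixes E :: "(real \<Rightarrow> complex) \<Rightarrow> (real \<Rightarrow> complex) \<Rightarrow> complex"
  assumes al: "\<And>f g h. f \<in> schwartz \<Longrightarrow> g \<in> schwartz \<Longrightarrow> h \<in> schwartz \<Longrightarrow> E (\<lambda>t. f t + g t) h = E f h + E g h"
    and ar: "\<And>f g h. f \<in> schwartz \<Longrightarrow> g \<in> schwartz \<Longrightarrow> h \<in> schwartz \<Longrightarrow> E h (\<lambda>t. f t + g t) = E h f + E h g"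
    and bd: "\<And>f g a b. f \<in> schwartz \<Longrightarrow> g \<in> schwartz \<Longrightarrow> a > 0 \<Longrightarrow> b > 0 \<Longrightarrow>
        seminorm_le N a f \<Longrightarrow> seminorm_le N b g \<Longrightarrow> norm (E f g) \<le> K * a * b"
    and z: "\<And>f g. f \<in> test_functions \<Longrightarrow> g \<in> test_functions \<Longrightarrow> E f g = 0"
    and K: "K > 0" and f: "f \<in> schwartz" and g: "g \<in> schwartz"
  shows "E f g = 0"
proof -
  obtain \<theta> :: "real \<Rightarrow> real \<Rightarrow> complex" where t: "\<And>R. R \<ge> 0 \<Longrightarrow> \<theta> R \<in> test_functions" "\<And>R t. \<bar>t\<bar> \<le> R \<Longrightarrow> \<theta> R t = 1"
    "\<And>N. \<exists>C>0. \<forall>R t. \<forall>m\<le>N. norm ((vderiv ^^ m) (\<theta> R) t) \<le> C" and ts: "\<And>R. smooth (\<theta> R)"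
    using plateau_exists by auto
  obtain M where M: "M > 0" "\<forall>R\<ge>1. seminorm_le N (M / R) (\<lambda>t. (1 + - \<theta> R t) * f t)"
    using cutoff_approx[OF f ts t(2) t(3)] by blast
  obtain M' where M': "M' > 0" "\<forall>R\<ge>1. seminorm_le N (M' / R) (\<lambda>t. (1 + - \<theta> R t) * g t)"
    using cutoff_approx[OF g ts t(2) t(3)] by blast
  obtain A where A: "A > 0" "seminorm_le N A f" using schwartz_seminorm_le[OF f] by blast
  obtain B where B: "B > 0" "seminorm_le N B g" using schwartz_seminorm_le[OF g] by blast
  have "norm (E f g) \<le> a * (K * M * B + K * (A + M) * M')" if a: "0 < a" "a \<le> 1" for a
  proof -
    define R where "R = 1 / a"
    have R: "R \<ge> 1" "M / R = a * M" "M' / R = a * M'" using a by (auto simp: R_def)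
    define f1 where "f1 t = \<theta> R t * f t" for t
    define f2 where "f2 t = (1 + - \<theta> R t) * f t" for t
    define g1 where "g1 t = \<theta> R t * g t" for t
    define g2 where "g2 t = (1 + - \<theta> R t) * g t" for t
    have tR: "\<theta> R \<in> test_functions" using t(1) R by simp
    have t1: "f1 \<in> test_functions" "g1 \<in> test_functions"
      using test_smooth_mult[OF tR schwartz_smooth[OF f]] test_smooth_mult[OF tR schwartz_smooth[OF g]]
      by (simp_all add: f1_def[abs_def] g1_def[abs_def] mult.commute)
    note s1 = test_schwartz[OF t1(1)] test_schwartz[OF t1(2)]
    have f2: "f2 = (\<lambda>t. f t + (-1) * f1 t)" and g2: "g2 = (\<lambda>t. g t + (-1) * g1 t)"
      by (auto simp: f1_def f2_def g1_def g2_def algebra_simps)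
    have s2: "f2 \<in> schwartz" "g2 \<in> schwartz"
      unfolding f2 g2 by (intro schwartz_add schwartz_cmult f g s1)+
    have fe: "f = (\<lambda>t. f1 t + f2 t)" and ge: "g = (\<lambda>t. g1 t + g2 t)"
      by (auto simp: f1_def f2_def g1_def g2_def algebra_simps)
    have b2: "seminorm_le N (a * M) f2" "seminorm_le N (a * M') g2"
      using M(2) M'(2) R by (auto simp: f2_def[abs_def] g2_def[abs_def])
    have f1e: "f1 = (\<lambda>t. f t + (-1) * f2 t)" by (auto simp: f1_def f2_def algebra_simps)
    have "seminorm_le N (A + norm (-1::complex) * (a * M)) f1"
      unfolding f1e by (rule seminorm_le_add[OF schwartz_smooth[OF f] schwartz_smooth[OF schwartz_cmult[OF s2(1)]] A(2)
            seminorm_le_cmult[OF schwartz_smooth[OF s2(1)] b2(1)]])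
    then have b1: "seminorm_le N (A + M) f1"
      by (rule seminorm_le_mono) (use a M in simp)
    have "E f g = E f1 g + E f2 g" using al[OF s1(1) s2(1) g] fe by simp
    also have "E f1 g = E f1 g1 + E f1 g2" using ar[OF s1(2) s2(2) s1(1)] ge by simp
    also have "E f1 g1 = 0" by (rule z[OF t1])
    finally have "norm (E f g) \<le> norm (E f1 g2) + norm (E f2 g)"
      using norm_triangle_ineq by simp
    also have "norm (E f1 g2) \<le> K * (A + M) * (a * M')"
      by (rule bd[OF s1(1) s2(2) _ _ b1 b2(2)]) (use A M M' a in auto)
    also have "norm (E f2 g) \<le> K * (a * M) * B"
      by (rule bd[OF s2(1) g _ _ b2(1) B(2)]) (use B M a in auto)
    finally show ?thesis by (simp add: algebra_simps)
  qed
  then have "norm (E f g) \<le> 0" by (rule le_zero_of_le_small)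
  then show ?thesis by simp
qed

section \<open>Integrals of products of Schwartz functions\<close>

lemma integrable_one_plus_square: "integrable lborel (\<lambda>t::real. inverse (1 + t^2))"
  using integrable_inverse_1_plus_square by (simp add: set_integrable_def)

text \<open>Order 2 suffices: the weights 1 and t^2 on f together give the integrable factor 1/(1 +
  t^2).\<close>

lemma schwartz_mult_vderiv_bound:
  fixes f g :: "real \<Rightarrow> complex"
  assumes "seminorm_le 2 a f" "seminorm_le 2 b g" "0 \<le> a" "0 \<le> b"
  shows "norm (f t * vderiv g t) \<le> 2 * a * b * inverse (1 + t^2)"
proof -
  have "norm (f t) \<le> a" "t^2 * norm (f t) \<le> a"
    using assms(1)[unfolded seminorm_le_def, rule_format, of 0 0 t] assms(1)[unfolded seminorm_le_def, rule_format, of 2 0 t]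
    by auto
  then have "norm (f t) * (1 + t^2) \<le> 2 * a" by (simp add: algebra_simps)
  then have "norm (f t) \<le> 2 * a * inverse (1 + t^2)"
    by (simp add: field_simps add_pos_nonneg)
  moreover have "norm (vderiv g t) \<le> b"
    using assms(2)[unfolded seminorm_le_def, rule_format, of 0 1 t] by simp
  ultimately have "norm (f t) * norm (vderiv g t) \<le> (2 * a * inverse (1 + t^2)) * b"
    by (intro mult_mono) (use assms in auto)
  then show ?thesis by (simp add: norm_mult mult_ac)
qed

lemma schwartz_integrable:
  fixes f g :: "real \<Rightarrow> complex"
  assumes "f \<in> schwartz" "g \<in> schwartz"
  shows "integrable lborel (\<lambda>t. f t * vderiv g t)"
proof -
  obtain a where a: "a > 0" "seminorm_le 2 a f" using schwartz_seminorm_le[OF assms(1)] by blast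
  obtain b where b: "b > 0" "seminorm_le 2 b g" using schwartz_seminorm_le[OF assms(2)] by blast
  have c: "continuous_on UNIV (\<lambda>t. f t * vderiv g t)"
    by (rule smooth_continuous_on[OF smooth_mult[OF schwartz_smooth[OF assms(1)] smooth_vderiv[OF schwartz_smooth[OF assms(2)]]]])
  show ?thesis
  proof (rule Bochner_Integration.integrable_bound)
    show "integrable lborel (\<lambda>t::real. 2 * a * b * inverse (1 + t^2))"
      by (rule integrable_mult_right[OF integrable_one_plus_square])
    show "(\<lambda>t. f t * vderiv g t) \<in> borel_measurable lborel"
      using borel_measurable_continuous_onI[OF c] by simp
    have "norm (f t * vderiv g t) \<le> norm (2 * a * b * inverse (1 + t^2))" for t
      using schwartz_mult_vderiv_bound[OF a(2) b(2), of t] a(1) b(1) by (auto intro: order_trans)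
    then show "AE t in lborel. norm (f t * vderiv g t) \<le> norm (2 * a * b * inverse (1 + t^2))" by simp
  qed
qed

lemma schwartz_integral_bound:
  fixes f g :: "real \<Rightarrow> complex"
  assumes "f \<in> schwartz" "g \<in> schwartz" "seminorm_le 2 a f" "seminorm_le 2 b g" "0 < a" "0 < b"
  shows "norm (LINT t|lborel. f t * vderiv g t) \<le> (2 * (LINT t|lborel. inverse (1 + t^2))) * a * b"
proof -
  have "norm (LINT t|lborel. f t * vderiv g t) \<le> (LINT t|lborel. 2 * a * b * inverse (1 + t^2))"
  proof (rule Bochner_Integration.integral_norm_bound_integral[OF schwartz_integrable[OF assms(1,2)]])
    show "integrable lborel (\<lambda>t::real. 2 * a * b * inverse (1 + t^2))"
      by (rule integrable_mult_right[OF integrable_one_plus_square])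
    show "norm (f t * vderiv g t) \<le> 2 * a * b * inverse (1 + t^2)" for t
      by (rule schwartz_mult_vderiv_bound) (use assms in auto)
  qed
  then show ?thesis by (simp add: mult_ac)
qed

section \<open>Translation-invariant cyclic cocycles on the line\<close>

text \<open>The scalar form left once the Lie algebra is split off; \<open>cocycle\<close> is the
  Lie algebra cocycle condition with its Lie algebra factor cancelled. This identity and translation
  invariance are asked on test functions, where the algebra takes place. Linearity and the estimate
  hold on all Schwartz functions, for the passage to the limit at the end.\<close>

locale cyclic_cocycle =
  fixes D :: "(real \<Rightarrow> complex) \<Rightarrow> (real \<Rightarrow> complex) \<Rightarrow> complex" and N :: nat and K :: real
  assumes add_left: "f \<in> schwartz \<Longrightarrow> g \<in> schwartz \<Longrightarrow> h \<in> schwartz \<Longrightarrow> D (\<lambda>t. f t + g t) h = D f h + D g h"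
    and scale_left: "f \<in> schwartz \<Longrightarrow> h \<in> schwartz \<Longrightarrow> D (\<lambda>t. c * f t) h = c * D f h"
    and antisym: "f \<in> schwartz \<Longrightarrow> g \<in> schwartz \<Longrightarrow> D f g = - D g f"
    and cocycle: "f \<in> test_functions \<Longrightarrow> g \<in> test_functions \<Longrightarrow> h \<in> test_functions \<Longrightarrow>
        D (\<lambda>t. f t * g t) h + D (\<lambda>t. g t * h t) f + D (\<lambda>t. h t * f t) g = 0"
    and translation: "f \<in> test_functions \<Longrightarrow> g \<in> test_functions \<Longrightarrow> D (\<lambda>t. f (t - a)) (\<lambda>t. g (t - a)) = D f g"
    and bound: "f \<in> schwartz \<Longrightarrow> g \<in> schwartz \<Longrightarrow> a > 0 \<Longrightarrow> b > 0 \<Longrightarrow>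
        seminorm_le N a f \<Longrightarrow> seminorm_le N b g \<Longrightarrow> norm (D f g) \<le> K * a * b"
    and K_pos: "K > 0"
begin

lemma add_right:
  assumes "f \<in> schwartz" "g \<in> schwartz" "h \<in> schwartz"
  shows "D h (\<lambda>t. f t + g t) = D h f + D h g"
  using add_left[OF assms] antisym[OF assms(3) schwartz_add[OF assms(1,2)]] antisym[OF assms(3,1)] antisym[OF assms(3,2)]
  by simp

lemma scale_right:
  assumes "f \<in> schwartz" "h \<in> schwartz"
  shows "D h (\<lambda>t. c * f t) = c * D h f"
  using scale_left[OF assms] antisym[OF assms(2) schwartz_cmult[OF assms(1)]] antisym[OF assms(2,1)] by simp

text \<open>The derivative at a = 0 of \<open>D\<close> on translates, with explicit errors: the
  difference quotient \<open>p h a\<close> is -h' up to a remainder \<open>r h a\<close> of size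
  O(a).\<close>

lemma vderiv_skew:
  assumes f: "f \<in> test_functions" and g: "g \<in> test_functions"
  shows "D (vderiv f) g = - D f (vderiv g)"
proof -
  define r where "r f a t = of_real (1 / a) * (f (t - a) + - f t) + vderiv f t" for f :: "real \<Rightarrow> complex" and a t :: real
  define p where "p f a t = of_real (1 / a) * (f (t - a) + - f t)" for f :: "real \<Rightarrow> complex" and a t :: real
  obtain B where B: "B > 0" "\<forall>a>0. a \<le> 1 \<longrightarrow> seminorm_le N (B * a) (r f a)"
    using translation_remainder[OF f] unfolding r_def[abs_def] by blast
  obtain C where C: "C > 0" "\<forall>a>0. a \<le> 1 \<longrightarrow> seminorm_le N (C * a) (r g a)"
    using translation_remainder[OF g] unfolding r_def[abs_def] by blast
  have tp: "p h a \<in> test_functions" if "h \<in> test_functions" for h a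
    using test_cmult[OF test_add[OF test_translate[OF that] test_cmult[OF that, of "-1"]], of "of_real (1/a)" a]
    by (simp add: p_def[abs_def])
  have tr: "r h a \<in> test_functions" if "h \<in> test_functions" for h a
    using test_add[OF tp[OF that] test_vderiv[OF that]] by (simp add: p_def r_def[abs_def])
  note S = test_schwartz[OF f] test_schwartz[OF g] test_schwartz[OF test_vderiv[OF f]] test_schwartz[OF test_vderiv[OF g]]
    test_schwartz[OF tp[OF f]] test_schwartz[OF tp[OF g]] test_schwartz[OF tr[OF f]] test_schwartz[OF tr[OF g]]
  obtain bf where bf: "bf > 0" "seminorm_le N bf f" using schwartz_seminorm_le[OF S(1)] by blast
  obtain bg where bg: "bg > 0" "seminorm_le N bg g" using schwartz_seminorm_le[OF S(2)] by blast
  obtain cf where cf: "cf > 0" "seminorm_le N cf (vderiv f)" using schwartz_seminorm_le[OF S(3)] by blast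
  obtain cg where cg: "cg > 0" "seminorm_le N cg (vderiv g)" using schwartz_seminorm_le[OF S(4)] by blast
  have "norm (D (vderiv f) g + D f (vderiv g)) \<le> a * (K * B * bg + K * bf * C + K * (B + cf) * (C + cg))"
    if a: "0 < a" "a \<le> 1" for a
  proof -
    have pe: "p h a = (\<lambda>t. r h a t + (-1) * vderiv h t)" for h by (auto simp: p_def r_def)
    have te: "(\<lambda>t. h (t - a)) = (\<lambda>t. h t + of_real a * p h a t)" for h :: "real \<Rightarrow> complex"
      using a by (auto simp: p_def)
    \<comment> \<open>Each translate is h + a p. Translation invariance cancels
      \<open>D f g\<close>, one factor a is divided out, and the quadratic term keeps a factor a
      while \<open>D (p f a) (p g a)\<close> stays bounded.\<close>
    have ex: "D (\<lambda>t. f t + of_real a * p f a t) (\<lambda>t. g t + of_real a * p g a t)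
      = D f g + of_real a * D f (p g a) + of_real a * (D (p f a) g + of_real a * D (p f a) (p g a))"
      by (simp add: add_left add_right scale_left scale_right S schwartz_add schwartz_cmult distrib_left)
    have "D f g + of_real a * D f (p g a) + of_real a * (D (p f a) g + of_real a * D (p f a) (p g a)) = D f g"
      using translation[OF f g, of a] unfolding te ex .
    then have "of_real a * (D f (p g a) + D (p f a) g + of_real a * D (p f a) (p g a)) = 0"
      by (simp add: algebra_simps)
    then have e1: "D f (p g a) + D (p f a) g + of_real a * D (p f a) (p g a) = 0" using a by simp
    have e2: "D (p f a) g = D (r f a) g - D (vderiv f) g"
      by (simp only: pe[of f] add_left[OF S(7) schwartz_cmult[OF S(3)] S(2)] scale_left[OF S(3) S(2)]) simp
    have e3: "D f (p g a) = D f (r g a) - D f (vderiv g)"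
      by (simp only: pe[of g] add_right[OF S(8) schwartz_cmult[OF S(4)] S(1)] scale_right[OF S(4) S(1)]) simp
    have "D (vderiv f) g + D f (vderiv g) = D (r f a) g + D f (r g a) + of_real a * D (p f a) (p g a)"
      using e1 unfolding e2 e3 by (simp add: algebra_simps)
    then have "norm (D (vderiv f) g + D f (vderiv g)) \<le> norm (D (r f a) g) + norm (D f (r g a)) + a * norm (D (p f a) (p g a))"
      using a by (simp add: norm_mult norm_triangle_mono order_trans[OF norm_triangle_ineq])
    also have "norm (D (r f a) g) \<le> K * (B * a) * bg"
      by (rule bound[OF S(7,2) _ _ _ bg(2)]) (use B bg a in auto)
    also have "norm (D f (r g a)) \<le> K * bf * (C * a)"
      by (rule bound[OF S(1,8) _ _ bf(2)]) (use C bf a in auto)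
    also have "norm (D (p f a) (p g a)) \<le> K * (B + cf) * (C + cg)"
    proof (rule bound[OF S(5,6)])
      have "seminorm_le N (B * a + norm (-1::complex) * cf) (p f a)" unfolding pe
        by (rule seminorm_le_add[OF schwartz_smooth[OF S(7)] schwartz_smooth[OF schwartz_cmult[OF S(3)]]
              _ seminorm_le_cmult[OF schwartz_smooth[OF S(3)] cf(2)]]) (use B a in auto)
      then show "seminorm_le N (B + cf) (p f a)" by (rule seminorm_le_mono) (use B a in simp)
      have "seminorm_le N (C * a + norm (-1::complex) * cg) (p g a)" unfolding pe
        by (rule seminorm_le_add[OF schwartz_smooth[OF S(8)] schwartz_smooth[OF schwartz_cmult[OF S(4)]]
              _ seminorm_le_cmult[OF schwartz_smooth[OF S(4)] cg(2)]]) (use C a in auto)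
      then show "seminorm_le N (C + cg) (p g a)" by (rule seminorm_le_mono) (use C a in simp)
    qed (use B C cf cg in auto)
    finally show ?thesis using a by (simp add: algebra_simps)
  qed
  then have "norm (D (vderiv f) g + D f (vderiv g)) \<le> 0" by (rule le_zero_of_le_small)
  then show ?thesis by (simp add: add_eq_0_iff2)
qed

text \<open>The cyclic identity solved for one term by skewness. It has the shape of the product
  rule for (u g)' under an integral against f.\<close>

lemma leibniz:
  assumes "f \<in> test_functions" "u \<in> test_functions" "g \<in> test_functions"
  shows "D f (\<lambda>t. u t * g t) = D (\<lambda>t. f t * u t) g + D (\<lambda>t. f t * g t) u"
proof -
  have e: "(\<lambda>t. g t * f t) = (\<lambda>t. f t * g t)" by (simp add: mult.commute)
  have a: "D f (\<lambda>t. u t * g t) = - D (\<lambda>t. u t * g t) f"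
    by (rule antisym[OF test_schwartz[OF assms(1)] test_schwartz[OF test_mult[OF assms(2,3)]]])
  show ?thesis unfolding a using cocycle[OF assms] unfolding e by algebra
qed

section \<open>The commutator with multiplication by t\<close>

definition L :: "(real \<Rightarrow> complex) \<Rightarrow> (real \<Rightarrow> complex) \<Rightarrow> complex" where
  "L f g = D f (\<lambda>t. of_real t * g t) - D (\<lambda>t. of_real t * f t) g"

text \<open>Expand both terms of \<open>L f (u g)\<close> by \<open>leibniz\<close>: each produces
  \<open>D (t f g) u\<close>, and these cancel.\<close>

lemma L_mult:
  assumes f: "f \<in> test_functions" and u: "u \<in> test_functions" and g: "g \<in> test_functions"
  shows "L (\<lambda>t. f t * u t) g = L f (\<lambda>t. u t * g t)"
proof -
  have 1: "D f (\<lambda>t. of_real t * (u t * g t)) = D (\<lambda>t. f t * u t) (\<lambda>t. of_real t * g t) + D (\<lambda>t. f t * (of_real t * g t)) u"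
    using leibniz[OF f u test_of_real_mult[OF g]] by (simp add: mult.left_commute)
  have 2: "D (\<lambda>t. of_real t * f t) (\<lambda>t. u t * g t) = D (\<lambda>t. of_real t * (f t * u t)) g + D (\<lambda>t. f t * (of_real t * g t)) u"
    using leibniz[OF test_of_real_mult[OF f] u g] by (simp add: mult_ac)
  show ?thesis unfolding L_def 1 2 by simp
qed

lemma L_add_left:
  assumes "f \<in> test_functions" "g \<in> test_functions" "h \<in> test_functions"
  shows "L (\<lambda>t. f t + c * g t) h = L f h + c * L g h"
proof -
  have "(\<lambda>t. of_real t * (f t + c * g t)) = (\<lambda>t. of_real t * f t + c * (of_real t * g t))"
    by (simp add: algebra_simps)
  then show ?thesis
    by (simp add: L_def add_left scale_left assms test_schwartz schwartz_cmult test_of_real_mult algebra_simps)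
qed

text \<open>The product rule for t f and t g produces \<open>D f g\<close> twice, with opposite
  signs.\<close>

lemma L_skew:
  assumes f: "f \<in> test_functions" and g: "g \<in> test_functions"
  shows "L (vderiv f) g = - L f (vderiv g)"
proof -
  note F = test_vderiv[OF f] test_of_real_mult[OF f] test_of_real_mult[OF test_vderiv[OF f]]
  note G = test_vderiv[OF g] test_of_real_mult[OF g] test_of_real_mult[OF test_vderiv[OF g]]
  have 1: "D (vderiv f) (\<lambda>t. of_real t * g t) = - (D f (\<lambda>t. of_real t * vderiv g t) + D f g)"
    using vderiv_skew[OF f G(2)] add_right[OF test_schwartz[OF G(3)] test_schwartz[OF g] test_schwartz[OF f]]
    by (simp add: vderiv_of_real_mult[OF test_smooth[OF g]])
  have 2: "D (\<lambda>t. of_real t * vderiv f t) g + D f g = - D (\<lambda>t. of_real t * f t) (vderiv g)"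
    using vderiv_skew[OF F(2) g] add_left[OF test_schwartz[OF F(3)] test_schwartz[OF f] test_schwartz[OF g]]
    by (simp add: vderiv_of_real_mult[OF test_smooth[OF f]])
  show ?thesis using 2 unfolding L_def 1 by algebra
qed

text \<open>Moving g across a plateau that is 1 on its support makes \<open>L f g\<close> a linear
  functional of w = f g. This functional kills derivatives, and a test function of integral zero is
  the derivative of a test function; hence it is a multiple of the integral.\<close>

lemma L_integral: "\<exists>c. \<forall>f\<in>test_functions. \<forall>g\<in>test_functions. L f g = c * (LINT t|lborel. f t * g t)"
proof -
  obtain \<theta> :: "real \<Rightarrow> real \<Rightarrow> complex" where t: "\<And>R. R \<ge> 0 \<Longrightarrow> \<theta> R \<in> test_functions" "\<And>R t. \<bar>t\<bar> \<le> R \<Longrightarrow> \<theta> R t = 1"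
    using plateau_exists by auto
  obtain \<rho> where r: "\<rho> \<in> test_functions" "\<And>t. 2 \<le> \<bar>t\<bar> \<Longrightarrow> \<rho> t = 0" "(LINT t|lborel. \<rho> t) = 1"
    using unit_mass_exists by auto
  \<comment> \<open>\<open>\<theta> R\<close> stands for the constant 1. The factor
    \<open>L (\<theta> 2) \<rho>\<close> does not involve R: \<open>\<theta> 2\<close> is 1 on the
    support of \<open>\<rho>\<close>, so \<open>L \<rho> (\<theta> R)\<close> can be rewritten by
    \<open>L_mult\<close>, and \<open>\<rho>\<close> absorbs \<open>\<theta> R\<close>.\<close>
  have main: "L w (\<theta> R) = (LINT t|lborel. w t) * L (\<theta> 2) \<rho>"
    if w: "w \<in> test_functions" "\<And>t. R \<le> \<bar>t\<bar> \<Longrightarrow> w t = 0" and R: "R \<ge> 2" for w R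
  proof -
    define m where "m = (LINT t|lborel. w t)"
    define w0 where "w0 t = w t + (- m) * \<rho> t" for t
    have tR: "\<theta> R \<in> test_functions" and t2: "\<theta> 2 \<in> test_functions" using t(1) R by auto
    have w0: "w0 \<in> test_functions" unfolding w0_def[abs_def] by (rule test_add[OF w(1) test_cmult[OF r(1)]])
    have i0: "(LINT t|lborel. w0 t) = 0"
      unfolding w0_def using test_integrable[OF w(1)] test_integrable[OF r(1)] by (simp add: m_def r(3))
    have z0: "w0 t = 0" if "R \<le> \<bar>t\<bar>" for t using w(2)[OF that] r(2)[of t] that R by (simp add: w0_def)
    obtain u where u: "u \<in> test_functions" "vderiv u = w0" "\<And>t. R \<le> \<bar>t\<bar> \<Longrightarrow> u t = 0"
      using test_antiderivative[OF w0 i0, of R] z0 R by auto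
    have tu: "(\<lambda>t. \<theta> R t * u t) = u"
    proof
      show "\<theta> R t * u t = u t" for t using t(2)[of t R] u(3)[of t] by (cases "\<bar>t\<bar> \<le> R") auto
    qed
    have ut: "(\<lambda>t. u t * vderiv (\<theta> R) t) = (\<lambda>t. 0)"
    proof
      fix s
      show "u s * vderiv (\<theta> R) s = 0"
      proof (cases "\<bar>s\<bar> < R")
        case True
        have "open {s::real. \<bar>s\<bar> < R}" by (intro open_Collect_less continuous_intros)
        then have "(vderiv ^^ 1) (\<theta> R) s = (vderiv ^^ 1) (\<lambda>s. 1) s"
          by (rule funpow_vderiv_cong_open[OF test_smooth[OF tR] smooth_const]) (use True t(2) in auto)
        then show ?thesis by (simp add: vderiv_const)
      qed (simp add: u(3))
    qed
    have zz: "D h (\<lambda>t. 0) = 0" if "h \<in> schwartz" for h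
      using scale_right[OF test_schwartz[OF tR] that, of 0] by simp
    have "L w0 (\<theta> R) = - L u (vderiv (\<theta> R))" using L_skew[OF u(1) tR] u(2) by simp
    also have "L u (vderiv (\<theta> R)) = L (\<theta> R) (\<lambda>t. u t * vderiv (\<theta> R) t)"
      using L_mult[OF tR u(1) test_vderiv[OF tR]] tu by simp
    also have "\<dots> = 0" unfolding ut L_def
      by (simp add: zz test_schwartz[OF tR] test_schwartz[OF test_of_real_mult[OF tR]])
    finally have "L w0 (\<theta> R) = 0" by simp
    then have 1: "L w (\<theta> R) = m * L \<rho> (\<theta> R)"
      using L_add_left[OF w(1) r(1) tR, of "-m"] by (simp add: w0_def[abs_def])
    have "(\<lambda>t. \<theta> 2 t * \<rho> t) = \<rho>"
    proof
      show "\<theta> 2 t * \<rho> t = \<rho> t" for t using t(2)[of t 2] r(2)[of t] by (cases "\<bar>t\<bar> \<le> 2") auto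
    qed
    moreover have "(\<lambda>t. \<rho> t * \<theta> R t) = \<rho>"
    proof
      show "\<rho> t * \<theta> R t = \<rho> t" for t using t(2)[of t R] r(2)[of t] R by (cases "\<bar>t\<bar> \<le> 2") auto
    qed
    ultimately have "L \<rho> (\<theta> R) = L (\<theta> 2) \<rho>" using L_mult[OF t2 r(1) tR] by simp
    then show ?thesis using 1 by (simp add: m_def)
  qed
  have "L f g = L (\<theta> 2) \<rho> * (LINT t|lborel. f t * g t)" if f: "f \<in> test_functions" and g: "g \<in> test_functions" for f g
  proof -
    obtain R where R: "R \<ge> 2" "\<forall>t. R \<le> \<bar>t\<bar> \<longrightarrow> g t = 0" using test_support[OF g] by blast
    have "(\<lambda>t. g t * \<theta> R t) = g"
    proof
      show "g t * \<theta> R t = g t" for t using t(2)[of t R] R by (cases "\<bar>t\<bar> \<le> R") auto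
    qed
    then have "L f g = L (\<lambda>t. f t * g t) (\<theta> R)"
      using L_mult[OF f g t(1)[of R]] R by simp
    also have "\<dots> = (LINT t|lborel. f t * g t) * L (\<theta> 2) \<rho>"
      by (rule main[OF test_mult[OF f g]]) (use R in auto)
    finally show ?thesis by simp
  qed
  then show ?thesis by blast
qed

text \<open>Commutators with \<open>D\<close> obey the product rule: for a + t P, first t and then P
  is moved across, and the two integrals add up to the one with the derivative P + t P'.\<close>

lemma poly_rule:
  assumes L: "\<And>f g. f \<in> test_functions \<Longrightarrow> g \<in> test_functions \<Longrightarrow> L f g = c * (LINT t|lborel. f t * g t)"
    and "f \<in> test_functions" "g \<in> test_functions"
  shows "D f (\<lambda>t. poly P (of_real t) * g t) - D (\<lambda>t. poly P (of_real t) * f t) g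
    = c * (LINT t|lborel. poly (pderiv P) (of_real t) * (f t * g t))"
  using assms(2,3)
proof (induction P arbitrary: f g)
  case 0
  have "D f (\<lambda>t. 0) = 0" "D (\<lambda>t. 0) g = 0"
    using scale_right[OF test_schwartz[OF 0(2)] test_schwartz[OF 0(1)], of 0]
      scale_left[OF test_schwartz[OF 0(1)] test_schwartz[OF 0(2)], of 0] by simp_all
  then show ?case by simp
next
  case (pCons a P)
  note f = \<open>f \<in> test_functions\<close> and g = \<open>g \<in> test_functions\<close>
  let ?t = "complex_of_real"
  note pf = test_poly_mult[OF f, of P] and pg = test_poly_mult[OF g, of P]
    and tf = test_of_real_mult[OF f] and tpf = test_of_real_mult[OF test_poly_mult[OF f, of P]]
    and tpg = test_of_real_mult[OF test_poly_mult[OF g, of P]]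
  have e: "(\<lambda>t. poly (pCons a P) (?t t) * h t) = (\<lambda>t. a * h t + ?t t * (poly P (?t t) * h t))" for h
    by (simp add: algebra_simps)
  have 1: "D f (\<lambda>t. poly (pCons a P) (?t t) * g t) = a * D f g + D f (\<lambda>t. ?t t * (poly P (?t t) * g t))"
    unfolding e using add_right[OF schwartz_cmult[OF test_schwartz[OF g]] test_schwartz[OF tpg] test_schwartz[OF f]]
      scale_right[OF test_schwartz[OF g] test_schwartz[OF f]] by simp
  have 2: "D (\<lambda>t. poly (pCons a P) (?t t) * f t) g = a * D f g + D (\<lambda>t. ?t t * (poly P (?t t) * f t)) g"
    unfolding e using add_left[OF schwartz_cmult[OF test_schwartz[OF f]] test_schwartz[OF tpf] test_schwartz[OF g]]
      scale_left[OF test_schwartz[OF f] test_schwartz[OF g]] by simp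
  have 3: "D f (\<lambda>t. ?t t * (poly P (?t t) * g t)) = D (\<lambda>t. ?t t * f t) (\<lambda>t. poly P (?t t) * g t)
      + c * (LINT t|lborel. f t * (poly P (?t t) * g t))"
    using L[OF f pg] by (simp add: L_def algebra_simps)
  have 4: "D (\<lambda>t. ?t t * f t) (\<lambda>t. poly P (?t t) * g t) = D (\<lambda>t. ?t t * (poly P (?t t) * f t)) g
      + c * (LINT t|lborel. poly (pderiv P) (?t t) * (?t t * f t * g t))"
    using pCons.IH[OF tf g] by (simp add: mult.left_commute algebra_simps)
  have i: "integrable lborel (\<lambda>t. f t * (poly P (?t t) * g t))" "integrable lborel (\<lambda>t. poly (pderiv P) (?t t) * (?t t * f t * g t))"
    by (rule test_integrable[OF test_mult[OF f pg]], rule test_integrable[OF test_poly_mult[OF test_mult[OF tf g]]])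
  have "(LINT t|lborel. poly (pderiv (pCons a P)) (?t t) * (f t * g t))
    = (LINT t|lborel. f t * (poly P (?t t) * g t) + poly (pderiv P) (?t t) * (?t t * f t * g t))"
    by (rule Bochner_Integration.integral_cong) (simp_all add: pderiv_pCons algebra_simps)
  also have "\<dots> = (LINT t|lborel. f t * (poly P (?t t) * g t)) + (LINT t|lborel. poly (pderiv P) (?t t) * (?t t * f t * g t))"
    by (rule Bochner_Integration.integral_add[OF i])
  finally show ?case unfolding 1 2 3 4 by (simp add: algebra_simps)
qed

text \<open>For a polynomial P near u the rule holds exactly, so the defect for u is the defect for
  v = u - P. Closeness is available on [-R, R] only, where f and g live; outside, v may grow but is
  multiplied by zero.\<close>

lemma multiplier_rule:
  assumes L: "\<And>f g. f \<in> test_functions \<Longrightarrow> g \<in> test_functions \<Longrightarrow> L f g = c * (LINT t|lborel. f t * g t)"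
    and u: "u \<in> test_functions" and f: "f \<in> test_functions" and g: "g \<in> test_functions"
  shows "D f (\<lambda>t. u t * g t) - D (\<lambda>t. u t * f t) g = c * (LINT t|lborel. vderiv u t * (f t * g t))"
proof -
  obtain R0 where R0: "R0 \<ge> 1" "\<forall>t. R0 \<le> \<bar>t\<bar> \<longrightarrow> f t = 0" using test_support[OF f] by blast
  obtain R where R: "R \<ge> R0" "\<forall>t. R \<le> \<bar>t\<bar> \<longrightarrow> g t = 0" using test_support[OF g] by blast
  have Rf: "f t = 0" if "R \<le> \<bar>t\<bar>" for t using R0 R that by auto
  obtain F where F: "F > 0" "seminorm_le N F f" using schwartz_seminorm_le[OF test_schwartz[OF f]] by blast
  obtain G where G: "G > 0" "seminorm_le N G g" using schwartz_seminorm_le[OF test_schwartz[OF g]] by blast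
  \<comment> \<open>R^N bounds the weights, 2^N counts the terms of the product rule.\<close>
  define Q where "Q = R ^ N * 2 ^ N"
  have Q: "Q > 0" using R R0 by (simp add: Q_def)
  define X where "X = D f (\<lambda>t. u t * g t) - D (\<lambda>t. u t * f t) g - c * (LINT t|lborel. vderiv u t * (f t * g t))"
  define I where "I = (LINT t|lborel. norm (f t * g t))"
  have su: "smooth u" by (rule test_smooth[OF u])
  have "norm X \<le> a * (K * F * (Q * G) + K * (Q * F) * G + norm c * I)" if a: "0 < a" "a \<le> 1" for a
  proof -
    have "R > 0" using R R0 by simp
    \<comment> \<open>Orders up to N enter the seminorms of v f and v g; the extra one covers v' in
      the integral even when N = 0.\<close>
    from poly_approx_smooth[OF su a(1) this, of "N + 1"]
    obtain P where P: "\<forall>j\<le>N + 1. \<forall>t. \<bar>t\<bar> \<le> R \<longrightarrow> norm ((vderiv ^^ j) u t + - poly ((pderiv ^^ j) P) (of_real t)) \<le> a" ..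
    define v where "v t = u t + - poly P (of_real t)" for t
    have sp: "smooth (\<lambda>t. - poly P (complex_of_real t))"
      by (rule smooth_linear[OF bounded_linear_minus[OF bounded_linear_ident] smooth_poly])
    have sv: "smooth v" unfolding v_def[abs_def] by (rule smooth_add[OF su sp])
    have dv: "(vderiv ^^ j) v t = (vderiv ^^ j) u t + - poly ((pderiv ^^ j) P) (of_real t)" for j t
      unfolding v_def[abs_def] funpow_vderiv_add[OF su sp]
        funpow_vderiv_linear[OF bounded_linear_minus[OF bounded_linear_ident] smooth_poly] funpow_vderiv_poly ..
    have dv1: "vderiv v t = vderiv u t - poly (pderiv P) (of_real t)" for t using dv[of 1 t] by simp
    have bv: "norm ((vderiv ^^ j) v t) \<le> a" if "j \<le> N + 1" "\<bar>t\<bar> \<le> R" for j t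
      using P[rule_format, OF that] by (simp only: dv)
    have sb: "seminorm_le N (a * (Q * H)) (\<lambda>t. v t * h t)"
      if h: "h \<in> test_functions" "\<And>t. R \<le> \<bar>t\<bar> \<Longrightarrow> h t = 0" "H > 0" "seminorm_le N H h" for h H
    proof -
      have "seminorm_le N (R ^ N * (2 ^ N * (a * H))) (\<lambda>t. v t * h t)"
      proof (rule seminorm_le_compact_support[OF smooth_mult[OF sv test_smooth[OF h(1)]]])
        fix m t assume m: "m \<le> N" "\<bar>t\<bar> \<le> R"
        have "norm ((vderiv ^^ m) (\<lambda>t. v t * h t) t) \<le> 2 ^ m * (a * H)"
        proof (rule norm_funpow_vderiv_mult_le[OF sv test_smooth[OF h(1)]])
          show "norm ((vderiv ^^ i) v t) \<le> a" if "i \<le> m" for i using bv[of i t] that m by simp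
          show "norm ((vderiv ^^ i) h t) \<le> H" if "i \<le> m" for i
            using h(4)[unfolded seminorm_le_def, rule_format, of 0 i t] that m by simp
        qed (use a h in auto)
        also have "\<dots> \<le> 2 ^ N * (a * H)" using m a h(3) by (intro mult_right_mono power_increasing) auto
        finally show "norm ((vderiv ^^ m) (\<lambda>t. v t * h t) t) \<le> 2 ^ N * (a * H)" .
      qed (use h a R R0 in auto)
      then show ?thesis by (simp add: Q_def mult_ac)
    qed
    note vf = test_smooth_mult[OF f sv] and vg = test_smooth_mult[OF g sv]
    have ue: "(\<lambda>t. u t * h t) = (\<lambda>t. v t * h t + poly P (of_real t) * h t)" for h
      by (simp add: v_def algebra_simps)
    have 1: "D f (\<lambda>t. u t * g t) = D f (\<lambda>t. v t * g t) + D f (\<lambda>t. poly P (of_real t) * g t)"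
      unfolding ue by (rule add_right[OF test_schwartz[OF vg] test_schwartz[OF test_poly_mult[OF g]] test_schwartz[OF f]])
    have 2: "D (\<lambda>t. u t * f t) g = D (\<lambda>t. v t * f t) g + D (\<lambda>t. poly P (of_real t) * f t) g"
      unfolding ue by (rule add_left[OF test_schwartz[OF vf] test_schwartz[OF test_poly_mult[OF f]] test_schwartz[OF g]])
    note fg = test_mult[OF f g]
    have i: "integrable lborel (\<lambda>t. vderiv u t * (f t * g t))" "integrable lborel (\<lambda>t. poly (pderiv P) (of_real t) * (f t * g t))"
      by (rule test_integrable[OF test_mult[OF test_vderiv[OF u] fg]], rule test_integrable[OF test_poly_mult[OF fg]])
    have iv: "integrable lborel (\<lambda>t. vderiv v t * (f t * g t))"
      by (rule test_integrable[OF test_smooth_mult[OF fg smooth_vderiv[OF sv]]])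
    have 3: "(LINT t|lborel. vderiv v t * (f t * g t)) =
       (LINT t|lborel. vderiv u t * (f t * g t)) - (LINT t|lborel. poly (pderiv P) (of_real t) * (f t * g t))"
      unfolding Bochner_Integration.integral_diff[OF i, symmetric] by (simp add: dv1 algebra_simps)
    have X: "X = D f (\<lambda>t. v t * g t) - D (\<lambda>t. v t * f t) g - c * (LINT t|lborel. vderiv v t * (f t * g t))"
      unfolding X_def 1 2 3 using poly_rule[OF L f g, of P] by (simp add: algebra_simps)
    have "norm X \<le> norm (D f (\<lambda>t. v t * g t)) + norm (D (\<lambda>t. v t * f t) g) + norm c * norm (LINT t|lborel. vderiv v t * (f t * g t))"
      unfolding X norm_mult[symmetric] by (rule order_trans[OF norm_triangle_ineq4 add_right_mono[OF norm_triangle_ineq4]])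
    also have "norm (D f (\<lambda>t. v t * g t)) \<le> K * F * (a * (Q * G))"
      by (rule bound[OF test_schwartz[OF f] test_schwartz[OF vg] _ _ F(2) sb[OF g]]) (use a F G Q R in auto)
    also have "norm (D (\<lambda>t. v t * f t) g) \<le> K * (a * (Q * F)) * G"
      by (rule bound[OF test_schwartz[OF vf] test_schwartz[OF g] _ _ sb[OF f] G(2)]) (use a F G Q Rf in auto)
    also have "norm c * norm (LINT t|lborel. vderiv v t * (f t * g t)) \<le> norm c * (LINT t|lborel. a * norm (f t * g t))"
    proof (rule mult_left_mono[OF _ norm_ge_zero], rule Bochner_Integration.integral_norm_bound_integral[OF iv])
      show "integrable lborel (\<lambda>t. a * norm (f t * g t))"
        by (rule integrable_mult_right[OF integrable_norm[OF test_integrable[OF fg]]])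
      show "norm (vderiv v t * (f t * g t)) \<le> a * norm (f t * g t)" for t
      proof (cases "\<bar>t\<bar> \<le> R")
        case True
        then show ?thesis using bv[of 1 t] unfolding norm_mult[of "vderiv v t"] by (intro mult_right_mono) auto
      next
        case False
        then show ?thesis using Rf[of t] by simp
      qed
    qed
    finally show ?thesis by (simp add: I_def algebra_simps)
  qed
  then have "norm X \<le> 0" by (rule le_zero_of_le_small)
  then show ?thesis by (simp add: X_def)
qed

lemma classification:
  "\<exists>c. \<forall>f\<in>schwartz. \<forall>g\<in>schwartz. D f g = c * (LINT t|lborel. f t * vderiv g t)"
proof -
  obtain c where L: "\<And>f g. f \<in> test_functions \<Longrightarrow> g \<in> test_functions \<Longrightarrow> L f g = c * (LINT t|lborel. f t * g t)"
    using L_integral by blast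
  obtain \<theta> :: "real \<Rightarrow> real \<Rightarrow> complex" where t: "\<And>R. R \<ge> 0 \<Longrightarrow> \<theta> R \<in> test_functions" "\<And>R t. \<bar>t\<bar> \<le> R \<Longrightarrow> \<theta> R t = 1"
    using plateau_exists by auto
  have test: "D f u = c * (LINT t|lborel. f t * vderiv u t)" if f: "f \<in> test_functions" and u: "u \<in> test_functions" for f u
  proof -
    obtain R where R: "R \<ge> 0" "\<forall>t. R \<le> \<bar>t\<bar> \<longrightarrow> f t = 0" using test_support[OF f] by blast
    have e: "f t * \<theta> R t = f t" for t using t(2)[of t R] R by (cases "\<bar>t\<bar> \<le> R") auto
    \<comment> \<open>The plateau is the third factor in the cyclic identity: being 1 on the support
      of f, it turns \<open>D f u\<close> into a difference to which \<open>multiplier_rule\<close>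
      applies, with the plateau in the role of g.\<close>
    have "D (\<lambda>t. f t * \<theta> R t) u = D f (\<lambda>t. u t * \<theta> R t) - D (\<lambda>t. u t * f t) (\<theta> R)"
      using leibniz[OF f u t(1)[OF R(1)]] by (simp add: mult.commute)
    also have "\<dots> = c * (LINT t|lborel. vderiv u t * (f t * \<theta> R t))"
      by (rule multiplier_rule[OF L u f t(1)[OF R(1)]])
    finally show ?thesis by (simp add: e mult.commute)
  qed
  define J where "J = (LINT t|lborel. inverse (1 + t^2 :: real))"
  have J: "J \<ge> 0" unfolding J_def by (intro Bochner_Integration.integral_nonneg) (simp add: add_nonneg_nonneg)
  define E where "E f g = D f g + (- c) * (LINT t|lborel. f t * vderiv g t)" for f g
  have "E f g = 0" if f: "f \<in> schwartz" and g: "g \<in> schwartz" for f g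
  \<comment> \<open>The order N serves \<open>D\<close>, the order 2 serves the integral.\<close>
  proof (rule vanish_on_schwartz[where N="max N 2" and K="K + norm c * (2 * J)", OF _ _ _ _ _ f g])
    fix f g h :: "real \<Rightarrow> complex" assume S: "f \<in> schwartz" "g \<in> schwartz" "h \<in> schwartz"
    have "(LINT t|lborel. (f t + g t) * vderiv h t) = (LINT t|lborel. f t * vderiv h t) + (LINT t|lborel. g t * vderiv h t)"
      unfolding Bochner_Integration.integral_add[OF schwartz_integrable[OF S(1,3)] schwartz_integrable[OF S(2,3)], symmetric]
      by (simp add: algebra_simps)
    then show "E (\<lambda>t. f t + g t) h = E f h + E g h" by (simp add: E_def add_left S algebra_simps)
    have "(LINT t|lborel. h t * vderiv (\<lambda>t. f t + g t) t) = (LINT t|lborel. h t * vderiv f t) + (LINT t|lborel. h t * vderiv g t)"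
      unfolding Bochner_Integration.integral_add[OF schwartz_integrable[OF S(3,1)] schwartz_integrable[OF S(3,2)], symmetric]
      by (simp add: vderiv_add schwartz_smooth S algebra_simps)
    then show "E h (\<lambda>t. f t + g t) = E h f + E h g" by (simp add: E_def add_right S algebra_simps)
  next
    fix f g :: "real \<Rightarrow> complex" and a b :: real
    assume S: "f \<in> schwartz" "g \<in> schwartz" "0 < a" "0 < b" "seminorm_le (max N 2) a f" "seminorm_le (max N 2) b g"
    have le: "seminorm_le N a f" "seminorm_le N b g" "seminorm_le 2 a f" "seminorm_le 2 b g"
      using S(5,6) by (auto simp: seminorm_le_def)
    have "norm (E f g) \<le> norm (D f g) + norm c * norm (LINT t|lborel. f t * vderiv g t)"
      unfolding E_def by (rule order_trans[OF norm_triangle_ineq]) (simp add: norm_mult)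
    also have "\<dots> \<le> K * a * b + norm c * ((2 * J) * a * b)"
      unfolding J_def by (intro add_mono mult_left_mono bound schwartz_integral_bound S le) auto
    finally show "norm (E f g) \<le> (K + norm c * (2 * J)) * a * b" by (simp add: algebra_simps)
  next
    fix f g assume "f \<in> test_functions" "g \<in> test_functions"
    then show "E f g = 0" by (simp add: E_def test)
  next
    show "K + norm c * (2 * J) > 0" using K_pos J by (intro add_pos_nonneg) auto
  qed
  then show ?thesis by (intro exI[of _ c]) (simp add: E_def)
qed

end

section \<open>The adjoint representation\<close>

lemma differentiable_transform_open:
  assumes "f differentiable (at x)" "open S" "x \<in> S" "\<And>y. y \<in> S \<Longrightarrow> f y = g y"
  shows "g differentiable (at x)"
proof -
  obtain T where "(f has_derivative T) (at x)" using assms(1) unfolding differentiable_def by blast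
  then have "(g has_derivative T) (at x)"
    by (rule has_derivative_transform_within_open[OF _ assms(2,3)]) (rule assms(4))
  then show ?thesis by (rule differentiableI)
qed

text \<open>Coordinate maps are arbitrary outside their domains, so smoothness must be transferred
  between maps that agree only on an open set.\<close>

lemma Ck_on_cong:
  assumes "open S" "\<And>x. x \<in> S \<Longrightarrow> f x = g x" "Ck_on k f S"
  shows "Ck_on k g S"
  using assms(2,3)
proof (induction k arbitrary: f g)
  case 0
  then show ?case by simp
next
  case (Suc k)
  have d: "f differentiable (at x)" if "x \<in> S" for x using Suc.prems(2) that by simp
  have "g differentiable (at x)" if "x \<in> S" for x
    by (rule differentiable_transform_open[OF d[OF that] assms(1) that Suc.prems(1)])
  moreover have "Ck_on k (\<lambda>x. frechet_derivative g (at x) v) S" for v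
  proof (rule Suc.IH)
    show "Ck_on k (\<lambda>x. frechet_derivative f (at x) v) S" using Suc.prems(2) by simp
    show "frechet_derivative f (at x) v = frechet_derivative g (at x) v" if "x \<in> S" for x
      using frechet_derivative_transform_within_open[OF d[OF that] assms(1) that, of g] Suc.prems(1) by simp
  qed
  ultimately show ?case by simp
qed

section \<open>Coordinates on the group and multiplication in charts\<close>

locale lie_chart =
  fixes G :: "'g::{t2_space,second_countable_topology} monoid"
    and A :: "('g, 'e::euclidean_space) chart set" and c :: "('g, 'e) chart"
  assumes lie: "lie_group G A" and chart: "c \<in> A" and one_chart: "\<one>\<^bsub>G\<^esub> \<in> fst c"
begin

sublocale group G using lie by (simp add: lie_group_def)

lemma carrier_UNIV [simp]: "carrier G = UNIV"
  using lie by (simp add: lie_group_def)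

lemma atlas: "smooth_atlas A"
  using lie by (simp add: lie_group_def)

lemma chart_open:
  assumes "d \<in> A" shows "open (fst d)" "open (snd d ` fst d)"
  using atlas assms unfolding smooth_atlas_def by blast+

lemma chart_homeomorphism:
  assumes "d \<in> A" shows "homeomorphism (fst d) (snd d ` fst d) (snd d) (param d)"
  using atlas assms unfolding smooth_atlas_def by blast

lemma param_chart [simp]: "d \<in> A \<Longrightarrow> g \<in> fst d \<Longrightarrow> param d (snd d g) = g"
  using chart_homeomorphism[of d] unfolding homeomorphism_def by blast

lemma param_in:
  assumes "d \<in> A" "x \<in> snd d ` fst d" shows "param d x \<in> fst d" "snd d (param d x) = x"
  using chart_homeomorphism[OF assms(1)] assms(2) unfolding homeomorphism_def by blast+

lemma chart_continuous:
  assumes "d \<in> A" shows "continuous_on (fst d) (snd d)" "continuous_on (snd d ` fst d) (param d)"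
  using chart_homeomorphism[OF assms] unfolding homeomorphism_def by blast+

lemma chart_exists: obtains d where "d \<in> A" "g \<in> fst d"
proof -
  have "g \<in> (\<Union>d\<in>A. fst d)" using atlas unfolding smooth_atlas_def by simp
  then show thesis using that by blast
qed

lemma mult_continuous: "continuous_on UNIV (\<lambda>(g, h). g \<otimes>\<^bsub>G\<^esub> h)"
  and inv_continuous: "continuous_on UNIV (\<lambda>g. inv\<^bsub>G\<^esub> g)"
  using lie unfolding lie_group_def smooth_map_def by blast+

lemma continuous_mult [continuous_intros]:
  assumes "continuous_on S f" "continuous_on S h"
  shows "continuous_on S (\<lambda>x. f x \<otimes>\<^bsub>G\<^esub> h x)"
  using continuous_on_compose2[OF mult_continuous continuous_on_Pair[OF assms]] by simp

lemma continuous_inv [continuous_intros]: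
  assumes "continuous_on S f"
  shows "continuous_on S (\<lambda>x. inv\<^bsub>G\<^esub> (f x))"
  using continuous_on_compose2[OF inv_continuous assms] by simp

lemma open_param_preimage:
  assumes "d \<in> A" "open B" "continuous_on UNIV f"
  shows "open {x \<in> snd d ` fst d. f (param d x) \<in> B}"
proof -
  have "continuous_on (snd d ` fst d) (\<lambda>x. f (param d x))"
    using continuous_on_compose2[OF assms(3) chart_continuous(2)[OF assms(1)]] by simp
  then have "open (snd d ` fst d \<inter> (\<lambda>x. f (param d x)) -` B)"
    by (rule continuous_open_preimage[OF _ chart_open(2)[OF assms(1)] assms(2)])
  also have "snd d ` fst d \<inter> (\<lambda>x. f (param d x)) -` B = {x \<in> snd d ` fst d. f (param d x) \<in> B}" by blast
  finally show ?thesis .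
qed

text \<open>Three charts, since for general g neither g x nor the inverse of g lies in the chart
  \<open>c\<close> around the identity.\<close>

definition mul_chart :: "('g, 'e) chart \<Rightarrow> ('g, 'e) chart \<Rightarrow> ('g, 'e) chart \<Rightarrow> 'e \<times> 'e \<Rightarrow> 'e" where
  "mul_chart d1 d2 d3 z = snd d3 (param d1 (fst z) \<otimes>\<^bsub>G\<^esub> param d2 (snd z))"

definition mul_dom :: "('g, 'e) chart \<Rightarrow> ('g, 'e) chart \<Rightarrow> ('g, 'e) chart \<Rightarrow> ('e \<times> 'e) set" where
  "mul_dom d1 d2 d3 = {z \<in> (snd d1 ` fst d1) \<times> (snd d2 ` fst d2). param d1 (fst z) \<otimes>\<^bsub>G\<^esub> param d2 (snd z) \<in> fst d3}"

text \<open>Smoothness of the multiplication is given through the product atlas, whose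
  \<open>param\<close> is an inverse chosen for the paired map. On the domain it is the pair of the
  two inverses, and only there do the two descriptions agree.\<close>

lemma mul_chart_smooth:
  assumes d: "d1 \<in> A" "d2 \<in> A" "d3 \<in> A"
  shows "open (mul_dom d1 d2 d3)" "smooth_on (mul_chart d1 d2 d3) (mul_dom d1 d2 d3)"
proof -
  define p where "p = (fst d1 \<times> fst d2, map_prod (snd d1) (snd d2))"
  have p: "p \<in> prod_atlas A A" using d unfolding prod_atlas_def p_def by blast
  have inj: "inj_on (map_prod (snd d1) (snd d2)) (fst d1 \<times> fst d2)"
    by (intro map_prod_inj_on inj_on_inverseI[where g="param d1"] inj_on_inverseI[where g="param d2"]) (use d in auto)
  have par: "param p (snd d1 g, snd d2 h) = (g, h)" if "g \<in> fst d1" "h \<in> fst d2" for g h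
    unfolding param_def p_def fst_conv snd_conv by (rule inv_into_f_eq[OF inj]) (use that in auto)
  have S: "snd p ` (fst p \<inter> (\<lambda>(g, h). g \<otimes>\<^bsub>G\<^esub> h) -` fst d3) = mul_dom d1 d2 d3"
  proof (intro equalityI subsetI)
    fix z assume "z \<in> snd p ` (fst p \<inter> (\<lambda>(g, h). g \<otimes>\<^bsub>G\<^esub> h) -` fst d3)"
    then obtain g h where "g \<in> fst d1" "h \<in> fst d2" "g \<otimes>\<^bsub>G\<^esub> h \<in> fst d3" "z = (snd d1 g, snd d2 h)"
      by (auto simp: p_def)
    then show "z \<in> mul_dom d1 d2 d3" using d by (auto simp: mul_dom_def)
  next
    fix z assume z: "z \<in> mul_dom d1 d2 d3"
    then have "z = snd p (param d1 (fst z), param d2 (snd z))"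
      using param_in d by (auto simp: mul_dom_def p_def)
    moreover have "(param d1 (fst z), param d2 (snd z)) \<in> fst p \<inter> (\<lambda>(g, h). g \<otimes>\<^bsub>G\<^esub> h) -` fst d3"
      using z param_in d by (auto simp: mul_dom_def p_def)
    ultimately show "z \<in> snd p ` (fst p \<inter> (\<lambda>(g, h). g \<otimes>\<^bsub>G\<^esub> h) -` fst d3)" by (rule image_eqI)
  qed
  have cont: "continuous_on ((snd d1 ` fst d1) \<times> (snd d2 ` fst d2)) (\<lambda>z. param d1 (fst z) \<otimes>\<^bsub>G\<^esub> param d2 (snd z))"
    by (intro continuous_intros continuous_on_compose2[OF chart_continuous(2)[OF d(1)]]
        continuous_on_compose2[OF chart_continuous(2)[OF d(2)]]) auto
  have "mul_dom d1 d2 d3 = (snd d1 ` fst d1 \<times> snd d2 ` fst d2) \<inter> (\<lambda>z. param d1 (fst z) \<otimes>\<^bsub>G\<^esub> param d2 (snd z)) -` fst d3"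
    unfolding mul_dom_def by blast
  then show op: "open (mul_dom d1 d2 d3)"
    using continuous_open_preimage[OF cont open_Times[OF chart_open(2)[OF d(1)] chart_open(2)[OF d(2)]] chart_open(1)[OF d(3)]]
    by (simp only:)
  have "smooth_on (snd d3 \<circ> (\<lambda>(g, h). g \<otimes>\<^bsub>G\<^esub> h) \<circ> param p) (snd p ` (fst p \<inter> (\<lambda>(g, h). g \<otimes>\<^bsub>G\<^esub> h) -` fst d3))"
    using lie p d(3) unfolding lie_group_def smooth_map_def by blast
  then have *: "smooth_on (snd d3 \<circ> (\<lambda>(g, h). g \<otimes>\<^bsub>G\<^esub> h) \<circ> param p) (mul_dom d1 d2 d3)" by (simp only: S)
  have eq: "(snd d3 \<circ> (\<lambda>(g, h). g \<otimes>\<^bsub>G\<^esub> h) \<circ> param p) z = mul_chart d1 d2 d3 z" if "z \<in> mul_dom d1 d2 d3" for z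
  proof -
    have "param p z = (param d1 (fst z), param d2 (snd z))"
      using par[of "param d1 (fst z)" "param d2 (snd z)"] that param_in d by (auto simp: mul_dom_def)
    then show ?thesis by (simp add: mul_chart_def)
  qed
  show "smooth_on (mul_chart d1 d2 d3) (mul_dom d1 d2 d3)"
    unfolding smooth_on_def
  proof
    fix k
    show "Ck_on k (mul_chart d1 d2 d3) (mul_dom d1 d2 d3)"
      by (rule Ck_on_cong[OF op _ *[unfolded smooth_on_def, rule_format]]) (rule eq)
  qed
qed

text \<open>The first order is for \<open>Ad\<close>, the second for the bracket, which
  differentiates \<open>Ad\<close> once more.\<close>

lemma mul_chart_differentiable:
  assumes "d1 \<in> A" "d2 \<in> A" "d3 \<in> A" "z \<in> mul_dom d1 d2 d3"
  shows "mul_chart d1 d2 d3 differentiable (at z)"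
    "(\<lambda>z. frechet_derivative (mul_chart d1 d2 d3) (at z) v) differentiable (at z)"
proof -
  have "Ck_on (Suc (Suc 0)) (mul_chart d1 d2 d3) (mul_dom d1 d2 d3)"
    using mul_chart_smooth(2)[OF assms(1-3)] unfolding smooth_on_def by blast
  then show "mul_chart d1 d2 d3 differentiable (at z)"
    "(\<lambda>z. frechet_derivative (mul_chart d1 d2 d3) (at z) v) differentiable (at z)"
    unfolding Ck_on.simps using assms(4) by blast+
qed

section \<open>The adjoint action in coordinates\<close>

abbreviation e0 :: 'e where "e0 \<equiv> snd c \<one>\<^bsub>G\<^esub>"

definition conj_chart :: "'g \<Rightarrow> 'e \<Rightarrow> 'e" where
  "conj_chart g x = snd c (g \<otimes>\<^bsub>G\<^esub> param c x \<otimes>\<^bsub>G\<^esub> inv\<^bsub>G\<^esub> g)"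

lemma e0_in: "e0 \<in> snd c ` fst c" using one_chart by blast

lemma param_e0 [simp]: "param c e0 = \<one>\<^bsub>G\<^esub>" using one_chart chart by simp

lemma conj_chart_e0 [simp]: "conj_chart g e0 = e0"
  by (simp add: conj_chart_def)

text \<open>The conjugation need not factor inside \<open>c\<close>: x goes to g x in a chart
  \<open>d\<close> around g, and multiplication by the inverse of g, read in \<open>d'\<close>,
  leads back to \<open>c\<close>. \<open>U\<close> is where the intermediate point stays in
  \<open>d\<close>.\<close>

lemma conj_chart_has_derivative: "(conj_chart g has_derivative Ad G c g) (at e0)"
proof -
  obtain d where d: "d \<in> A" "g \<in> fst d" using chart_exists by blast
  obtain d' where d': "d' \<in> A" "inv\<^bsub>G\<^esub> g \<in> fst d'" using chart_exists by blast
  define F where "F x = mul_chart d d' c (mul_chart d c d (snd d g, x), snd d' (inv\<^bsub>G\<^esub> g))" for x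
  define U where "U = {x \<in> snd c ` fst c. g \<otimes>\<^bsub>G\<^esub> param c x \<in> fst d}"
  have U: "open U" unfolding U_def
    by (rule open_param_preimage[OF chart chart_open(1)[OF d(1)]]) (intro continuous_intros)
  have eU: "e0 \<in> U" using e0_in d(2) by (simp add: U_def)
  have FU: "F x = conj_chart g x" if "x \<in> U" for x
    using that d d' by (simp add: U_def F_def mul_chart_def conj_chart_def)
  have z1: "(snd d g, e0) \<in> mul_dom d c d" using d e0_in by (auto simp: mul_dom_def)
  have z2: "(mul_chart d c d (snd d g, e0), snd d' (inv\<^bsub>G\<^esub> g)) \<in> mul_dom d d' c"
    using d d' one_chart by (auto simp: mul_dom_def mul_chart_def)
  have p1: "(\<lambda>x. (snd d g, x)) differentiable (at e0)" by simp
  have q1: "(\<lambda>x. mul_chart d c d (snd d g, x)) differentiable (at e0)"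
    using differentiable_chain_at[OF p1 mul_chart_differentiable(1)[OF d(1) chart d(1) z1]] by (simp add: o_def)
  have p2: "(\<lambda>x. (mul_chart d c d (snd d g, x), snd d' (inv\<^bsub>G\<^esub> g))) differentiable (at e0)"
    using q1 by simp
  have "F differentiable (at e0)"
    unfolding F_def[abs_def]
    using differentiable_chain_at[OF p2 mul_chart_differentiable(1)[OF d(1) d'(1) chart z2]] by (simp add: o_def)
  then have "conj_chart g differentiable (at e0)"
    by (rule differentiable_transform_open[OF _ U eU]) (rule FU)
  then show ?thesis
    unfolding Ad_def conj_chart_def[symmetric] frechet_derivative_works .
qed

lemma Ad_eqI: "(conj_chart g has_derivative T) (at e0) \<Longrightarrow> Ad G c g = T"
  using has_derivative_unique[OF conj_chart_has_derivative] .

lemma Ad_linear: "bounded_linear (Ad G c g)"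
  by (rule has_derivative_bounded_linear[OF conj_chart_has_derivative])

lemma Ad_one [simp]: "Ad G c \<one>\<^bsub>G\<^esub> = (\<lambda>x. x)"
proof (rule Ad_eqI)
  show "(conj_chart \<one>\<^bsub>G\<^esub> has_derivative (\<lambda>x. x)) (at e0)"
    by (rule has_derivative_transform_within_open[OF has_derivative_ident chart_open(2)[OF chart] e0_in])
       (simp add: conj_chart_def param_in[OF chart])
qed

lemma conj_open:
  "open {x \<in> snd c ` fst c. h \<otimes>\<^bsub>G\<^esub> param c x \<otimes>\<^bsub>G\<^esub> inv\<^bsub>G\<^esub> h \<in> fst c}"
  by (rule open_param_preimage[OF chart chart_open(1)[OF chart]]) (intro continuous_intros)

text \<open>Chain rule at the fixed point \<open>e0\<close>. The coordinate maps compose where the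
  inner conjugate stays in the domain of \<open>c\<close>, an open set around
  \<open>e0\<close>.\<close>

lemma Ad_mult: "Ad G c (g \<otimes>\<^bsub>G\<^esub> h) = Ad G c g \<circ> Ad G c h"
proof (rule Ad_eqI)
  have *: "(conj_chart g \<circ> conj_chart h has_derivative Ad G c g \<circ> Ad G c h) (at e0)"
    by (rule diff_chain_at[OF conj_chart_has_derivative]) (simp add: conj_chart_has_derivative)
  show "(conj_chart (g \<otimes>\<^bsub>G\<^esub> h) has_derivative Ad G c g \<circ> Ad G c h) (at e0)"
  proof (rule has_derivative_transform_within_open[OF * conj_open])
    show "e0 \<in> {x \<in> snd c ` fst c. h \<otimes>\<^bsub>G\<^esub> param c x \<otimes>\<^bsub>G\<^esub> inv\<^bsub>G\<^esub> h \<in> fst c}"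
      using e0_in one_chart by simp
    fix x assume "x \<in> {x \<in> snd c ` fst c. h \<otimes>\<^bsub>G\<^esub> param c x \<otimes>\<^bsub>G\<^esub> inv\<^bsub>G\<^esub> h \<in> fst c}"
    then show "(conj_chart g \<circ> conj_chart h) x = conj_chart (g \<otimes>\<^bsub>G\<^esub> h) x"
      using chart by (simp add: conj_chart_def inv_mult_group m_assoc)
  qed
qed

lemma Ad_inv [simp]: "Ad G c (inv\<^bsub>G\<^esub> g) (Ad G c g x) = x" "Ad G c g (Ad G c (inv\<^bsub>G\<^esub> g) x) = x"
  using Ad_mult[of "inv\<^bsub>G\<^esub> g" g] Ad_mult[of g "inv\<^bsub>G\<^esub> g"] by (simp_all add: fun_eq_iff)

lemma inv_chart_differentiable: "(\<lambda>x. snd c (inv\<^bsub>G\<^esub> (param c x))) differentiable (at e0)"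
proof -
  have "smooth_on (snd c \<circ> (\<lambda>g. inv\<^bsub>G\<^esub> g) \<circ> param c) (snd c ` (fst c \<inter> (\<lambda>g. inv\<^bsub>G\<^esub> g) -` fst c))"
    using lie chart unfolding lie_group_def smooth_map_def by blast
  then have "Ck_on (Suc 0) (snd c \<circ> (\<lambda>g. inv\<^bsub>G\<^esub> g) \<circ> param c) (snd c ` (fst c \<inter> (\<lambda>g. inv\<^bsub>G\<^esub> g) -` fst c))"
    unfolding smooth_on_def by blast
  moreover have "e0 \<in> snd c ` (fst c \<inter> (\<lambda>g. inv\<^bsub>G\<^esub> g) -` fst c)"
    using one_chart by (intro imageI) simp
  ultimately show ?thesis unfolding Ck_on.simps o_def by blast
qed

text \<open>Near the identity, \<open>Ad (param c x)\<close> is the derivative of \<open>y \<mapsto> (x y) x\<inverse>\<close>, hence a composition of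
  first derivatives of the multiplication in the chart; these depend differentiably on \<open>x\<close>.\<close>

lemma Ad_param_differentiable: "(\<lambda>x. Ad G c (param c x) w) differentiable (at e0)"
proof -
  define m where "m = mul_chart c c c"
  define i where "i x = snd c (inv\<^bsub>G\<^esub> (param c x))" for x
  define U where "U = {x \<in> snd c ` fst c. inv\<^bsub>G\<^esub> (param c x) \<in> fst c}"
  define D where "D z v = frechet_derivative m (at z) v" for z v
  have U: "open U" unfolding U_def
    by (rule open_param_preimage[OF chart chart_open(1)[OF chart]]) (intro continuous_intros)
  have eU: "e0 \<in> U" using e0_in one_chart by (simp add: U_def)
  have Uc: "x \<in> snd c ` fst c" if "x \<in> U" for x using that by (simp add: U_def)
  have mU: "(x, e0) \<in> mul_dom c c c" "(x, i x) \<in> mul_dom c c c" if "x \<in> U" for x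
    using that param_in[OF chart Uc[OF that]] e0_in chart one_chart by (auto simp: U_def mul_dom_def i_def)
  have m_e0: "m (x, e0) = x" if "x \<in> U" for x
    using param_in[OF chart Uc[OF that]] by (simp add: m_def mul_chart_def)
  have Dm: "(m has_derivative D z) (at z)" if "z \<in> mul_dom c c c" for z
    using mul_chart_differentiable(1)[OF chart chart chart that]
    unfolding D_def m_def by (rule frechet_derivative_works[THEN iffD1])
  have Ad_eq: "Ad G c (param c x) w = D (x, i x) (D (x, e0) (0, w), 0)" if x: "x \<in> U" for x w
  proof -
    let ?g = "param c x"
    define V where "V = {y \<in> snd c ` fst c. ?g \<otimes>\<^bsub>G\<^esub> param c y \<in> fst c}"
    have V: "open V" unfolding V_def
      by (rule open_param_preimage[OF chart chart_open(1)[OF chart]]) (intro continuous_intros)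
    have eV: "e0 \<in> V" using e0_in param_in[OF chart Uc[OF x]] by (simp add: V_def)
    have "((\<lambda>y. (x, y)) has_derivative (\<lambda>w. (0, w))) (at e0)"
      by (intro has_derivative_Pair has_derivative_const has_derivative_ident)
    from diff_chain_at[OF this Dm[OF mU(1)[OF x]]]
    have "((\<lambda>y. m (x, y)) has_derivative (\<lambda>w. D (x, e0) (0, w))) (at e0)" by (simp add: o_def)
    then have "((\<lambda>y. (m (x, y), i x)) has_derivative (\<lambda>w. (D (x, e0) (0, w), 0))) (at e0)"
      by (intro has_derivative_Pair has_derivative_const)
    from diff_chain_at[OF this, of m "D (x, i x)"] Dm[OF mU(2)[OF x]]
    have "((\<lambda>y. m (m (x, y), i x)) has_derivative (\<lambda>w. D (x, i x) (D (x, e0) (0, w), 0))) (at e0)"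
      by (simp add: o_def m_e0[OF x])
    then have "(conj_chart ?g has_derivative (\<lambda>w. D (x, i x) (D (x, e0) (0, w), 0))) (at e0)"
    proof (rule has_derivative_transform_within_open[OF _ V eV])
      fix y assume "y \<in> V"
      then show "m (m (x, y), i x) = conj_chart ?g y"
        using x chart by (simp add: V_def U_def m_def mul_chart_def conj_chart_def i_def)
    qed
    then show ?thesis by (simp add: Ad_eqI)
  qed
  have lin: "bounded_linear (D z)" if "z \<in> mul_dom c c c" for z
    by (rule has_derivative_bounded_linear[OF Dm[OF that]])
  \<comment> \<open>The vector put into \<open>D (x, i x)\<close> itself varies with x. Expanded in
    the basis, only derivatives in fixed directions remain, and those are known to be differentiable
    in the base point.\<close>
  have ex: "Ad G c (param c x) w = (\<Sum>b\<in>Basis. (D (x, e0) (0, w) \<bullet> b) *\<^sub>R D (x, i x) (b, 0))" if x: "x \<in> U" for x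
  proof -
    interpret bounded_linear "D (x, i x)" by (rule lin[OF mU(2)[OF x]])
    have rep: "(y, 0) = (\<Sum>b\<in>Basis. (y \<bullet> b) *\<^sub>R (b, 0::'e))" for y :: 'e
      by (rule prod_eqI) (simp_all add: fst_sum snd_sum euclidean_representation)
    have "D (x, i x) (y, 0) = (\<Sum>b\<in>Basis. (y \<bullet> b) *\<^sub>R D (x, i x) (b, 0))" for y
    proof -
      have "D (x, i x) (y, 0) = D (x, i x) (\<Sum>b\<in>Basis. (y \<bullet> b) *\<^sub>R (b, 0))" by (rule arg_cong[OF rep])
      also have "\<dots> = (\<Sum>b\<in>Basis. D (x, i x) ((y \<bullet> b) *\<^sub>R (b, 0)))" by (rule sum)
      finally show ?thesis by (simp only: scaleR)
    qed
    then show ?thesis unfolding Ad_eq[OF x] .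
  qed
  have DD: "(\<lambda>z. D z v) differentiable (at z)" if "z \<in> mul_dom c c c" for z v
    unfolding D_def m_def by (rule mul_chart_differentiable(2)[OF chart chart chart that])
  have "(\<lambda>x. (x, e0)) differentiable (at e0)" by simp
  from differentiable_chain_at[OF this DD[OF mU(1)[OF eU]]]
  have d1: "(\<lambda>x. D (x, e0) v) differentiable (at e0)" for v by (simp add: o_def)
  have "(\<lambda>x. (x, i x)) differentiable (at e0)"
    using inv_chart_differentiable by (simp add: i_def[abs_def])
  from differentiable_chain_at[OF this DD[OF mU(2)[OF eU]]]
  have d2: "(\<lambda>x. D (x, i x) v) differentiable (at e0)" for v by (simp add: o_def)
  have "(\<lambda>x. \<Sum>b\<in>Basis. (D (x, e0) (0, w) \<bullet> b) *\<^sub>R D (x, i x) (b, 0)) differentiable (at e0)"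
    by (intro differentiable_sum differentiable_scaleR differentiable_inner d1 d2 ballI finite_Basis differentiable_const)
  then show ?thesis by (rule differentiable_transform_open[OF _ U eU]) (rule ex[symmetric])
qed

section \<open>The bracket and its identities\<close>

abbreviation br :: "'e \<Rightarrow> 'e \<Rightarrow> 'e" where "br \<equiv> lie_bracket G c"

lemma Ad_param_has_derivative: "((\<lambda>x. Ad G c (param c x) w) has_derivative (\<lambda>v. br v w)) (at e0)"
  using Ad_param_differentiable[of w] unfolding lie_bracket_def frechet_derivative_works .

lemma bracket_bilinear: "bounded_bilinear br"
proof -
  have l: "linear (\<lambda>v. br v w)" for w
    by (rule bounded_linear.linear[OF has_derivative_bounded_linear[OF Ad_param_has_derivative]])
  have "br v (w + w') = br v w + br v w'" for v w w'
  proof -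
    have "((\<lambda>x. Ad G c (param c x) (w + w')) has_derivative (\<lambda>v. br v w + br v w')) (at e0)"
      unfolding linear_add[OF bounded_linear.linear[OF Ad_linear]]
      by (intro has_derivative_add Ad_param_has_derivative)
    from has_derivative_unique[OF Ad_param_has_derivative this] show ?thesis by meson
  qed
  moreover have "br v (r *\<^sub>R w) = r *\<^sub>R br v w" for v w r
  proof -
    have "((\<lambda>x. Ad G c (param c x) (r *\<^sub>R w)) has_derivative (\<lambda>v. r *\<^sub>R br v w)) (at e0)"
      unfolding linear_scale[OF bounded_linear.linear[OF Ad_linear]]
      by (intro has_derivative_scaleR_right Ad_param_has_derivative)
    from has_derivative_unique[OF Ad_param_has_derivative this] show ?thesis by meson
  qed
  ultimately have "linear (br v)" for v by (intro linearI)
  then have "bilinear br" using l by (simp add: bilinear_def)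
  then show ?thesis by (simp add: bilinear_conv_bounded_bilinear)
qed

text \<open>Differentiate Ad(g) Ad(x) w = Ad(g x g^-1) Ad(g) w in x at the identity.\<close>

lemma Ad_bracket: "Ad G c g (br v w) = br (Ad G c g v) (Ad G c g w)"
proof -
  have 1: "((\<lambda>x. Ad G c g (Ad G c (param c x) w)) has_derivative (\<lambda>v. Ad G c g (br v w))) (at e0)"
    by (rule bounded_linear.has_derivative[OF Ad_linear Ad_param_has_derivative])
  have "((\<lambda>x. Ad G c (param c x) (Ad G c g w)) \<circ> conj_chart g has_derivative (\<lambda>v. br v (Ad G c g w)) \<circ> Ad G c g) (at e0)"
    by (rule diff_chain_at[OF conj_chart_has_derivative]) (simp add: Ad_param_has_derivative)
  then have "((\<lambda>x. Ad G c g (Ad G c (param c x) w)) has_derivative (\<lambda>v. br v (Ad G c g w)) \<circ> Ad G c g) (at e0)"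
  proof (rule has_derivative_transform_within_open[OF _ conj_open])
    show "e0 \<in> {x \<in> snd c ` fst c. g \<otimes>\<^bsub>G\<^esub> param c x \<otimes>\<^bsub>G\<^esub> inv\<^bsub>G\<^esub> g \<in> fst c}"
      using e0_in one_chart by simp
    fix x assume "x \<in> {x \<in> snd c ` fst c. g \<otimes>\<^bsub>G\<^esub> param c x \<otimes>\<^bsub>G\<^esub> inv\<^bsub>G\<^esub> g \<in> fst c}"
    then show "((\<lambda>x. Ad G c (param c x) (Ad G c g w)) \<circ> conj_chart g) x = Ad G c g (Ad G c (param c x) w)"
      using chart by (simp add: conj_chart_def Ad_mult)
  qed
  from has_derivative_unique[OF 1 this] show ?thesis by (simp add: fun_eq_iff)
qed

text \<open>The form on \<open>Ad\<close>-translates of x and y is constant in the group element;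
  its derivative at the identity, by the product rule, is the left side.\<close>

lemma invariant_form_derivative:
  assumes "bounded_bilinear \<beta>" "\<And>g x y. \<beta> (Ad G c g x) (Ad G c g y) = \<beta> x y"
  shows "\<beta> (br v x) y + \<beta> x (br v y) = 0"
proof -
  have "((\<lambda>z. \<beta> (Ad G c (param c z) x) (Ad G c (param c z) y)) has_derivative
      (\<lambda>v. \<beta> (Ad G c (param c e0) x) (br v y) + \<beta> (br v x) (Ad G c (param c e0) y))) (at e0)"
    by (rule bounded_bilinear.FDERIV[OF assms(1) Ad_param_has_derivative Ad_param_has_derivative])
  then have "((\<lambda>z. \<beta> x y) has_derivative (\<lambda>v. \<beta> x (br v y) + \<beta> (br v x) y)) (at e0)"
    by (simp add: assms(2))
  from has_derivative_unique[OF this has_derivative_const] show ?thesis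
    by (simp add: fun_eq_iff add.commute)
qed

text \<open>The Jacobi identity as a derivation rule, obtained before skew symmetry is known:
  differentiate \<open>Ad_bracket\<close> in the group element.\<close>

lemma bracket_leibniz: "br u (br v w) = br (br u v) w + br v (br u w)"
proof -
  have "((\<lambda>z. br (Ad G c (param c z) v) (Ad G c (param c z) w)) has_derivative
      (\<lambda>u. br (Ad G c (param c e0) v) (br u w) + br (br u v) (Ad G c (param c e0) w))) (at e0)"
    by (rule bounded_bilinear.FDERIV[OF bracket_bilinear Ad_param_has_derivative Ad_param_has_derivative])
  then have "((\<lambda>z. Ad G c (param c z) (br v w)) has_derivative (\<lambda>u. br v (br u w) + br (br u v) w)) (at e0)"
    by (simp add: Ad_bracket)
  from has_derivative_unique[OF Ad_param_has_derivative this] show ?thesis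
    by (simp add: fun_eq_iff add.commute)
qed

text \<open>The span of the squares \<open>br v v\<close> is an ideal which acts by zero, so it vanishes.\<close>

lemma bracket_antisym:
  assumes simple: "simple_lie_algebra br"
  shows "br v w = - br w v"
proof -
  interpret bounded_bilinear br by (rule bracket_bilinear)
  define I where "I = span (range (\<lambda>v. br v v))"
  have sq: "br v v \<in> I" for v unfolding I_def by (intro span_base rangeI)
  have I: "subspace I" unfolding I_def by (rule subspace_span)
  have "br x y \<in> I" if "y \<in> I" for x y
  proof -
    have "subspace {y. br x y \<in> I}"
      using I by (auto simp: subspace_def add_right scaleR_right zero_right)
    moreover have "br x (br v v) \<in> I" for v
    proof -
      \<comment> \<open>By the derivation rule the left side is \<open>br u v + br v u\<close> with
        u = \<open>br x v\<close>, and polarisation writes this as a combination of squares.\<close>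
      have "br x (br v v) = br (br x v + v) (br x v + v) - br (br x v) (br x v) - br v v"
        unfolding bracket_leibniz[of x v v] by (simp add: add_left add_right)
      then show ?thesis using sq I subspace_diff by metis
    qed
    ultimately show ?thesis
      using span_minimal[of "range (\<lambda>v. br v v)" "{y. br x y \<in> I}"] that unfolding I_def by blast
  qed
  then have "I = {0} \<or> I = UNIV" using simple I unfolding simple_lie_algebra_def by blast
  moreover have "I \<noteq> UNIV"
  proof
    assume "I = UNIV"
    have "subspace {z. \<forall>w. br z w = 0}" by (auto simp: subspace_def add_left scaleR_left zero_left)
    \<comment> \<open>In the derivation rule for v, v, w the term \<open>br v (br v w)\<close>
      stands on both sides.\<close>
    moreover have "br (br v v) w = 0" for v w using bracket_leibniz[of v v w] by simp
    ultimately have "I \<subseteq> {z. \<forall>w. br z w = 0}" unfolding I_def by (intro span_minimal) auto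
    then show False using \<open>I = UNIV\<close> simple unfolding simple_lie_algebra_def by auto
  qed
  ultimately have z: "br v v = 0" for v using sq by auto
  have "br (v + w) (v + w) = br v v + br w v + (br v w + br w w)" by (simp only: add_left add_right)
  then have "br w v + br v w = 0" by (simp add: z)
  then show ?thesis by (simp add: eq_neg_iff_add_eq_0 add.commute)
qed

text \<open>Translation to the identity: Ad(g) = Ad(g0) Ad(g0^-1 g), and near g0 the element g0^-1 g
  lies in the chart, where differentiability at \<open>e0\<close> gives continuity.\<close>

lemma Ad_continuous: "continuous_on UNIV (\<lambda>g. Ad G c g w)"
proof -
  have "isCont (\<lambda>g. Ad G c g w) g0" for g0
  proof -
    define V where "V = {g. inv\<^bsub>G\<^esub> g0 \<otimes>\<^bsub>G\<^esub> g \<in> fst c}"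
    have tr: "continuous_on UNIV (\<lambda>g. inv\<^bsub>G\<^esub> g0 \<otimes>\<^bsub>G\<^esub> g)" by (intro continuous_intros)
    have V: "open V" using open_vimage[OF chart_open(1)[OF chart] tr] by (simp add: V_def vimage_def)
    have gV: "g0 \<in> V" using one_chart by (simp add: V_def)
    have "isCont (\<lambda>x. Ad G c (param c x) w) e0"
      by (rule has_derivative_continuous[OF Ad_param_has_derivative])
    moreover have "isCont (snd c) \<one>\<^bsub>G\<^esub>"
      using chart_continuous(1)[OF chart] chart_open(1)[OF chart] one_chart continuous_on_eq_continuous_at by blast
    ultimately have 1: "isCont (\<lambda>k. Ad G c (param c (snd c k)) w) \<one>\<^bsub>G\<^esub>"
      using isCont_o2 by blast
    have "isCont (\<lambda>g. inv\<^bsub>G\<^esub> g0 \<otimes>\<^bsub>G\<^esub> g) g0" using tr by (simp add: continuous_on_eq_continuous_at)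
    from isCont_o2[OF this, of "\<lambda>k. Ad G c (param c (snd c k)) w"] 1
    have "isCont (\<lambda>g. Ad G c (param c (snd c (inv\<^bsub>G\<^esub> g0 \<otimes>\<^bsub>G\<^esub> g))) w) g0" by simp
    then have 2: "isCont (\<lambda>g. Ad G c g0 (Ad G c (param c (snd c (inv\<^bsub>G\<^esub> g0 \<otimes>\<^bsub>G\<^esub> g))) w)) g0"
      by (rule bounded_linear.continuous[OF Ad_linear])
    have "Ad G c g0 (Ad G c (param c (snd c (inv\<^bsub>G\<^esub> g0 \<otimes>\<^bsub>G\<^esub> g))) w) = Ad G c g w" if "g \<in> V" for g
    proof -
      have "Ad G c g0 (Ad G c (inv\<^bsub>G\<^esub> g0 \<otimes>\<^bsub>G\<^esub> g) w) = Ad G c g w"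
        by (simp add: Ad_mult)
      then show ?thesis using that chart by (simp add: V_def)
    qed
    then have "\<forall>\<^sub>F g in nhds g0. Ad G c g0 (Ad G c (param c (snd c (inv\<^bsub>G\<^esub> g0 \<otimes>\<^bsub>G\<^esub> g))) w) = Ad G c g w"
      using V gV by (intro eventually_nhds[THEN iffD2]) blast
    from isCont_cong[OF this] 2 show ?thesis by blast
  qed
  then show ?thesis by (simp add: continuous_on_eq_continuous_at)
qed

end

section \<open>Invariant bilinear forms\<close>

text \<open>The function \<open>Q \<mapsto> max\<^sub>g \<bar>\<rho> g Q\<bar>\<close> is invariant, and by the parallelogram law
  its minimum over \<open>K\<close> is attained at a single point.\<close>

lemma compact_group_fixed_point:
  fixes \<rho> :: "'g::topological_space \<Rightarrow> 'v::euclidean_space \<Rightarrow> 'v"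
  assumes comp: "compact (UNIV :: 'g set)" and lin: "\<And>g. linear (\<rho> g)"
    and cont: "\<And>Q. continuous_on UNIV (\<lambda>g. \<rho> g Q)"
    and mult: "\<And>g h. \<exists>k. \<forall>Q. \<rho> g (\<rho> h Q) = \<rho> k Q"
    and inj: "\<And>g P Q. \<rho> g P = \<rho> g Q \<Longrightarrow> P = Q"
    and K: "compact K" "convex K" "K \<noteq> {}" "\<And>g Q. Q \<in> K \<Longrightarrow> \<rho> g Q \<in> K"
  shows "\<exists>Q\<in>K. \<forall>g. \<rho> g Q = Q"
proof -
  have "\<exists>g. \<forall>h. norm (\<rho> h Q) \<le> norm (\<rho> g Q)" for Q
    using continuous_attains_sup[OF comp UNIV_not_empty continuous_on_norm[OF cont[of Q]]] by simp
  then obtain m where m: "\<And>h Q. norm (\<rho> h Q) \<le> norm (\<rho> (m Q) Q)" by metis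
  define F where "F Q = norm (\<rho> (m Q) Q)" for Q
  have F: "norm (\<rho> h Q) \<le> F Q" for h Q using m by (simp add: F_def)
  \<comment> \<open>Bounds \<open>F\<close> by the norm through its values on the basis. As
    \<open>F\<close> is subadditive, \<open>C\<close> becomes a Lipschitz constant, so
    \<open>F\<close> is continuous although the maximiser \<open>m Q\<close> was chosen
    arbitrarily.\<close>
  define C where "C = (\<Sum>b\<in>Basis. F b)"
  have C: "F Q \<le> norm Q * C" for Q
  proof -
    have "\<rho> g Q = (\<Sum>b\<in>Basis. (Q \<bullet> b) *\<^sub>R \<rho> g b)" for g
    proof -
      have "\<rho> g Q = \<rho> g (\<Sum>b\<in>Basis. (Q \<bullet> b) *\<^sub>R b)" by (simp only: euclidean_representation)
      then show ?thesis by (simp only: linear_sum[OF lin] linear_scale[OF lin])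
    qed
    then have "F Q = norm (\<Sum>b\<in>Basis. (Q \<bullet> b) *\<^sub>R \<rho> (m Q) b)" by (simp only: F_def)
    also have "\<dots> \<le> (\<Sum>b\<in>Basis. norm ((Q \<bullet> b) *\<^sub>R \<rho> (m Q) b))" by (rule norm_sum)
    also have "\<dots> \<le> (\<Sum>b\<in>Basis. norm Q * F b)"
    proof (rule sum_mono)
      fix b :: 'v assume "b \<in> Basis"
      then show "norm ((Q \<bullet> b) *\<^sub>R \<rho> (m Q) b) \<le> norm Q * F b"
        using F[of "m Q" b] Basis_le_norm[of b Q] by (simp add: mult_mono)
    qed
    finally show ?thesis by (simp add: C_def sum_distrib_left)
  qed
  have F_diff: "F P - F Q \<le> norm (P - Q) * C" for P Q
  proof -
    have "F P = norm (\<rho> (m P) Q + \<rho> (m P) (P - Q))" by (simp add: F_def linear_diff[OF lin])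
    also have "\<dots> \<le> F Q + F (P - Q)" by (rule order_trans[OF norm_triangle_ineq add_mono[OF F F]])
    finally show ?thesis using C[of "P - Q"] by simp
  qed
  have "\<bar>F P - F Q\<bar> \<le> norm (P - Q) * C" for P Q
    using F_diff[of P Q] F_diff[of Q P] by (simp add: abs_le_iff norm_minus_commute)
  then have "\<bar>F P - F Q\<bar> \<le> C * norm (P - Q)" for P Q by (simp add: mult.commute)
  moreover have "C \<ge> 0" unfolding C_def by (rule sum_nonneg) (simp add: F_def)
  ultimately have "C-lipschitz_on K F" by (intro lipschitz_onI) (simp_all add: dist_norm)
  from continuous_attains_inf[OF K(1,3) lipschitz_on_continuous_on[OF this]]
  obtain Q where Q: "Q \<in> K" "\<And>P. P \<in> K \<Longrightarrow> F Q \<le> F P" by blast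
  have "\<rho> h Q = Q" for h
  proof -
    define P where "P = \<rho> h Q"
    have P: "P \<in> K" using K(4) Q(1) by (simp add: P_def)
    have PF: "norm (\<rho> g P) \<le> F Q" for g
    proof -
      obtain k where "\<forall>Q. \<rho> g (\<rho> h Q) = \<rho> k Q" using mult by blast
      then show ?thesis using F[of k Q] by (simp add: P_def)
    qed
    \<comment> \<open>The midpoint of Q and its image. Minimality gives \<open>F Q\<close> \<le>
      \<open>F M\<close>, while \<open>a\<close> and \<open>b\<close> have norm at most
      \<open>F Q\<close>; the parallelogram law then forces \<open>a = b\<close>.\<close>
    define M where "M = (1/2) *\<^sub>R P + (1/2) *\<^sub>R Q"
    have "M \<in> K" unfolding M_def by (rule convexD[OF K(2) P Q(1)]) auto
    define a where "a = \<rho> (m M) P"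
    define b where "b = \<rho> (m M) Q"
    have "F Q \<le> F M" by (rule Q(2)[OF \<open>M \<in> K\<close>])
    also have "F M = norm ((1/2) *\<^sub>R (a + b))"
      by (simp add: F_def M_def a_def b_def linear_add[OF lin] linear_scale[OF lin] scaleR_add_right)
    finally have "2 * F Q \<le> norm (a + b)" by simp
    moreover have FQ: "norm a \<le> F Q" "norm b \<le> F Q" "F Q \<ge> 0" using PF F by (simp_all add: a_def b_def F_def)
    ultimately have 1: "(2 * F Q)^2 \<le> (norm (a + b))^2" by (intro power_mono) auto
    have "(norm (a + b))^2 + (norm (a - b))^2 = 2 * (norm a)^2 + 2 * (norm b)^2"
      by (simp add: power2_norm_eq_inner inner_add inner_diff inner_commute algebra_simps)
    moreover have "(norm a)^2 \<le> (F Q)^2" "(norm b)^2 \<le> (F Q)^2" using FQ by (auto intro: power_mono)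
    moreover have "4 * (F Q)^2 \<le> (norm (a + b))^2" using 1 by (simp add: power_mult_distrib)
    ultimately have "(norm (a - b))^2 \<le> 0" by linarith
    then have "a = b" by simp
    then show ?thesis using inj unfolding a_def b_def P_def by blast
  qed
  then show ?thesis using Q(1) by blast
qed

section \<open>An invariant inner product from compactness\<close>

lemma inner_transpose_mult: 
  fixes M Q :: "real ^ 'n ^ 'n"
  shows "x \<bullet> ((transpose M ** Q ** M) *v y) = (M *v x) \<bullet> (Q *v (M *v y))"
proof -
  have "x \<bullet> ((transpose M ** Q ** M) *v y) = x \<bullet> (transpose M *v (Q *v (M *v y)))"
    by (simp add: matrix_vector_mul_assoc matrix_mul_assoc)
  also have "\<dots> = (M *v x) \<bullet> (Q *v (M *v y))"
    by (simp add: inner_commute[of x] transpose_matrix_vector dot_lmul_matrix inner_commute[of "M *v x"])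
  finally show ?thesis .
qed

lemma matrix_eq_inner:
  fixes P Q :: "real ^ 'n ^ 'n"
  assumes "\<And>x y. x \<bullet> (P *v y) = x \<bullet> (Q *v y)"
  shows "P = Q"
proof -
  have "P *v y = Q *v y" for y using assms vector_eq_ldot by blast
  then show ?thesis by (simp add: matrix_eq)
qed

text \<open>Bilinear forms are encoded as matrices, a Euclidean space on which the group acts by
  congruence. The convex hull of the orbit of the identity matrix is compact and invariant, and it
  lies in the convex set \<open>S\<close> of symmetric positive definite matrices, so its fixed
  point is an inner product.\<close>

lemma invariant_inner_product:
  fixes c :: "('g::{t2_space,second_countable_topology}, real ^ 'n) chart"
  assumes "lie_chart G A c" and comp: "compact (UNIV :: 'g set)"
  shows "\<exists>Q :: real ^ 'n ^ 'n. (\<forall>x y. x \<bullet> (Q *v y) = y \<bullet> (Q *v x)) \<and> (\<forall>x. x \<noteq> 0 \<longrightarrow> x \<bullet> (Q *v x) > 0) \<and>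
    (\<forall>g x y. Ad G c g x \<bullet> (Q *v Ad G c g y) = x \<bullet> (Q *v y))"
proof -
  interpret lie_chart G A c by fact
  \<comment> \<open>The inverse turns congruence into a left action:
    \<open>\<rho> g (\<rho> h Q)\<close> is the action of the product g h on
    \<open>Q\<close>.\<close>
  define M where "M g = matrix (Ad G c (inv\<^bsub>G\<^esub> g))" for g
  have M: "M g *v x = Ad G c (inv\<^bsub>G\<^esub> g) x" for g x
    unfolding M_def by (rule matrix_works[OF linear_matrix_vector_mul_eq[THEN iffD2, OF bounded_linear.linear[OF Ad_linear]]])
  define \<rho> where "\<rho> g Q = transpose (M g) ** Q ** M g" for g Q
  have \<rho>: "x \<bullet> (\<rho> g Q *v y) = Ad G c (inv\<^bsub>G\<^esub> g) x \<bullet> (Q *v Ad G c (inv\<^bsub>G\<^esub> g) y)" for g Q x y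
    unfolding \<rho>_def inner_transpose_mult M ..
  have lin: "linear (\<rho> g)" for g
    by (rule linearI; rule matrix_eq_inner)
       (simp_all add: \<rho> matrix_vector_mult_add_rdistrib inner_add_right scaleR_matrix_vector_assoc[symmetric])
  have "continuous_on UNIV (\<lambda>g. Ad G c (inv\<^bsub>G\<^esub> g) w)" for w
    by (rule continuous_on_compose2[OF Ad_continuous inv_continuous]) auto
  then have cont: "continuous_on UNIV (\<lambda>g. \<rho> g Q)" for Q
    unfolding \<rho>_def M_def matrix_matrix_mult_def transpose_def matrix_def
    by (simp add: continuous_on_vec_lambda continuous_on_sum continuous_on_mult continuous_on_component continuous_on_const)
  have mult: "\<exists>k. \<forall>Q. \<rho> g (\<rho> h Q) = \<rho> k Q" for g h
  proof (intro exI allI matrix_eq_inner)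
    show "x \<bullet> (\<rho> g (\<rho> h Q) *v y) = x \<bullet> (\<rho> (g \<otimes>\<^bsub>G\<^esub> h) Q *v y)" for x y Q
      unfolding \<rho> by (simp add: inv_mult_group Ad_mult)
  qed
  have inj: "P = Q" if "\<rho> g P = \<rho> g Q" for g P Q
  proof (rule matrix_eq_inner)
    fix x y
    show "x \<bullet> (P *v y) = x \<bullet> (Q *v y)"
      using \<rho>[of "Ad G c g x" g P "Ad G c g y"] \<rho>[of "Ad G c g x" g Q "Ad G c g y"] that by simp
  qed
  define K where "K = convex hull (range (\<lambda>g. \<rho> g (mat 1)))"
  have "compact (range (\<lambda>g. \<rho> g (mat 1)))" by (rule compact_continuous_image[OF cont comp])
  then have K1: "compact K" unfolding K_def by (rule compact_convex_hull)
  have K2: "convex K" "K \<noteq> {}" unfolding K_def by (auto simp: convex_hull_eq_empty)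
  have K4: "\<rho> g Q \<in> K" if "Q \<in> K" for g Q
  proof -
    have "\<rho> g ` K = convex hull (\<rho> g ` range (\<lambda>g. \<rho> g (mat 1)))"
      unfolding K_def by (rule convex_hull_linear_image[OF lin])
    also have "\<dots> \<subseteq> K" unfolding K_def
    proof (rule hull_mono)
      show "\<rho> g ` range (\<lambda>g. \<rho> g (mat 1)) \<subseteq> range (\<lambda>g. \<rho> g (mat 1))" using mult by fastforce
    qed
    finally show ?thesis using that by blast
  qed
  have "\<exists>Q\<in>K. \<forall>g. \<rho> g Q = Q"
    by (rule compact_group_fixed_point[OF comp lin cont mult _ K1 K2]) (fact inj K4)+
  then obtain Q where Q: "Q \<in> K" "\<And>g. \<rho> g Q = Q" by blast
  define S where "S = {Q :: real ^ 'n ^ 'n. (\<forall>x y. x \<bullet> (Q *v y) = y \<bullet> (Q *v x)) \<and> (\<forall>x. x \<noteq> 0 \<longrightarrow> x \<bullet> (Q *v x) > 0)}"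
  have "convex S"
  proof (rule convexI)
    fix P Q :: "real ^ 'n ^ 'n" and u v :: real
    assume PQ: "P \<in> S" "Q \<in> S" and uv: "0 \<le> u" "0 \<le> v" "u + v = 1"
    have e: "x \<bullet> ((u *\<^sub>R P + v *\<^sub>R Q) *v y) = u * (x \<bullet> (P *v y)) + v * (x \<bullet> (Q *v y))" for x y
      by (simp add: matrix_vector_mult_add_rdistrib inner_add_right scaleR_matrix_vector_assoc[symmetric])
    have "0 < u * (x \<bullet> (P *v x)) + v * (x \<bullet> (Q *v x))" if "x \<noteq> 0" for x
    proof -
      have "x \<bullet> (P *v x) > 0" "x \<bullet> (Q *v x) > 0" using PQ that by (auto simp: S_def)
      moreover have "u > 0 \<or> v > 0" using uv by linarith
      ultimately show ?thesis using uv by (auto intro: add_pos_nonneg add_nonneg_pos)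
    qed
    moreover have "x \<bullet> (P *v y) = y \<bullet> (P *v x)" "x \<bullet> (Q *v y) = y \<bullet> (Q *v x)" for x y
      using PQ by (simp_all add: S_def)
    ultimately show "u *\<^sub>R P + v *\<^sub>R Q \<in> S" unfolding S_def mem_Collect_eq e by presburger
  qed
  moreover have "\<rho> g (mat 1) \<in> S" for g
  proof -
    have "Ad G c (inv\<^bsub>G\<^esub> g) x \<noteq> 0" if "x \<noteq> 0" for x
      using Ad_inv(2)[of g x] that linear_0[OF bounded_linear.linear[OF Ad_linear]] by metis
    then show ?thesis unfolding S_def mem_Collect_eq \<rho> by (simp add: inner_commute)
  qed
  ultimately have "K \<subseteq> S" unfolding K_def by (intro hull_minimal) auto
  then have "Q \<in> S" using Q(1) by blast
  moreover have "Ad G c g x \<bullet> (Q *v Ad G c g y) = x \<bullet> (Q *v y)" for g x y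
    using \<rho>[of x "inv\<^bsub>G\<^esub> g" Q y] Q(2)[of "inv\<^bsub>G\<^esub> g"] by simp
  ultimately show ?thesis unfolding S_def by blast
qed

section \<open>Uniqueness of invariant forms on a simple Lie algebra\<close>

lemma nonpos_quadratic_imp_zero:
  fixes a b :: real
  assumes "\<And>s. s * a + s^2 * b \<le> 0"
  shows "a = 0"
proof (rule ccontr)
  assume "a \<noteq> 0"
  have b: "b \<le> 0"
  proof (rule ccontr)
    assume "\<not> b \<le> 0"
    then show False using assms[of 1] assms[of "-1"] by simp
  qed
  \<comment> \<open>Chosen so that s a + s^2 b equals s^2 at s = r.\<close>
  define r where "r = a / (1 - b)"
  have a: "r * (1 - b) = a" "r \<noteq> 0" using b \<open>a \<noteq> 0\<close> by (simp_all add: r_def)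
  have "r * (r * (1 - b)) + r^2 * b = r^2" by (simp add: algebra_simps power2_eq_square)
  then have "r^2 \<le> 0" using assms[of r] by (simp add: a(1))
  then show False using a(2) by simp
qed

text \<open>The radical of an invariant form is an ideal, so one nonzero element makes it
  everything.\<close>

lemma invariant_form_radical:
  assumes simple: "simple_lie_algebra br" and b: "bounded_bilinear \<tau>"
    and inv: "\<And>v x y. \<tau> (br v x) y + \<tau> x (br v y) = (0::real)"
    and x: "\<And>y. \<tau> x y = 0" "x \<noteq> 0"
  shows "\<tau> z y = 0"
proof -
  interpret bounded_bilinear \<tau> by fact
  define I where "I = {x. \<forall>y. \<tau> x y = 0}"
  have "subspace I" by (auto simp: I_def subspace_def add_left scaleR_left zero_left)
  moreover have "br v x \<in> I" if "x \<in> I" for v x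
    using that inv[of v x] by (simp add: I_def)
  ultimately have "I = {0} \<or> I = UNIV" using simple unfolding simple_lie_algebra_def by blast
  moreover have "x \<in> I" using x by (simp add: I_def)
  ultimately have "I = UNIV" using x(2) by auto
  then show ?thesis unfolding I_def by blast
qed

lemma bounded_bilinear_diff_mult:
  fixes f g :: "'a::euclidean_space \<Rightarrow> 'b::euclidean_space \<Rightarrow> real"
  assumes "bounded_bilinear f" "bounded_bilinear g"
  shows "bounded_bilinear (\<lambda>x y. f x y - k * g x y)"
proof -
  interpret f: bounded_bilinear f by fact
  interpret g: bounded_bilinear g by fact
  have "bilinear (\<lambda>x y. f x y - k * g x y)"
    unfolding bilinear_def
    by (auto intro!: linearI simp: f.add_left f.add_right g.add_left g.add_right
        f.scaleR_left f.scaleR_right g.scaleR_left g.scaleR_right algebra_simps)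
  then show ?thesis by (simp add: bilinear_conv_bounded_bilinear)
qed

text \<open>For the skew part \<open>\<alpha>\<close>, the trilinear form \<open>\<alpha> (br v x) y\<close> is symmetric in \<open>x, y\<close> and
  skew in \<open>v, x\<close>, hence zero. The symmetric part minus its maximal eigenvalue with respect to
  \<open>ip\<close> is degenerate.\<close>

lemma invariant_form_unique:
  fixes br :: "'e::euclidean_space \<Rightarrow> 'e \<Rightarrow> 'e"
  assumes simple: "simple_lie_algebra br" and anti: "\<And>v w. br v w = - br w v"
    and ip: "bounded_bilinear ip" "\<And>x y. ip x y = ip y x" "\<And>x. x \<noteq> 0 \<Longrightarrow> ip x x > (0::real)"
      "\<And>v x y. ip (br v x) y + ip x (br v y) = 0"
    and \<beta>: "bounded_bilinear \<beta>" "\<And>v x y. \<beta> (br v x) y + \<beta> x (br v y) = (0::real)"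
  shows "\<exists>k. \<forall>x y. \<beta> x y = k * ip x y"
proof -
  interpret ip: bounded_bilinear ip by fact
  interpret \<beta>: bounded_bilinear \<beta> by fact
  obtain v0 x0 where nz: "br v0 x0 \<noteq> 0" using simple unfolding simple_lie_algebra_def by blast
  have flip: "bounded_bilinear (\<lambda>x y. \<beta> y x)" by (rule bounded_bilinear.flip[OF \<beta>(1)])
  define \<alpha> where "\<alpha> x y = \<beta> x y - \<beta> y x" for x y
  have \<alpha>b: "bounded_bilinear \<alpha>"
    using bounded_bilinear_diff_mult[OF \<beta>(1) flip, of 1] by (simp add: \<alpha>_def[abs_def])
  interpret \<alpha>: bounded_bilinear \<alpha> by fact
  have \<alpha>inv: "\<alpha> (br v x) y + \<alpha> x (br v y) = 0" for v x y
    using \<beta>(2)[of v x y] \<beta>(2)[of v y x] by (simp add: \<alpha>_def)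
  have \<alpha>a: "\<alpha> x y = - \<alpha> y x" for x y by (simp add: \<alpha>_def)
  have s: "\<alpha> (br v x) y = \<alpha> (br v y) x" for v x y
    using \<alpha>inv[of v x y] \<alpha>a[of x "br v y"] by simp
  have t: "\<alpha> (br v x) y = - \<alpha> (br x v) y" for v x y
    using anti[of v x] \<alpha>.minus_left by metis
  \<comment> \<open>Alternating the symmetry \<open>s\<close> in the last two arguments with the
    skewness \<open>t\<close> in the first two runs through all six orders of v, x, y and returns
    after three sign changes.\<close>
  have a0: "\<alpha> (br v x) y = 0" for v x y
    using s[of v x y] t[of v y x] s[of y v x] t[of y x v] s[of x y v] t[of x v y] by linarith
  have "\<alpha> x y = 0" for x y
    by (rule invariant_form_radical[where br=br and \<tau>=\<alpha> and x="br v0 x0"]) (rule simple \<alpha>b \<alpha>inv a0 nz)+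
  then have sym: "\<beta> x y = \<beta> y x" for x y by (simp add: \<alpha>_def)
  define f where "f x = \<beta> x x / ip x x" for x
  have "ip x x \<noteq> 0" if "x \<in> sphere 0 1" for x using ip(3)[of x] that by force
  then have "continuous_on (sphere 0 1) f"
    unfolding f_def[abs_def]
    by (intro continuous_on_divide \<beta>.continuous_on ip.continuous_on continuous_on_id) auto
  moreover have "sphere (0::'e) 1 \<noteq> {}" by simp
  ultimately obtain x1 where x1: "x1 \<in> sphere 0 1" "\<And>x. x \<in> sphere 0 1 \<Longrightarrow> f x \<le> f x1"
    using continuous_attains_sup[OF compact_sphere] by blast
  define k where "k = f x1"
  define \<tau> where "\<tau> x y = \<beta> x y - k * ip x y" for x y
  have \<tau>b: "bounded_bilinear \<tau>"
    unfolding \<tau>_def[abs_def] by (rule bounded_bilinear_diff_mult[OF \<beta>(1) ip(1)])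
  interpret \<tau>: bounded_bilinear \<tau> by fact
  have x1n: "x1 \<noteq> 0" using x1(1) by auto
  have \<tau>1: "\<tau> x1 x1 = 0" using ip(3)[OF x1n] by (simp add: \<tau>_def k_def f_def)
  have neg: "\<tau> x x \<le> 0" for x
  proof (cases "x = 0")
    case True
    then show ?thesis by (simp add: \<tau>.zero_left)
  next
    case False
    define u where "u = inverse (norm x) *\<^sub>R x"
    have x: "x = norm x *\<^sub>R u" using False by (simp add: u_def)
    have u: "u \<in> sphere 0 1" using False by (simp add: u_def)
    then have "ip u u > 0" using ip(3)[of u] by force
    then have "\<tau> u u \<le> 0" using x1(2)[OF u] by (simp add: \<tau>_def k_def[symmetric] f_def[of u] divide_le_eq)
    moreover have "\<tau> x x = (norm x)^2 * \<tau> u u"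
      by (subst x, subst (2) x) (simp add: \<tau>.scaleR_left \<tau>.scaleR_right power2_eq_square)
    ultimately show ?thesis by (simp add: mult_nonneg_nonpos)
  qed
  \<comment> \<open>\<open>x1\<close> maximises \<tau> x x, with value 0, so the linear term of
    \<tau> along x1 + s y must vanish: \<open>x1\<close> lies in the radical.\<close>
  have z: "\<tau> x1 y = 0" for y
  proof -
    have "s * (2 * \<tau> x1 y) + s^2 * \<tau> y y \<le> 0" for s
    proof -
      have "\<tau> y x1 = \<tau> x1 y" by (simp add: \<tau>_def sym[of y x1] ip(2)[of y x1])
      then have "\<tau> (x1 + s *\<^sub>R y) (x1 + s *\<^sub>R y) = s * (2 * \<tau> x1 y) + s^2 * \<tau> y y"
        by (simp add: \<tau>.add_left \<tau>.add_right \<tau>.scaleR_left \<tau>.scaleR_right \<tau>1 power2_eq_square algebra_simps)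
      then show ?thesis using neg[of "x1 + s *\<^sub>R y"] by simp
    qed
    from nonpos_quadratic_imp_zero[OF this] show ?thesis by simp
  qed
  have \<tau>inv: "\<tau> (br v x) y + \<tau> x (br v y) = 0" for v x y
  proof -
    have "\<tau> (br v x) y + \<tau> x (br v y) = (\<beta> (br v x) y + \<beta> x (br v y)) - k * (ip (br v x) y + ip x (br v y))"
      by (simp add: \<tau>_def algebra_simps)
    then show ?thesis by (simp add: \<beta>(2) ip(4))
  qed
  have "\<tau> x y = 0" for x y 
    by (rule invariant_form_radical[where br=br and \<tau>=\<tau> and x=x1]) (rule simple \<tau>b \<tau>inv z x1n)+
  then show ?thesis by (intro exI[of _ k]) (simp add: \<tau>_def)
qed

section \<open>Continuous forms and seminorm estimates\<close>

lemma schwartz_zero: "(\<lambda>t. 0) \<in> schwartz"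
proof (rule schwartzI[OF smooth_const])
  show "\<exists>a. seminorm_le N a (\<lambda>t. 0)" for N
    by (rule exI[of _ 0]) (simp add: seminorm_le_def funpow_vderiv_zero)
qed

text \<open>The generating sets are seminorm balls around arbitrary centres; if 0 lies in one of
  them, a smaller ball around 0 fits inside. Finite intersections take the larger order and the
  smaller radius.\<close>

lemma schwartz_neighbourhood_zero:
  fixes U :: "(real \<Rightarrow> 'e::real_normed_vector) set"
  assumes "openin schwartz_topology U" "(\<lambda>t. 0) \<in> U"
  shows "\<exists>N. \<exists>\<delta>>0. \<forall>g\<in>schwartz. seminorm_le N \<delta> g \<longrightarrow> g \<in> U"
proof -
  have "generate_topology_on {{g \<in> schwartz. schwartz_seminorm k m (\<lambda>t. g t - f t) < \<epsilon>} | f k m \<epsilon>.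
      (f :: real \<Rightarrow> 'e) \<in> schwartz \<and> 0 < \<epsilon>} U"
    using assms(1) unfolding schwartz_topology_def openin_topology_generated_by_iff .
  then show ?thesis using assms(2)
  proof (induction rule: generate_topology_on.induct)
    case Empty
    then show ?case by simp
  next
    case (Int U V)
    from Int.IH(1) Int.prems obtain N d where 1: "d > 0" "\<forall>g\<in>schwartz. seminorm_le N d g \<longrightarrow> g \<in> U" by blast
    from Int.IH(2) Int.prems obtain M e where 2: "e > 0" "\<forall>g\<in>schwartz. seminorm_le M e g \<longrightarrow> g \<in> V" by blast
    have "g \<in> U \<inter> V" if "g \<in> schwartz" "seminorm_le (max N M) (min d e) g" for g
    proof -
      have "seminorm_le N d g" "seminorm_le M e g" using that(2) unfolding seminorm_le_def by auto
      then show ?thesis using 1 2 that(1) by blast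
    qed
    then show ?case using 1(1) 2(1) by (intro exI[of _ "max N M"] exI[of _ "min d e"]) auto
  next
    case (UN K)
    then obtain k where "k \<in> K" "(\<lambda>t. 0) \<in> k" by blast
    with UN.IH obtain N d where "d > 0" "\<forall>g\<in>schwartz. seminorm_le N d g \<longrightarrow> g \<in> k" by blast
    then show ?case using \<open>k \<in> K\<close> by blast
  next
    case (Basis s)
    then obtain f :: "real \<Rightarrow> 'e" and k m \<epsilon> where f: "f \<in> schwartz"
      and s: "s = {g \<in> schwartz. schwartz_seminorm k m (\<lambda>t. g t - f t) < \<epsilon>}" by blast
    define r where "r = schwartz_seminorm k m (\<lambda>t. 0 - f t)"
    have r: "r < \<epsilon>" using Basis.prems by (simp add: s r_def)
    have sf: "smooth f" by (rule schwartz_smooth[OF f])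
    have dm: "(vderiv ^^ m) (\<lambda>t. - f t) = (\<lambda>t. - (vderiv ^^ m) f t)"
      by (rule funpow_vderiv_linear[OF bounded_linear_minus[OF bounded_linear_ident] sf])
    have dg: "(vderiv ^^ m) (\<lambda>t. g t - f t) = (\<lambda>t. (vderiv ^^ m) g t - (vderiv ^^ m) f t)" if "smooth g" for g
      using funpow_vderiv_add[OF that smooth_linear[OF bounded_linear_minus[OF bounded_linear_ident] sf], of m]
      by (simp add: dm)
    \<comment> \<open>\<open>SUP\<close> is an upper bound only for a range bounded above; for f
      this is the Schwartz condition.\<close>
    obtain C where "\<And>t. \<bar>t\<bar> ^ k * norm ((vderiv ^^ m) f t) \<le> C" using schwartz_bound[OF f] by meson
    then have "bdd_above (range (\<lambda>t. norm (t ^ k *\<^sub>R (vderiv ^^ m) (\<lambda>t. 0 - f t) t)))"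
      by (intro bdd_aboveI[of _ C]) (auto simp: dm power_abs)
    then have "norm (t ^ k *\<^sub>R (vderiv ^^ m) (\<lambda>t. 0 - f t) t) \<le> r" for t
      unfolding r_def schwartz_seminorm_def by (intro cSUP_upper) auto
    then have fr: "\<bar>t\<bar> ^ k * norm ((vderiv ^^ m) f t) \<le> r" for t
      by (simp add: dm power_abs)
    \<comment> \<open>Half of the slack \<open>\<epsilon> - r\<close>, because the supremum yields a
      weak inequality while the ball is strict.\<close>
    have "g \<in> s" if g: "g \<in> schwartz" "seminorm_le (max k m) ((\<epsilon> - r) / 2) g" for g
    proof -
      have "norm (t ^ k *\<^sub>R (vderiv ^^ m) (\<lambda>t. g t - f t) t) \<le> (\<epsilon> - r) / 2 + r" for t
      proof -
        have "norm (t ^ k *\<^sub>R (vderiv ^^ m) (\<lambda>t. g t - f t) t) = \<bar>t\<bar> ^ k * norm ((vderiv ^^ m) g t - (vderiv ^^ m) f t)"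
          by (simp add: dg[OF schwartz_smooth[OF g(1)]] power_abs)
        also have "\<dots> \<le> \<bar>t\<bar> ^ k * (norm ((vderiv ^^ m) g t) + norm ((vderiv ^^ m) f t))"
          by (intro mult_left_mono norm_triangle_ineq4) simp
        also have "\<dots> \<le> (\<epsilon> - r) / 2 + r"
          unfolding distrib_left using g(2)[unfolded seminorm_le_def, rule_format, of k m t] fr[of t]
          by (intro add_mono) auto
        finally show ?thesis .
      qed
      then have "schwartz_seminorm k m (\<lambda>t. g t - f t) \<le> (\<epsilon> - r) / 2 + r"
        unfolding schwartz_seminorm_def by (intro cSUP_least) auto
      also have "\<dots> < \<epsilon>" using r by (simp add: field_simps)
      finally show ?thesis using g(1) by (simp add: s)
    qed
    then show ?case using r by (intro exI[of _ "max k m"] exI[of _ "(\<epsilon> - r) / 2"]) auto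
  qed
qed

lemma of_real_vector_scale: "complex_of_real r *s x = r *\<^sub>R x"
  by (simp add: vec_eq_iff complex_eq_iff)

lemma schwartz_bilinear_add:
  assumes "schwartz_bilinear \<omega>" "\<xi> \<in> schwartz" "\<eta> \<in> schwartz" "\<zeta> \<in> schwartz"
  shows "\<omega> (\<lambda>t. \<xi> t + \<eta> t) \<zeta> = \<omega> \<xi> \<zeta> + \<omega> \<eta> \<zeta>" "\<omega> \<zeta> (\<lambda>t. \<xi> t + \<eta> t) = \<omega> \<zeta> \<xi> + \<omega> \<zeta> \<eta>"
proof -
  have *: "\<omega> (\<lambda>t. 1 *s \<xi> t + 1 *s \<eta> t) \<zeta> = 1 * \<omega> \<xi> \<zeta> + 1 * \<omega> \<eta> \<zeta>"
    "\<omega> \<zeta> (\<lambda>t. 1 *s \<xi> t + 1 *s \<eta> t) = 1 * \<omega> \<zeta> \<xi> + 1 * \<omega> \<zeta> \<eta>"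
    using assms unfolding schwartz_bilinear_def by blast+
  then show "\<omega> (\<lambda>t. \<xi> t + \<eta> t) \<zeta> = \<omega> \<xi> \<zeta> + \<omega> \<eta> \<zeta>" "\<omega> \<zeta> (\<lambda>t. \<xi> t + \<eta> t) = \<omega> \<zeta> \<xi> + \<omega> \<zeta> \<eta>"
    by simp_all
qed

lemma schwartz_bilinear_scale:
  assumes "schwartz_bilinear \<omega>" "\<xi> \<in> schwartz" "\<zeta> \<in> schwartz"
  shows "\<omega> (\<lambda>t. a *s \<xi> t) \<zeta> = a * \<omega> \<xi> \<zeta>" "\<omega> \<zeta> (\<lambda>t. a *s \<xi> t) = a * \<omega> \<zeta> \<xi>"
proof -
  have *: "\<omega> (\<lambda>t. a *s \<xi> t + 0 *s \<xi> t) \<zeta> = a * \<omega> \<xi> \<zeta> + 0 * \<omega> \<xi> \<zeta>"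
    "\<omega> \<zeta> (\<lambda>t. a *s \<xi> t + 0 *s \<xi> t) = a * \<omega> \<zeta> \<xi> + 0 * \<omega> \<zeta> \<xi>"
    using assms unfolding schwartz_bilinear_def by blast+
  then show "\<omega> (\<lambda>t. a *s \<xi> t) \<zeta> = a * \<omega> \<xi> \<zeta>" "\<omega> \<zeta> (\<lambda>t. a *s \<xi> t) = a * \<omega> \<zeta> \<xi>"
    by simp_all
qed

lemma schwartz_scaleR: "f \<in> schwartz \<Longrightarrow> (\<lambda>t. r *\<^sub>R f t) \<in> schwartz"
  by (rule schwartz_linear[OF bounded_linear_scaleR_right])

text \<open>Continuity at the origin gives |\<omega>| < 1 on a product neighbourhood; scaling the
  arguments to sizes d and e turns this into a global estimate.\<close>

lemma continuous_form_bound: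
  fixes \<omega> :: "'n::finite form"
  assumes bil: "schwartz_bilinear \<omega>" and cont: "continuous_form \<omega>"
  shows "\<exists>N. \<exists>K>0. \<forall>\<xi>\<in>schwartz. \<forall>\<eta>\<in>schwartz. \<forall>a>0. \<forall>b>0.
    seminorm_le N a \<xi> \<longrightarrow> seminorm_le N b \<eta> \<longrightarrow> norm (\<omega> \<xi> \<eta>) \<le> K * a * b"
proof -
  let ?T = "schwartz_topology :: (real \<Rightarrow> complex ^ 'n) topology"
  let ?S = "{x \<in> topspace (prod_topology ?T ?T). (\<lambda>(\<xi>, \<eta>). \<omega> \<xi> \<eta>) x \<in> ball 0 1}"
  \<comment> \<open>The space of a generated topology is the union of its generators, so 0 has to be
    placed in one of them; the unit ball for k = m = 0 serves.\<close>
  have "schwartz_seminorm 0 0 (\<lambda>t. (0 :: complex ^ 'n) - 0) < 1" by (simp add: schwartz_seminorm_def)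
  then have "(\<lambda>t. 0) \<in> {g \<in> schwartz. schwartz_seminorm 0 0 (\<lambda>t. g t - (0 :: complex ^ 'n)) < 1}"
    using schwartz_zero by simp
  moreover have "{g \<in> schwartz. schwartz_seminorm 0 0 (\<lambda>t. g t - (0 :: complex ^ 'n)) < 1} \<in>
      {{g \<in> schwartz. schwartz_seminorm k m (\<lambda>t. g t - f t) < \<epsilon>} | f k m \<epsilon>. f \<in> schwartz \<and> 0 < \<epsilon>}"
    by (rule CollectI, rule exI[of _ "\<lambda>t. 0"], rule exI[of _ 0], rule exI[of _ 0], rule exI[of _ 1])
       (simp add: schwartz_zero)
  ultimately have z: "(\<lambda>t. 0) \<in> topspace ?T"
    unfolding schwartz_topology_def topology_generated_by_topspace by (rule UnionI[rotated])
  have op: "openin (prod_topology ?T ?T) ?S"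
    using cont unfolding continuous_form_def
    by (rule openin_continuous_map_preimage) simp
  have "\<omega> (\<lambda>t. 0) (\<lambda>t. 0) = 0"
    using schwartz_bilinear_scale(1)[OF bil schwartz_zero schwartz_zero, of 0] by simp
  then have "((\<lambda>t. 0), (\<lambda>t. 0)) \<in> ?S" using z by simp
  then obtain U V where UV: "openin ?T U" "openin ?T V" "(\<lambda>t. 0) \<in> U" "(\<lambda>t. 0) \<in> V" "U \<times> V \<subseteq> ?S"
    using op unfolding openin_prod_topology_alt by meson
  obtain N d where N: "d > 0" "\<forall>g\<in>schwartz. seminorm_le N d g \<longrightarrow> g \<in> U"
    using schwartz_neighbourhood_zero[OF UV(1,3)] by blast
  obtain M e where M: "e > 0" "\<forall>g\<in>schwartz. seminorm_le M e g \<longrightarrow> g \<in> V"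
    using schwartz_neighbourhood_zero[OF UV(2,4)] by blast
  have "norm (\<omega> \<xi> \<eta>) \<le> (1 / (d * e)) * a * b"
    if S: "\<xi> \<in> schwartz" "\<eta> \<in> schwartz" and ab: "a > 0" "b > 0"
      and le: "seminorm_le (max N M) a \<xi>" "seminorm_le (max N M) b \<eta>" for \<xi> \<eta> a b
  proof -
    have le': "seminorm_le N a \<xi>" "seminorm_le M b \<eta>" using le unfolding seminorm_le_def by auto
    have "seminorm_le N ((d / a) * a) (\<lambda>t. (d / a) *\<^sub>R \<xi> t)"
      by (rule seminorm_le_linear[OF bounded_linear_scaleR_right schwartz_smooth[OF S(1)] le'(1)]) (use ab N in auto)
    then have u: "(\<lambda>t. (d / a) *\<^sub>R \<xi> t) \<in> U" using N(2) schwartz_scaleR[OF S(1)] ab by simp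
    have "seminorm_le M ((e / b) * b) (\<lambda>t. (e / b) *\<^sub>R \<eta> t)"
      by (rule seminorm_le_linear[OF bounded_linear_scaleR_right schwartz_smooth[OF S(2)] le'(2)]) (use ab M in auto)
    then have v: "(\<lambda>t. (e / b) *\<^sub>R \<eta> t) \<in> V" using M(2) schwartz_scaleR[OF S(2)] ab by simp
    have sv: "(\<lambda>t. of_real (e / b) *s \<eta> t) \<in> schwartz"
      using schwartz_scaleR[OF S(2), of "e / b"] by (simp only: of_real_vector_scale)
    have "norm (\<omega> (\<lambda>t. (d / a) *\<^sub>R \<xi> t) (\<lambda>t. (e / b) *\<^sub>R \<eta> t)) < 1"
      using subsetD[OF UV(5) SigmaI[OF u v]] by simp
    also have "\<omega> (\<lambda>t. (d / a) *\<^sub>R \<xi> t) (\<lambda>t. (e / b) *\<^sub>R \<eta> t) = of_real (d / a) * (of_real (e / b) * \<omega> \<xi> \<eta>)"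
      by (simp only: of_real_vector_scale[symmetric] schwartz_bilinear_scale(1)[OF bil S(1) sv]
          schwartz_bilinear_scale(2)[OF bil S(2) S(1)])
    finally have "(d / a) * ((e / b) * norm (\<omega> \<xi> \<eta>)) < 1"
      using ab N M by (simp add: norm_mult norm_divide)
    then show ?thesis using ab N M by (simp add: field_simps)
  qed
  then show ?thesis using N(1) M(1) by (intro exI[of _ "max N M"] exI[of _ "1 / (d * e)"]) auto
qed

section \<open>Reduction to scalar functions\<close>

definition of_vec :: "real ^ 'n \<Rightarrow> complex ^ 'n" where
  "of_vec X = Complex_vec X 0"

text \<open>Only real X: the maps \<open>Ad\<close> and the bracket are real, so their
  complexifications act on the vector factor while complex scalars stay in the function.\<close>

definition tensor :: "(real \<Rightarrow> complex) \<Rightarrow> real ^ 'n \<Rightarrow> real \<Rightarrow> complex ^ 'n" where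
  "tensor f X t = f t *s of_vec X"

lemma of_vec_nth [simp]: "of_vec X $ i = of_real (X $ i)"
  by (simp add: of_vec_def Complex_vec_def complex_of_real_def)

lemma Re_vec_scale: "Re_vec (z *s of_vec X) = Re z *\<^sub>R X"
  and Im_vec_scale: "Im_vec (z *s of_vec X) = Im z *\<^sub>R X"
  by (simp_all add: Re_vec_def Im_vec_def vec_eq_iff)

lemma Complex_vec_scale: "Complex_vec (a *\<^sub>R X) (b *\<^sub>R X) = Complex a b *s of_vec X"
  by (simp add: vec_eq_iff Complex_vec_def complex_eq_iff)

lemma complexify_scale:
  assumes "linear L" shows "complexify L (z *s of_vec X) = z *s of_vec (L X)"
  unfolding complexify_def Re_vec_scale Im_vec_scale linear_scale[OF assms] Complex_vec_scale by simp

lemma complexify2_scale: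
  assumes "bounded_bilinear br"
  shows "complexify2 br (z *s of_vec X) (w *s of_vec Y) = (z * w) *s of_vec (br X Y)"
proof -
  interpret bounded_bilinear br by fact
  have "complexify2 br (z *s of_vec X) (w *s of_vec Y) =
    Complex_vec ((Re z * Re w - Im z * Im w) *\<^sub>R br X Y) ((Re z * Im w + Im z * Re w) *\<^sub>R br X Y)"
    unfolding complexify2_def Re_vec_scale Im_vec_scale
    by (simp add: scaleR_left scaleR_right scaleR_add_left scaleR_diff_left mult.commute)
  moreover have "Complex (Re z * Re w - Im z * Im w) (Re z * Im w + Im z * Re w) = z * w"
    by (simp add: complex_eq_iff)
  ultimately show ?thesis unfolding Complex_vec_scale by (simp only:)
qed

lemma bounded_linear_vector_scale: "bounded_linear (\<lambda>z. z *s (v :: complex ^ 'n))"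
proof -
  have "linear (\<lambda>z. z *s v)"
    by (rule linearI) (simp_all add: vec_eq_iff distrib_right)
  then show ?thesis by (simp add: linear_conv_bounded_linear)
qed

lemma tensor_schwartz: "f \<in> schwartz \<Longrightarrow> tensor f X \<in> schwartz"
  unfolding tensor_def[abs_def] by (rule schwartz_linear[OF bounded_linear_vector_scale])

lemma tensor_add_left: "tensor (\<lambda>t. f t + g t) X = (\<lambda>t. tensor f X t + tensor g X t)"
  by (simp add: fun_eq_iff tensor_def vec_eq_iff distrib_right)

lemma tensor_add_right: "tensor f (X + Y) = (\<lambda>t. tensor f X t + tensor f Y t)"
  by (simp add: fun_eq_iff tensor_def vec_eq_iff distrib_left)

lemma tensor_scale_left: "tensor (\<lambda>t. c * f t) X = (\<lambda>t. c *s tensor f X t)"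
  by (simp add: fun_eq_iff tensor_def vec_eq_iff mult.assoc)

lemma tensor_scale_right: "tensor f (r *\<^sub>R X) = (\<lambda>t. of_real r *s tensor f X t)"
  by (simp add: fun_eq_iff tensor_def vec_eq_iff mult_ac)

lemma tensor_expansion: "\<xi> = (\<lambda>t. \<Sum>i\<in>UNIV. tensor (\<lambda>t. \<xi> t $ i) (axis i 1) t)"
  by (simp add: fun_eq_iff tensor_def vec_eq_iff axis_def if_distrib cong: if_cong)

lemma schwartz_component:
  fixes \<xi> :: "real \<Rightarrow> complex ^ 'n"
  assumes "\<xi> \<in> schwartz"
  shows "(\<lambda>t. \<xi> t $ i) \<in> schwartz" "vderiv (\<lambda>t. \<xi> t $ i) = (\<lambda>t. vderiv \<xi> t $ i)"
  using schwartz_linear[OF bounded_linear_vec_nth assms] vderiv_linear[OF bounded_linear_vec_nth schwartz_smooth[OF assms]]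
  by auto

lemma schwartz_sum:
  assumes "finite I" "\<And>i. i \<in> I \<Longrightarrow> F i \<in> schwartz"
  shows "(\<lambda>t. \<Sum>i\<in>I. F i t) \<in> schwartz"
  using assms by induction (simp_all add: schwartz_zero schwartz_add)

lemma schwartz_bilinear_sum:
  fixes F :: "'i \<Rightarrow> real \<Rightarrow> complex ^ 'n"
  assumes "finite I" "\<And>i. i \<in> I \<Longrightarrow> F i \<in> schwartz" "schwartz_bilinear \<omega>" "\<zeta> \<in> schwartz"
  shows "\<omega> (\<lambda>t. \<Sum>i\<in>I. F i t) \<zeta> = (\<Sum>i\<in>I. \<omega> (F i) \<zeta>)" "\<omega> \<zeta> (\<lambda>t. \<Sum>i\<in>I. F i t) = (\<Sum>i\<in>I. \<omega> \<zeta> (F i))"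
proof -
  have "\<omega> (\<lambda>t. \<Sum>i\<in>I. F i t) \<zeta> = (\<Sum>i\<in>I. \<omega> (F i) \<zeta>) \<and> \<omega> \<zeta> (\<lambda>t. \<Sum>i\<in>I. F i t) = (\<Sum>i\<in>I. \<omega> \<zeta> (F i))"
    using assms(1,2)
  proof induction
    case empty
    then show ?case
      using schwartz_bilinear_scale(1)[OF assms(3) schwartz_zero assms(4), of 0]
        schwartz_bilinear_scale(2)[OF assms(3) schwartz_zero assms(4), of 0] by simp
  next
    case (insert i I)
    have s: "F i \<in> schwartz" "(\<lambda>t. \<Sum>i\<in>I. F i t) \<in> schwartz"
      using insert by (auto intro: schwartz_sum)
    show ?case
      using insert schwartz_bilinear_add[OF assms(3) s assms(4)] by simp
  qed
  then show "\<omega> (\<lambda>t. \<Sum>i\<in>I. F i t) \<zeta> = (\<Sum>i\<in>I. \<omega> (F i) \<zeta>)" "\<omega> \<zeta> (\<lambda>t. \<Sum>i\<in>I. F i t) = (\<Sum>i\<in>I. \<omega> \<zeta> (F i))"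
    by blast+
qed

lemma bounded_bilinear_Re_Im:
  fixes \<phi> :: "real ^ 'n \<Rightarrow> real ^ 'n \<Rightarrow> complex"
  assumes "\<And>X Y Z. \<phi> (X + Y) Z = \<phi> X Z + \<phi> Y Z" "\<And>X Y Z. \<phi> Z (X + Y) = \<phi> Z X + \<phi> Z Y"
    "\<And>r X Z. \<phi> (r *\<^sub>R X) Z = of_real r * \<phi> X Z" "\<And>r X Z. \<phi> Z (r *\<^sub>R X) = of_real r * \<phi> Z X"
  shows "bounded_bilinear (\<lambda>X Y. Re (\<phi> X Y))" "bounded_bilinear (\<lambda>X Y. Im (\<phi> X Y))"
proof -
  have "bilinear (\<lambda>X Y. Re (\<phi> X Y))" "bilinear (\<lambda>X Y. Im (\<phi> X Y))"
    unfolding bilinear_def by (auto intro!: linearI simp: assms)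
  then show "bounded_bilinear (\<lambda>X Y. Re (\<phi> X Y))" "bounded_bilinear (\<lambda>X Y. Im (\<phi> X Y))"
    by (simp_all add: bilinear_conv_bounded_bilinear)
qed

text \<open>Compactness of the group survives here as the positive definite invariant form
  \<open>ip\<close>.\<close>

locale compact_simple =
  fixes br :: "real ^ 'n \<Rightarrow> real ^ 'n \<Rightarrow> real ^ 'n" and ip :: "real ^ 'n \<Rightarrow> real ^ 'n \<Rightarrow> real"
  assumes simple: "simple_lie_algebra br" and br: "bounded_bilinear br" and anti: "br v w = - br w v"
    and ip: "bounded_bilinear ip" and ip_sym: "ip x y = ip y x" and ip_pos: "x \<noteq> 0 \<Longrightarrow> ip x x > 0"
    and ip_inv: "ip (br v x) y + ip x (br v y) = 0"
begin

text \<open>Real and imaginary part are invariant real forms, each a real multiple of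
  \<open>ip\<close>.\<close>

lemma complex_form_unique:
  assumes add: "\<And>X Y Z. \<phi> (X + Y) Z = \<phi> X Z + \<phi> Y Z" "\<And>X Y Z. \<phi> Z (X + Y) = \<phi> Z X + \<phi> Z Y"
    and scale: "\<And>r X Z. \<phi> (r *\<^sub>R X) Z = of_real r * \<phi> X Z" "\<And>r X Z. \<phi> Z (r *\<^sub>R X) = of_real r * \<phi> Z X"
    and inv: "\<And>v x y. \<phi> (br v x) y + \<phi> x (br v y) = (0::complex)"
  shows "\<exists>k. \<forall>x y. \<phi> x y = k * of_real (ip x y)"
proof -
  have R: "Re (\<phi> (br v x) y) + Re (\<phi> x (br v y)) = 0" "Im (\<phi> (br v x) y) + Im (\<phi> x (br v y)) = 0" for v x y
    using arg_cong[OF inv, of Re v x y] arg_cong[OF inv, of Im v x y] by simp_all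
  have bb: "bounded_bilinear (\<lambda>x y. Re (\<phi> x y))" "bounded_bilinear (\<lambda>x y. Im (\<phi> x y))"
    by (rule bounded_bilinear_Re_Im; rule add scale)+
  have "\<exists>k. \<forall>x y. Re (\<phi> x y) = k * ip x y"
    by (rule invariant_form_unique[where br=br and ip=ip and \<beta>="\<lambda>x y. Re (\<phi> x y)"])
       (rule simple anti ip ip_sym ip_pos ip_inv bb(1) R(1) | assumption)+
  then obtain k where k: "\<forall>x y. Re (\<phi> x y) = k * ip x y" ..
  have "\<exists>k. \<forall>x y. Im (\<phi> x y) = k * ip x y"
    by (rule invariant_form_unique[where br=br and ip=ip and \<beta>="\<lambda>x y. Im (\<phi> x y)"])
       (rule simple anti ip ip_sym ip_pos ip_inv bb(2) R(2) | assumption)+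
  then obtain l where l: "\<forall>x y. Im (\<phi> x y) = l * ip x y" ..
  show ?thesis using k l by (intro exI[of _ "Complex k l"]) (simp add: complex_eq_iff)
qed

lemma form_classification:
  assumes B: "invariant_symmetric_form (complexify2 br) B" "\<exists>x y. B x y \<noteq> 0"
    and coc: "two_cocycle (complexify2 br) \<omega>" and cont: "continuous_form \<omega>" and transl: "translation_invariant \<omega>"
    and inv: "\<And>f h v X Y. f \<in> schwartz \<Longrightarrow> h \<in> schwartz \<Longrightarrow>
      \<omega> (tensor f (br v X)) (tensor h Y) + \<omega> (tensor f X) (tensor h (br v Y)) = 0"
  shows "\<exists>k. \<forall>\<xi>\<in>schwartz. \<forall>\<eta>\<in>schwartz. \<omega> \<xi> \<eta> = k * (LINT t|lborel. B (\<xi> t) (vderiv \<eta> t))"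
proof -
  have bil: "schwartz_bilinear \<omega>" using coc by (simp add: two_cocycle_def)
  note bilD = schwartz_bilinear_add[OF bil] schwartz_bilinear_scale[OF bil]
  note S = tensor_schwartz
  obtain X0 Y0 where nz: "br X0 Y0 \<noteq> 0" using simple unfolding simple_lie_algebra_def by blast
  define q where "q = ip X0 X0"
  have "X0 \<noteq> 0" using nz bounded_bilinear.zero_left[OF br] by auto
  then have q: "q > 0" using ip_pos by (simp add: q_def)
  \<comment> \<open>The factor of \<open>ip\<close> is read off at X = Y = X0, where
    \<open>ip\<close> is positive; this formula is visibly bilinear in f and h.\<close>
  define D where "D f h = \<omega> (tensor f X0) (tensor h X0) / of_real q" for f h
  have D: "\<omega> (tensor f X) (tensor h Y) = D f h * of_real (ip X Y)" if fh: "f \<in> schwartz" "h \<in> schwartz" for f h X Y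
  proof -
    have "\<exists>k. \<forall>X Y. \<omega> (tensor f X) (tensor h Y) = k * of_real (ip X Y)"
    proof (rule complex_form_unique)
      show "\<omega> (tensor f (br v x)) (tensor h y) + \<omega> (tensor f x) (tensor h (br v y)) = 0" for v x y
        by (rule inv[OF fh])
    qed (simp_all add: tensor_add_right tensor_scale_right bilD S fh)
    then obtain k where k: "\<And>X Y. \<omega> (tensor f X) (tensor h Y) = k * of_real (ip X Y)" by blast
    have "D f h = k" using q by (simp add: D_def k q_def)
    then show ?thesis by (simp add: k)
  qed
  have brt: "(\<lambda>t. complexify2 br (tensor f X t) (tensor g Y t)) = tensor (\<lambda>t. f t * g t) (br X Y)" for f g X Y
    by (simp add: fun_eq_iff tensor_def complexify2_scale[OF br])
  obtain N K where K: "K > 0" "\<And>\<xi> \<eta> a b. \<xi> \<in> schwartz \<Longrightarrow> \<eta> \<in> schwartz \<Longrightarrow> a > 0 \<Longrightarrow> b > 0 \<Longrightarrow>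
      seminorm_le N a \<xi> \<Longrightarrow> seminorm_le N b \<eta> \<Longrightarrow> norm (\<omega> \<xi> \<eta>) \<le> K * a * b"
    using continuous_form_bound[OF bil cont] by blast
  \<comment> \<open>The summand 1 makes \<open>M\<close> positive, as the estimates require.\<close>
  define M where "M = onorm (\<lambda>z. z *s of_vec X0) + 1"
  have M: "M > 0" "norm (z *s of_vec X0) \<le> M * norm z" for z
  proof -
    show "M > 0" using onorm_pos_le[OF bounded_linear_vector_scale, of "of_vec X0"] by (simp add: M_def)
    show "norm (z *s of_vec X0) \<le> M * norm z"
      using onorm[OF bounded_linear_vector_scale, of z "of_vec X0"] by (simp add: M_def distrib_right add_increasing2)
  qed
  interpret D: cyclic_cocycle D N "K * M * M / q"
  proof
    fix f g h :: "real \<Rightarrow> complex" assume "f \<in> schwartz" "g \<in> schwartz" "h \<in> schwartz"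
    then show "D (\<lambda>t. f t + g t) h = D f h + D g h"
      by (simp add: D_def tensor_add_left bilD S add_divide_distrib)
  next
    fix f h :: "real \<Rightarrow> complex" and c assume "f \<in> schwartz" "h \<in> schwartz"
    then show "D (\<lambda>t. c * f t) h = c * D f h"
      by (simp add: D_def tensor_scale_left bilD S)
  next
    fix f g :: "real \<Rightarrow> complex" assume "f \<in> schwartz" "g \<in> schwartz"
    then have "\<omega> (tensor f X0) (tensor g X0) = - \<omega> (tensor g X0) (tensor f X0)"
      using coc S unfolding two_cocycle_def by blast
    then show "D f g = - D g f" by (simp add: D_def)
  next
    fix f g h assume T: "f \<in> test_functions" "g \<in> test_functions" "h \<in> test_functions"
    note s = test_schwartz[OF T(1)] test_schwartz[OF T(2)] test_schwartz[OF T(3)]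
    note s2 = test_schwartz[OF test_mult[OF T(1,2)]] test_schwartz[OF test_mult[OF T(2,3)]] test_schwartz[OF test_mult[OF T(3,1)]]
    \<comment> \<open>With Z = [X0, Y0] the cyclic number \<open>ip (br X0 Y0) Z\<close> is a
      squared length, hence nonzero, and can be cancelled from the cocycle identity on X0, Y0,
      Z.\<close>
    define Z where "Z = br X0 Y0"
    have p: "ip (br X0 Y0) Z > 0" unfolding Z_def by (rule ip_pos[OF nz])
    have p1: "ip (br Y0 Z) X0 = ip (br X0 Y0) Z"
      using ip_inv[of Y0 Z X0] anti[of X0 Y0] ip_sym[of Z "br X0 Y0"]
      by (simp add: bounded_bilinear.minus_right[OF ip])
    have p2: "ip (br Z X0) Y0 = ip (br X0 Y0) Z"
      using ip_inv[of X0 Z Y0] anti[of Z X0] ip_sym[of Z "br X0 Y0"]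
      by (simp add: bounded_bilinear.minus_left[OF ip])
    have "\<omega> (\<lambda>t. complexify2 br (tensor f X0 t) (tensor g Y0 t)) (tensor h Z) +
        \<omega> (\<lambda>t. complexify2 br (tensor g Y0 t) (tensor h Z t)) (tensor f X0) +
        \<omega> (\<lambda>t. complexify2 br (tensor h Z t) (tensor f X0 t)) (tensor g Y0) = 0"
      using coc S[OF s(1)] S[OF s(2)] S[OF s(3)] unfolding two_cocycle_def by blast
    then have "(D (\<lambda>t. f t * g t) h + D (\<lambda>t. g t * h t) f + D (\<lambda>t. h t * f t) g) * of_real (ip (br X0 Y0) Z) = 0"
      unfolding brt D[OF s2(1) s(3)] D[OF s2(2) s(1)] D[OF s2(3) s(2)] p1 p2 by (simp add: distrib_right)
    then show "D (\<lambda>t. f t * g t) h + D (\<lambda>t. g t * h t) f + D (\<lambda>t. h t * f t) g = 0" using p by simp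
  next
    fix f g a assume "f \<in> test_functions" "g \<in> test_functions"
    then have "\<omega> (\<lambda>t. tensor f X0 (t - a)) (\<lambda>t. tensor g X0 (t - a)) = \<omega> (tensor f X0) (tensor g X0)"
      using transl S[OF test_schwartz] unfolding translation_invariant_def by blast
    then show "D (\<lambda>t. f (t - a)) (\<lambda>t. g (t - a)) = D f g"
      by (simp add: D_def tensor_def[abs_def])
  next
    fix f g :: "real \<Rightarrow> complex" and a b :: real
    assume s: "f \<in> schwartz" "g \<in> schwartz" and ab: "0 < a" "0 < b" and le: "seminorm_le N a f" "seminorm_le N b g"
    have "seminorm_le N (M * a) (tensor f X0)" "seminorm_le N (M * b) (tensor g X0)"
      unfolding tensor_def[abs_def]
      by (rule seminorm_le_linear[OF bounded_linear_vector_scale schwartz_smooth]; use s le M in \<open>auto intro: less_imp_le\<close>)+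
    then have "norm (\<omega> (tensor f X0) (tensor g X0)) \<le> K * (M * a) * (M * b)"
      by (intro K(2) S s) (use ab M in auto)
    then show "norm (D f g) \<le> K * M * M / q * a * b"
      using q by (simp add: D_def norm_divide divide_right_mono mult_ac)
  next
    show "0 < K * M * M / q" using K(1) M(1) q by simp
  qed
  obtain c where c: "\<And>f g. f \<in> schwartz \<Longrightarrow> g \<in> schwartz \<Longrightarrow> D f g = c * (LINT t|lborel. f t * vderiv g t)"
    using D.classification by blast
  have Bl: "Vector_Spaces.linear (*s) (*) (B x)" and Bs: "B x y = B y x"
    and Bi: "B (complexify2 br x y) z + B y (complexify2 br x z) = 0" for x y z
    using B(1) unfolding invariant_symmetric_form_def by blast+
  have Badd: "B x (y + z) = B x y + B x z" and Bscale: "B x (a *s y) = a * B x y" for a x y z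
    using Vector_Spaces.linear.axioms(3)[OF Bl[of x]] unfolding module_hom_def module_hom_axioms_def by auto
  have Badd': "B (y + z) x = B y x + B z x" and Bscale': "B (a *s y) x = a * B y x" for a x y z
    using Badd Bscale Bs by metis+
  have Bsum: "B x (\<Sum>i\<in>I. f i) = (\<Sum>i\<in>I. B x (f i))" "B (\<Sum>i\<in>I. f i) x = (\<Sum>i\<in>I. B (f i) x)" for x I and f :: "'n \<Rightarrow> complex ^ 'n"
  proof -
    have "B x 0 = 0" for x using Bscale[of x 0 0] by simp
    then show 1: "B x (\<Sum>i\<in>I. f i) = (\<Sum>i\<in>I. B x (f i))" for x
      by (induction I rule: infinite_finite_induct) (simp_all add: Badd)
    have "B (\<Sum>i\<in>I. f i) x = (\<Sum>i\<in>I. B x (f i))" by (rule trans[OF Bs 1])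
    also have "\<dots> = (\<Sum>i\<in>I. B (f i) x)" by (rule sum.cong[OF refl Bs])
    finally show "B (\<Sum>i\<in>I. f i) x = (\<Sum>i\<in>I. B (f i) x)" .
  qed
  have cbr: "complexify2 br (of_vec X) (of_vec Y) = of_vec (br X Y)" for X Y
    using complexify2_scale[OF br, of 1 X 1 Y] by simp
  have ov: "of_vec (X + Y) = of_vec X + of_vec Y" "of_vec (r *\<^sub>R X) = of_real r *s of_vec X" for X Y :: "real ^ 'n" and r
    by (simp_all add: vec_eq_iff)
  \<comment> \<open>On real vectors \<open>B\<close> is an invariant form too, hence a multiple of
    \<open>ip\<close>. Since these values determine \<open>B\<close>, the factor is nonzero, and the
    constant for \<open>ip\<close> can be converted into one for \<open>B\<close>.\<close>
  have "\<exists>k. \<forall>X Y. B (of_vec X) (of_vec Y) = k * of_real (ip X Y)"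
  proof (rule complex_form_unique)
    show "B (of_vec (br v x)) (of_vec y) + B (of_vec x) (of_vec (br v y)) = 0" for v x y
      using Bi[of "of_vec v" "of_vec x" "of_vec y"] by (simp add: cbr)
  qed (simp_all add: ov Badd Badd' Bscale Bscale')
  then obtain k where k: "\<And>X Y. B (of_vec X) (of_vec Y) = k * of_real (ip X Y)" by blast
  let ?e = "\<lambda>i. axis i 1 :: real ^ 'n"
  have rep: "x = (\<Sum>i\<in>UNIV. (x $ i) *s of_vec (?e i))" for x :: "complex ^ 'n"
    by (simp add: vec_eq_iff axis_def if_distrib cong: if_cong)
  have Brep: "B x y = k * (\<Sum>i\<in>UNIV. \<Sum>j\<in>UNIV. of_real (ip (?e i) (?e j)) * (x $ i * y $ j))" for x y
  proof -
    have "B x y = B (\<Sum>i\<in>UNIV. (x $ i) *s of_vec (?e i)) (\<Sum>j\<in>UNIV. (y $ j) *s of_vec (?e j))"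
      by (rule arg_cong2[OF rep rep])
    also have "\<dots> = (\<Sum>i\<in>UNIV. \<Sum>j\<in>UNIV. x $ i * (y $ j * (k * of_real (ip (?e i) (?e j)))))"
      by (simp only: Bsum Bscale Bscale' k sum_distrib_left) (subst sum.swap, simp only: mult.left_commute)
    finally show ?thesis by (simp add: sum_distrib_left mult_ac)
  qed
  then have k0: "k \<noteq> 0" using B(2) by auto
  have "\<omega> \<xi> \<eta> = (c / k) * (LINT t|lborel. B (\<xi> t) (vderiv \<eta> t))" if s: "\<xi> \<in> schwartz" "\<eta> \<in> schwartz" for \<xi> \<eta>
  proof -
    note cs = schwartz_component[OF s(1)] schwartz_component[OF s(2)]
    define F where "F i = tensor (\<lambda>t. \<xi> t $ i) (?e i)" for i
    define H where "H j = tensor (\<lambda>t. \<eta> t $ j) (?e j)" for j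
    have F: "F i \<in> schwartz" and H: "H i \<in> schwartz" for i
      unfolding F_def H_def by (rule S[OF cs(1)], rule S[OF cs(3)])
    have Hs: "(\<lambda>t. \<Sum>j\<in>UNIV. H j t) \<in> schwartz" by (rule schwartz_sum[OF finite H])
    have "\<omega> \<xi> \<eta> = \<omega> (\<lambda>t. \<Sum>i\<in>UNIV. F i t) (\<lambda>t. \<Sum>j\<in>UNIV. H j t)"
      unfolding F_def H_def by (rule arg_cong2[OF tensor_expansion tensor_expansion])
    also have "\<dots> = (\<Sum>i\<in>UNIV. \<omega> (F i) (\<lambda>t. \<Sum>j\<in>UNIV. H j t))"
      by (rule schwartz_bilinear_sum(1)[OF finite F bil Hs])
    also have "\<dots> = (\<Sum>i\<in>UNIV. \<Sum>j\<in>UNIV. \<omega> (F i) (H j))"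
      by (rule sum.cong[OF refl schwartz_bilinear_sum(2)[OF finite H bil F]])
    also have "\<dots> = (\<Sum>i\<in>UNIV. \<Sum>j\<in>UNIV. \<omega> (tensor (\<lambda>t. \<xi> t $ i) (?e i)) (tensor (\<lambda>t. \<eta> t $ j) (?e j)))"
      by (simp only: F_def H_def)
    also have "\<dots> = (\<Sum>i\<in>UNIV. \<Sum>j\<in>UNIV. c * (LINT t|lborel. \<xi> t $ i * vderiv \<eta> t $ j) * of_real (ip (?e i) (?e j)))"
      by (simp only: D[OF cs(1) cs(3)] c[OF cs(1) cs(3)] cs(4))
    finally have 1: "\<omega> \<xi> \<eta> = c * (\<Sum>i\<in>UNIV. \<Sum>j\<in>UNIV. of_real (ip (?e i) (?e j)) * (LINT t|lborel. \<xi> t $ i * vderiv \<eta> t $ j))"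
      by (simp add: sum_distrib_left mult_ac)
    have int: "integrable lborel (\<lambda>t. \<xi> t $ i * vderiv \<eta> t $ j)" for i j
      using schwartz_integrable[OF cs(1)[of i] cs(3)[of j]] by (simp only: cs(4))
    have "(LINT t|lborel. B (\<xi> t) (vderiv \<eta> t)) = k * (\<Sum>i\<in>UNIV. \<Sum>j\<in>UNIV. of_real (ip (?e i) (?e j)) * (LINT t|lborel. \<xi> t $ i * vderiv \<eta> t $ j))"
      unfolding Brep by (simp add: int)
    then show ?thesis using k0 unfolding 1 by simp
  qed
  then show ?thesis by blast
qed

end

section \<open>From the Lie group to the algebraic classification\<close>

theorem theorem4p3:
  fixes G :: "'g::{t2_space,second_countable_topology} monoid"
    and A :: "('g, real ^ 'n) chart set"
    and c :: "('g, real ^ 'n) chart"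
    and B :: "complex ^ 'n \<Rightarrow> complex ^ 'n \<Rightarrow> complex"
    and \<omega> :: "(real \<Rightarrow> complex ^ 'n) \<Rightarrow> (real \<Rightarrow> complex ^ 'n) \<Rightarrow> complex"
  assumes "lie_group G A"
    and "compact (UNIV :: 'g set)"
    and "simply_connected (UNIV :: 'g set)"
    and "c \<in> A" and "\<one>\<^bsub>G\<^esub> \<in> fst c"
    and "simple_lie_algebra (lie_bracket G c)"
    and "invariant_symmetric_form (complexify2 (lie_bracket G c)) B"
    and "\<exists>x y. B x y \<noteq> 0"
    and "two_cocycle (complexify2 (lie_bracket G c)) \<omega>"
    and "continuous_form \<omega>"
    and "translation_invariant \<omega>"
    and "group_invariant G c \<omega>"
  shows "\<exists>k. \<forall>\<xi>\<in>schwartz. \<forall>\<eta>\<in>schwartz.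
           \<omega> \<xi> \<eta> = k / (2 * of_real pi * \<i>) * (LINT t|lborel. B (\<xi> t) (vderiv \<eta> t))"
proof -
  interpret lie_chart G A c using assms by unfold_locales
  obtain Q :: "real ^ 'n ^ 'n" where Q: "\<And>x y. x \<bullet> (Q *v y) = y \<bullet> (Q *v x)" "\<And>x. x \<noteq> 0 \<Longrightarrow> x \<bullet> (Q *v x) > 0"
    "\<And>g x y. Ad G c g x \<bullet> (Q *v Ad G c g y) = x \<bullet> (Q *v y)"
    using invariant_inner_product[OF lie_chart_axioms assms(2)] by blast
  have "bilinear (\<lambda>x y. x \<bullet> (Q *v y))"
    unfolding bilinear_def
    by (auto intro!: linearI simp: inner_add_left inner_add_right matrix_vector_right_distrib matrix_vector_mult_scaleR)
  then have ipb: "bounded_bilinear (\<lambda>x y. x \<bullet> (Q *v y))" by (simp add: bilinear_conv_bounded_bilinear)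
  interpret compact_simple br "\<lambda>x y. x \<bullet> (Q *v y)"
  proof (rule compact_simple.intro[OF assms(6) bracket_bilinear bracket_antisym[OF assms(6)] ipb])
    show "x \<bullet> (Q *v y) = y \<bullet> (Q *v x)" for x y by (rule Q(1))
    show "x \<bullet> (Q *v x) > 0" if "x \<noteq> 0" for x by (rule Q(2)[OF that])
    show "br v x \<bullet> (Q *v y) + x \<bullet> (Q *v br v y) = 0" for v x y
      by (rule invariant_form_derivative[OF ipb]) (rule Q(3))
  qed
  have bil: "schwartz_bilinear \<omega>" using assms(9) by (simp add: two_cocycle_def)
  \<comment> \<open>Group invariance is differentiated for fixed f and h: as a function of X and Y
    the form lives on a finite-dimensional space, and its real and imaginary parts are
    \<open>Ad\<close>-invariant bilinear forms.\<close>
  have inv: "\<omega> (tensor f (br v X)) (tensor h Y) + \<omega> (tensor f X) (tensor h (br v Y)) = 0"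
    if fh: "f \<in> schwartz" "h \<in> schwartz" for f h v X Y
  proof -
    define \<phi> where "\<phi> X Y = \<omega> (tensor f X) (tensor h Y)" for X Y
    have cx: "(\<lambda>t. complexify (Ad G c g) (tensor f X t)) = tensor f (Ad G c g X)" for g f X
      by (simp add: tensor_def[abs_def] complexify_scale[OF bounded_linear.linear[OF Ad_linear]])
    have g: "\<phi> (Ad G c g X) (Ad G c g Y) = \<phi> X Y" for g X Y
    proof -
      \<comment> \<open>\<open>group_invariant\<close> acts by the inverse; taken at the inverse of
        g it gives \<open>Ad G c g\<close>.\<close>
      have "\<omega> (\<lambda>t. complexify (Ad G c (inv\<^bsub>G\<^esub> (inv\<^bsub>G\<^esub> g))) (tensor f X t))
          (\<lambda>t. complexify (Ad G c (inv\<^bsub>G\<^esub> (inv\<^bsub>G\<^esub> g))) (tensor h Y t)) = \<omega> (tensor f X) (tensor h Y)"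
        using assms(12) tensor_schwartz[OF fh(1), of X] tensor_schwartz[OF fh(2), of Y]
        unfolding group_invariant_def carrier_UNIV by blast
      then show ?thesis unfolding cx by (simp add: \<phi>_def)
    qed
    have a: "\<phi> (X + Y) Z = \<phi> X Z + \<phi> Y Z" "\<phi> Z (X + Y) = \<phi> Z X + \<phi> Z Y"
      "\<phi> (r *\<^sub>R X) Z = of_real r * \<phi> X Z" "\<phi> Z (r *\<^sub>R X) = of_real r * \<phi> Z X" for X Y Z r
      by (simp_all add: \<phi>_def tensor_add_right tensor_scale_right schwartz_bilinear_add[OF bil] schwartz_bilinear_scale[OF bil] tensor_schwartz fh)
    have "Re (\<phi> (br v X) Y) + Re (\<phi> X (br v Y)) = 0"
      by (rule invariant_form_derivative[OF bounded_bilinear_Re_Im(1)[OF a]]) (simp add: g)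
    moreover have "Im (\<phi> (br v X) Y) + Im (\<phi> X (br v Y)) = 0"
      by (rule invariant_form_derivative[OF bounded_bilinear_Re_Im(2)[OF a]]) (simp add: g)
    ultimately show ?thesis by (simp add: \<phi>_def complex_eq_iff)
  qed
  obtain k where "\<forall>\<xi>\<in>schwartz. \<forall>\<eta>\<in>schwartz. \<omega> \<xi> \<eta> = k * (LINT t|lborel. B (\<xi> t) (vderiv \<eta> t))"
    using form_classification[OF assms(7-11) inv] by blast
  \<comment> \<open>The constant absorbs the normalisation 1/(2 pi i).\<close>
  then show ?thesis by (intro exI[of _ "k * (2 * of_real pi * \<i>)"]) simp
qed

end
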